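(* Let $V_0>0$ be a constant and let $f:\mathbb{R}\to\mathbb{R}$ be a $C^1$ function satisfying $(f_1)$–$(f_5)$ (with $\theta>2$ from $(f_3)$ and $p>2$, $C_p>0$ from $(f_5)$). Assume $$C_p>\left[\chi_p\frac{2\theta}{\theta-2}\right]^{(p-2)/2},$$ where $\chi_p=\inf_{u\in\mathcal{M}_{B_1(0)}}J_p(u)$, with $$J_p(u)=\frac12\int_{B_1(0)}\big(|\nabla u|^2+V_0|u|^2\big)dx-\frac1p\int_{B_1(0)}|u|^p\,dx,\quad u\in H_0^1(B_1(0)),$$ $$\mathcal{M}_{B_1(0)}=\{u\in H_0^1(B_1(0)):\ u^\pm\neq0,\ J_p'(u^\pm)u^\pm=0\}.$$ Then the autonomous problem $-\Delta u+V_0u=f(u)$ in $\mathbb{R}^2$, $u\in H^1(\mathbb{R}^2)$, does not have a least energy nodal solution; that is, the infimum $\hat c=\inf_{u\in\mathcal{M}}J(u)$ is not attained, where $J(u)=\frac12\int_{\mathbb{R}^2}(|\nabla u|^2+V_0u^2)dx-\int_{\mathbb{R}^2}F(u)dx$ on $H^1(\mathbb{R}^2)$ and $\mathcal{M}=\{u\in H^1(\mathbb{R}^2): u^\pm\neq0,\ J'(u^\pm)u^\pm=0\}$.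
   Context: Hypotheses on $f$: $(f_1)$ there is $C>0$ with $|f(s)|\le Ce^{4\pi s^2}$ for all $s\in\mathbb{R}$; $(f_2)$ $\lim_{s\to0}f(s)/s=0$; $(f_3)$ there is $\theta>2$ with $0<\theta F(s)\le sf(s)$ for all $s\neq0$, where $F(s)=\int_0^sf(t)\,dt$; $(f_4)$ $s\mapsto f(s)/|s|$ is strictly increasing on $(0,+\infty)$; $(f_5)$ there are $p>2$, $C_p>0$ with $\mathrm{sign}(s)f(s)\ge C_p|s|^{p-1}$ for all $s\neq0$. Notation: $u^+=\max\{u,0\}$, $u^-=\min\{u,0\}$. A least energy nodal solution is a $u\in\mathcal{M}$ with $J(u)=\hat c$ and $J'(u)=0$. *)

theory Defs
  imports "HOL-Analysis.Analysis"
begin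

type_synonym R2 = "real ^ 2"

coinductive smooth2 :: "(R2 \<Rightarrow> real) \<Rightarrow> bool" where
  "(\<forall>x. \<phi> differentiable (at x)) \<Longrightarrow>
   (\<forall>v. smooth2 (\<lambda>x. frechet_derivative \<phi> (at x) v)) \<Longrightarrow> smooth2 \<phi>"

definition supp2 :: "(R2 \<Rightarrow> real) \<Rightarrow> R2 set" where
  "supp2 \<phi> = closure {x. \<phi> x \<noteq> 0}"

definition test_fun :: "R2 set \<Rightarrow> (R2 \<Rightarrow> real) \<Rightarrow> bool" where
  "test_fun U \<phi> \<longleftrightarrow> smooth2 \<phi> \<and> compact (supp2 \<phi>) \<and> supp2 \<phi> \<subseteq> U"

definition cgrad :: "(R2 \<Rightarrow> real) \<Rightarrow> R2 \<Rightarrow> R2" where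
  "cgrad \<phi> x = (\<chi> i. frechet_derivative \<phi> (at x) (axis i 1))"

definition has_weak_grad :: "(R2 \<Rightarrow> real) \<Rightarrow> (R2 \<Rightarrow> R2) \<Rightarrow> bool" where
  "has_weak_grad u g \<longleftrightarrow>
     (\<forall>\<phi>. test_fun UNIV \<phi> \<longrightarrow> (\<forall>i.
        (\<integral>x. u x * cgrad \<phi> x $ i \<partial>lebesgue) = - (\<integral>x. g x $ i * \<phi> x \<partial>lebesgue)))"

definition wgrad :: "(R2 \<Rightarrow> real) \<Rightarrow> R2 \<Rightarrow> R2" where
  "wgrad u = (SOME g. g \<in> borel_measurable lebesgue \<and> has_weak_grad u g)"

definition H1 :: "(R2 \<Rightarrow> real) set" where
  "H1 = {u. u \<in> borel_measurable lebesgue \<and> integrable lebesgue (\<lambda>x. (u x)\<^sup>2) \<and>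
            (\<exists>g. g \<in> borel_measurable lebesgue \<and> has_weak_grad u g \<and>
                 integrable lebesgue (\<lambda>x. (norm (g x))\<^sup>2))}"

text \<open>H^1_0(U): closure of C_c^infinity(U) in the H^1 norm (functions extended by zero).\<close>
definition H01 :: "R2 set \<Rightarrow> (R2 \<Rightarrow> real) set" where
  "H01 U = {u \<in> H1. \<exists>\<phi>. (\<forall>n. test_fun U (\<phi> n)) \<and>
      (\<lambda>n. (\<integral>x. (\<phi> n x - u x)\<^sup>2 \<partial>lebesgue)
            + (\<integral>x. (norm (cgrad (\<phi> n) x - wgrad u x))\<^sup>2 \<partial>lebesgue)) \<longlonglongrightarrow> 0}"

definition pos_part :: "(R2 \<Rightarrow> real) \<Rightarrow> R2 \<Rightarrow> real" where
  "pos_part u = (\<lambda>x. max (u x) 0)"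

definition neg_part :: "(R2 \<Rightarrow> real) \<Rightarrow> R2 \<Rightarrow> real" where
  "neg_part u = (\<lambda>x. min (u x) 0)"

definition nonzero :: "(R2 \<Rightarrow> real) \<Rightarrow> bool" where
  "nonzero u \<longleftrightarrow> \<not> (AE x in lebesgue. u x = 0)"

definition Fprim :: "(real \<Rightarrow> real) \<Rightarrow> real \<Rightarrow> real" where
  "Fprim f s = (if 0 \<le> s then integral {0..s} f else - integral {s..0} f)"

definition Jfun :: "real \<Rightarrow> (real \<Rightarrow> real) \<Rightarrow> (R2 \<Rightarrow> real) \<Rightarrow> real" where
  "Jfun V0 f u = 1/2 * (\<integral>x. (norm (wgrad u x))\<^sup>2 + V0 * (u x)\<^sup>2 \<partial>lebesgue)
                 - (\<integral>x. Fprim f (u x) \<partial>lebesgue)"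

definition dJ :: "real \<Rightarrow> (real \<Rightarrow> real) \<Rightarrow> (R2 \<Rightarrow> real) \<Rightarrow> (R2 \<Rightarrow> real) \<Rightarrow> real" where
  "dJ V0 f u v = (\<integral>x. wgrad u x \<bullet> wgrad v x + V0 * u x * v x \<partial>lebesgue)
                 - (\<integral>x. f (u x) * v x \<partial>lebesgue)"

definition Mset :: "real \<Rightarrow> (real \<Rightarrow> real) \<Rightarrow> (R2 \<Rightarrow> real) set" where
  "Mset V0 f = {u \<in> H1. nonzero (pos_part u) \<and> nonzero (neg_part u) \<and>
                  dJ V0 f (pos_part u) (pos_part u) = 0 \<and> dJ V0 f (neg_part u) (neg_part u) = 0}"

definition c_hat :: "real \<Rightarrow> (real \<Rightarrow> real) \<Rightarrow> real" where
  "c_hat V0 f = Inf (Jfun V0 f ` Mset V0 f)"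

definition least_energy_nodal_solution :: "real \<Rightarrow> (real \<Rightarrow> real) \<Rightarrow> (R2 \<Rightarrow> real) \<Rightarrow> bool" where
  "least_energy_nodal_solution V0 f u \<longleftrightarrow>
     u \<in> Mset V0 f \<and> Jfun V0 f u = c_hat V0 f \<and> (\<forall>v\<in>H1. dJ V0 f u v = 0)"

definition Jp :: "real \<Rightarrow> real \<Rightarrow> (R2 \<Rightarrow> real) \<Rightarrow> real" where
  "Jp V0 p u = 1/2 * (\<integral>x\<in>ball 0 1. (norm (wgrad u x))\<^sup>2 + V0 * (u x)\<^sup>2 \<partial>lebesgue)
               - 1/p * (\<integral>x\<in>ball 0 1. \<bar>u x\<bar> powr p \<partial>lebesgue)"

definition dJp :: "real \<Rightarrow> real \<Rightarrow> (R2 \<Rightarrow> real) \<Rightarrow> (R2 \<Rightarrow> real) \<Rightarrow> real" where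
  "dJp V0 p u v = (\<integral>x\<in>ball 0 1. wgrad u x \<bullet> wgrad v x + V0 * u x * v x \<partial>lebesgue)
                  - (\<integral>x\<in>ball 0 1. \<bar>u x\<bar> powr (p - 2) * u x * v x \<partial>lebesgue)"

definition M_ball :: "real \<Rightarrow> real \<Rightarrow> (R2 \<Rightarrow> real) set" where
  "M_ball V0 p = {u \<in> H01 (ball 0 1). nonzero (pos_part u) \<and> nonzero (neg_part u) \<and>
       dJp V0 p (pos_part u) (pos_part u) = 0 \<and> dJp V0 p (neg_part u) (neg_part u) = 0}"

definition chi_p :: "real \<Rightarrow> real \<Rightarrow> real" where
  "chi_p V0 p = Inf (Jp V0 p ` M_ball V0 p)"

end

theory Submission
  imports Defs
begin

text \<open>Suppose that \<open>u\<close> attains the infimum. In the plane the dilation \<open>v (\<lambda> x)\<close> leaves the Dirichlet integral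
  \<open>A\<close> invariant and divides \<open>B (v) = \<integral> V\<^sub>0 v\<^sup>2 - f (v) v\<close> and \<open>Q (v) = \<integral> V\<^sub>0 v\<^sup>2 / 2 - F (v)\<close> by \<open>\<lambda>\<^sup>2\<close>, so
  every \<open>v\<close> with \<open>B (v) < 0\<close> has exactly one dilate on the Nehari manifold, with energy
  \<open>\<Psi> (v) = A/2 - Q A / B\<close>. Cutting off to opposite half-planes and dilating shows that
  \<open>\<Psi> (v) + \<Psi> (m)\<close> is at least the infimum for all \<open>v \<ge> 0 \<ge> m\<close>; hence \<open>w = u\<^sup>+\<close> minimizes \<open>\<Psi>\<close> among
  nonnegative functions, without any constraint. The first variation in directions supported where
  \<open>w < 1\<close> makes \<open>w\<close> a supersolution there, and testing with \<open>\<phi> (1 - w)\<^sub>+\<^sup>2 / (w + \<delta>)\<close> bounds the gradient of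
  essentially \<open>log (w + \<delta>)\<close> in \<open>L\<^sup>2\<close> locally, uniformly in \<open>\<delta>\<close>. Comparing \<open>w\<close> with its translates, one
  sees that \<open>w\<close> cannot vanish on a set of positive measure unless it vanishes identically. But \<open>w = 0\<close>
  where \<open>u < 0\<close>.\<close>

subsection \<open>Smooth functions on the plane\<close>

text \<open>Dilating about a point on the boundary line keeps a function inside its half-plane. The
  dilates of \<open>v\<close> and \<open>m\<close> therefore stay disjoint and are exactly the
  positive and negative parts of their sum. Dilations replace the usual multiples \<open>t v\<close>
  because the Nehari equation \<open>A + B / \<lambda>\<^sup>2 = 0\<close> is then linear in
  \<open>1 / \<lambda>\<^sup>2\<close> and is solvable whatever the shape of \<open>f\<close>. Two
  obstacles shape the cut-off. In the transition strip \<open>v\<close> becomes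
  \<open>\<sigma> v\<close> with \<open>\<sigma>\<close> between 0 and 1, and
  \<open>f (\<sigma> v) \<sigma> v\<close> is not dominated by \<open>f (v) v\<close>; averaging
  over the position of the strip bounds it by \<open>F (v)\<close>. Moreover a non-integrable
  function has Bochner integral 0, so integrability has to be extracted from the constraints before
  energies can be split. Weak derivatives are treated by translations instead of mollifiers: the
  increment of \<open>u\<close> along \<open>e\<close> is the mean of its derivative over the
  segment. The product rule, the chain rule and the final comparison of translates all rest on this
  identity. The first variation is taken only where \<open>w < 1\<close>, so that the Lipschitz
  constant of \<open>f\<close> on [0, 2] controls every nonlinear term.\<close>

lemma smooth2_differentiable: "smooth2 \<phi> \<Longrightarrow> \<phi> differentiable (at x)"
  by (erule smooth2.cases) auto

lemma smooth2_frechet: "smooth2 \<phi> \<Longrightarrow> smooth2 (\<lambda>x. frechet_derivative \<phi> (at x) v)"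
  by (erule smooth2.cases) auto

lemma smooth2_has_derivative:
  "smooth2 \<phi> \<Longrightarrow> (\<phi> has_derivative frechet_derivative \<phi> (at x)) (at x)"
  using smooth2_differentiable frechet_derivative_works by blast

lemma smooth2_continuous: "smooth2 \<phi> \<Longrightarrow> continuous_on UNIV \<phi>"
  by (meson continuous_at_imp_continuous_on differentiable_imp_continuous_within smooth2_differentiable)

text \<open>Smoothness is coinductive, so the invariant \<open>X\<close> consists of all sums of two
  smooth functions: this class is closed under directional derivatives.\<close>

lemma smooth2_add:
  assumes "smooth2 \<phi>" "smooth2 \<psi>"
  shows "smooth2 (\<lambda>x. \<phi> x + \<psi> x)"
proof -
  define X where "X = (\<lambda>\<zeta>. \<exists>\<phi> \<psi>. smooth2 \<phi> \<and> smooth2 \<psi> \<and> \<zeta> = (\<lambda>x. \<phi> x + \<psi> x))"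
  have "X (\<lambda>x. \<phi> x + \<psi> x)" using assms by (auto simp: X_def)
  then show ?thesis
  proof (coinduct rule: smooth2.coinduct)
    case (smooth2 \<zeta>)
    then obtain \<phi> \<psi> where *: "smooth2 \<phi>" "smooth2 \<psi>" "\<zeta> = (\<lambda>x. \<phi> x + \<psi> x)"
      by (auto simp: X_def)
    have d: "(\<zeta> has_derivative (\<lambda>v. frechet_derivative \<phi> (at x) v + frechet_derivative \<psi> (at x) v)) (at x)" for x
      unfolding *(3) by (intro has_derivative_add smooth2_has_derivative *)
    have e: "frechet_derivative \<zeta> (at x) = (\<lambda>v. frechet_derivative \<phi> (at x) v + frechet_derivative \<psi> (at x) v)" for x
      using frechet_derivative_at[OF d] by simp
    have "\<forall>x. \<zeta> differentiable (at x)" using d unfolding differentiable_def by blast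
    moreover have "X (\<lambda>x. frechet_derivative \<zeta> (at x) v)" for v
      unfolding X_def e using smooth2_frechet *(1,2) by blast
    ultimately show ?case by blast
  qed
qed

lemma frechet_derivative_affine:
  fixes \<phi> :: "R2 \<Rightarrow> real"
  assumes "\<And>x. \<phi> differentiable (at x)"
  shows "((\<lambda>x. c * \<phi> (l *\<^sub>R x + a)) has_derivative
           (\<lambda>v. c * l * frechet_derivative \<phi> (at (l *\<^sub>R x + a)) v)) (at x)"
proof -
  interpret linear "frechet_derivative \<phi> (at (l *\<^sub>R x + a))"
    by (rule linear_frechet_derivative[OF assms])
  have 1: "((\<lambda>x. l *\<^sub>R x + a) has_derivative (\<lambda>v. l *\<^sub>R v)) (at x)"
    by (auto intro!: derivative_eq_intros)
  have 2: "(\<phi> has_derivative frechet_derivative \<phi> (at (l *\<^sub>R x + a))) (at (l *\<^sub>R x + a))"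
    using assms frechet_derivative_works by blast
  have "((\<lambda>x. \<phi> (l *\<^sub>R x + a)) has_derivative (\<lambda>v. frechet_derivative \<phi> (at (l *\<^sub>R x + a)) (l *\<^sub>R v))) (at x)"
    using diff_chain_at[OF 1 2] by (simp add: o_def)
  from has_derivative_mult_right[OF this, of c] show ?thesis by (simp add: scale mult.assoc)
qed

lemma smooth2_affine:
  assumes "smooth2 \<phi>"
  shows "smooth2 (\<lambda>x. c * \<phi> (l *\<^sub>R x + a))"
proof -
  \<comment> \<open>The factor \<open>c\<close> belongs to the invariant because every
    differentiation brings out another factor \<open>l\<close>.\<close>
  define X where "X = (\<lambda>\<zeta>. \<exists>\<phi> c. smooth2 \<phi> \<and> \<zeta> = (\<lambda>x. c * \<phi> (l *\<^sub>R x + a)))"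
  have "X (\<lambda>x. c * \<phi> (l *\<^sub>R x + a))" using assms by (auto simp: X_def)
  then show ?thesis
  proof (coinduct rule: smooth2.coinduct)
    case (smooth2 \<zeta>)
    then obtain \<phi> c where *: "smooth2 \<phi>" "\<zeta> = (\<lambda>x. c * \<phi> (l *\<^sub>R x + a))"
      by (auto simp: X_def)
    have d: "(\<zeta> has_derivative (\<lambda>v. c * l * frechet_derivative \<phi> (at (l *\<^sub>R x + a)) v)) (at x)" for x
      unfolding *(2) by (rule frechet_derivative_affine) (rule smooth2_differentiable[OF *(1)])
    have e: "frechet_derivative \<zeta> (at x) = (\<lambda>v. c * l * frechet_derivative \<phi> (at (l *\<^sub>R x + a)) v)" for x
      using frechet_derivative_at[OF d] by simp
    have "\<forall>x. \<zeta> differentiable (at x)" using d unfolding differentiable_def by blast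
    moreover have "X (\<lambda>x. frechet_derivative \<zeta> (at x) v)" for v
      unfolding X_def e
      by (rule exI[of _ "\<lambda>y. frechet_derivative \<phi> (at y) v"], rule exI[of _ "c * l"])
         (use smooth2_frechet *(1) in auto)
    ultimately show ?case by blast
  qed
qed

subsection \<open>Test functions\<close>

text \<open>The classical flat function exp(-1/t) times powers of 1/t. The exponent \<open>q\<close>
  is carried along because differentiation only raises it, so the family spans a space closed under
  derivatives.\<close>

definition flat_exp :: "nat \<Rightarrow> real \<Rightarrow> real" where
  "flat_exp q t = (if t \<le> 0 then 0 else exp (- 1 / t) * (1 / t) ^ q)"

lemma power_le_fact_exp:
  fixes y :: real assumes "y \<ge> 0"
  shows "y ^ n \<le> fact n * exp y"
proof -
  have s: "(\<lambda>k. y ^ k /\<^sub>R fact k) sums exp y" by (rule exp_converges)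
  have "sum (\<lambda>k. y ^ k /\<^sub>R fact k) {n} \<le> suminf (\<lambda>k. y ^ k /\<^sub>R fact k)"
    by (rule sum_le_suminf) (use s assms in \<open>auto simp: sums_iff\<close>)
  then have "y ^ n /\<^sub>R fact n \<le> exp y" using s by (simp add: sums_iff)
  then show ?thesis by (simp add: field_simps)
qed

text \<open>With y = 1/t this is the bound of y^(q+2) by (q+2)! exp(y). Quadratic decay is what
  forces the derivative at 0 to exist and vanish.\<close>

lemma flat_exp_le_square: "\<bar>flat_exp q t\<bar> \<le> fact (q + 2) * t\<^sup>2"
proof (cases "t \<le> 0")
  case True then show ?thesis by (simp add: flat_exp_def)
next
  case False
  then have t: "t > 0" by simp
  have "(1 / t) ^ (q + 2) \<le> fact (q + 2) * exp (1 / t)"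
    by (rule power_le_fact_exp) (use t in auto)
  then have "(1 / t) ^ (q + 2) * (exp (- (1/t)) * t\<^sup>2) \<le> fact (q + 2) * exp (1 / t) * (exp (- (1/t)) * t\<^sup>2)"
    by (rule mult_right_mono) auto
  also have "\<dots> = fact (q + 2) * t\<^sup>2"
    by (simp add: exp_minus field_simps)
  also have "(1 / t) ^ (q + 2) * (exp (- (1/t)) * t\<^sup>2) = flat_exp q t"
    using t by (simp add: flat_exp_def power_add power_divide power2_eq_square field_simps)
  finally show ?thesis using t by (simp add: flat_exp_def)
qed

lemma flat_exp_deriv:
  "(flat_exp q has_real_derivative (- real q * flat_exp (q + 1) t + flat_exp (q + 2) t)) (at t)"
proof (cases t "0 :: real" rule: linorder_cases)
  case less
  have "((\<lambda>_. 0) has_real_derivative 0) (at t)" by simp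
  then have "(flat_exp q has_real_derivative 0) (at t)"
    by (rule has_field_derivative_transform_within_open[where S = "{..<0}"])
       (use less in \<open>auto simp: flat_exp_def\<close>)
  then show ?thesis using less by (simp add: flat_exp_def)
next
  case equal
  have "((\<lambda>h. flat_exp q h / h) \<longlongrightarrow> 0) (at 0)"
  proof (rule Lim_null_comparison)
    show "\<forall>\<^sub>F h in at 0. norm (flat_exp q h / h) \<le> fact (q + 2) * \<bar>h\<bar>"
      unfolding eventually_at_filter
    proof (rule always_eventually, intro allI impI)
      fix h :: real assume "h \<noteq> 0"
      then show "norm (flat_exp q h / h) \<le> fact (q + 2) * \<bar>h\<bar>"
        using flat_exp_le_square[of q h]
        by (simp add: divide_le_eq power2_eq_square abs_mult mult.assoc del: fact_Suc) 
    qed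
    have "((\<lambda>h::real. fact (q + 2) * \<bar>h\<bar>) \<longlongrightarrow> fact (q + 2) * \<bar>0\<bar>) (at 0)"
      by (intro tendsto_intros)
    then show "((\<lambda>h::real. fact (q + 2) * \<bar>h\<bar>) \<longlongrightarrow> 0) (at 0)" by simp
  qed
  then have "(flat_exp q has_real_derivative 0) (at 0)"
    by (simp add: has_field_derivative_iff flat_exp_def)
  then show ?thesis using equal by (simp add: flat_exp_def)
next
  case greater
  have "((\<lambda>t. exp (- 1 / t) * (1 / t) ^ q) has_real_derivative
          (- real q * flat_exp (q + 1) t + flat_exp (q + 2) t)) (at t)"
  proof (cases q)
    case 0
    then show ?thesis using greater
      by (auto intro!: derivative_eq_intros simp: flat_exp_def field_simps power2_eq_square)
  next
    case (Suc m)
    then show ?thesis using greater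
      by (auto intro!: derivative_eq_intros simp: flat_exp_def field_simps power2_eq_square)
         (use power_minus_mult[of m t] in \<open>auto simp: mult.commute\<close>)
  qed
  then show ?thesis
    by (rule has_field_derivative_transform_within_open[where S = "{0<..}"])
       (use greater in \<open>auto simp: flat_exp_def\<close>)
qed

text \<open>An algebra of functions that contains the bumps below and is closed under directional
  derivatives; the latter makes it amenable to coinduction.\<close>

inductive flat_alg :: "(R2 \<Rightarrow> real) \<Rightarrow> bool" where
  const: "flat_alg (\<lambda>x. c)"
| flat: "flat_alg (\<lambda>x. flat_exp q (c * x $ i + d))"
| add: "flat_alg \<phi> \<Longrightarrow> flat_alg \<psi> \<Longrightarrow> flat_alg (\<lambda>x. \<phi> x + \<psi> x)"
| mult: "flat_alg \<phi> \<Longrightarrow> flat_alg \<psi> \<Longrightarrow> flat_alg (\<lambda>x. \<phi> x * \<psi> x)"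

text \<open>The generators reproduce themselves: the derivative of order \<open>q\<close> combines
  orders \<open>q + 1\<close> and \<open>q + 2\<close> of the same affine argument. The sum and
  product rules do the rest.\<close>

lemma flat_alg_derivative:
  "flat_alg \<phi> \<Longrightarrow> \<exists>D. (\<forall>x. (\<phi> has_derivative (\<lambda>v. D v x)) (at x)) \<and> (\<forall>v. flat_alg (D v))"
proof (induction rule: flat_alg.induct)
  case (const c)
  show ?case by (rule exI[of _ "\<lambda>v x. 0"]) (auto intro: flat_alg.const)
next
  case (flat q c i d)
  define h where "h t = - real q * flat_exp (q + 1) t + flat_exp (q + 2) t" for t
  have "((\<lambda>x. flat_exp q (c * x $ i + d)) has_derivative (\<lambda>v. h (c * x $ i + d) * (c * v $ i))) (at x)" for x :: R2
  proof -
    have 1: "((\<lambda>x :: R2. c * x $ i + d) has_derivative (\<lambda>v. c * v $ i)) (at x)"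
      by (auto intro!: derivative_eq_intros bounded_linear_imp_has_derivative bounded_linear_vec_nth)
    have 2: "(flat_exp q has_derivative (*) (h (c * x $ i + d))) (at (c * x $ i + d))"
      using flat_exp_deriv[of q "c * x $ i + d"] unfolding has_field_derivative_def h_def .
    show ?thesis using diff_chain_at[OF 1 2] by (simp add: o_def)
  qed
  moreover have "flat_alg (\<lambda>x. h (c * x $ i + d) * (c * v $ i))" for v
    unfolding h_def by (intro flat_alg.intros)
  ultimately show ?case
    by (intro exI[of _ "\<lambda>v x. h (c * x $ i + d) * (c * v $ i)"]) auto
next
  case (add \<phi> \<psi>)
  then obtain D E where "\<And>x. (\<phi> has_derivative (\<lambda>v. D v x)) (at x)" "\<And>v. flat_alg (D v)"
    "\<And>x. (\<psi> has_derivative (\<lambda>v. E v x)) (at x)" "\<And>v. flat_alg (E v)" by metis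
  then show ?case
    by (intro exI[of _ "\<lambda>v x. D v x + E v x"]) (auto intro!: flat_alg.add has_derivative_add)
next
  case (mult \<phi> \<psi>)
  then obtain D E where *: "\<And>x. (\<phi> has_derivative (\<lambda>v. D v x)) (at x)" "\<And>v. flat_alg (D v)"
    "\<And>x. (\<psi> has_derivative (\<lambda>v. E v x)) (at x)" "\<And>v. flat_alg (E v)" by metis
  show ?case
    by (intro exI[of _ "\<lambda>v x. \<phi> x * E v x + D v x * \<psi> x"])
       (auto intro!: flat_alg.add flat_alg.mult has_derivative_mult * mult)
qed

text \<open>The algebra itself serves as the invariant of the coinduction.\<close>

lemma flat_alg_smooth2:
  assumes "flat_alg \<phi>" shows "smooth2 \<phi>"
  using assms
proof (coinduct rule: smooth2.coinduct)
  case (smooth2 \<phi>)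
  then obtain D where D: "\<And>x. (\<phi> has_derivative (\<lambda>v. D v x)) (at x)" "\<And>v. flat_alg (D v)"
    using flat_alg_derivative by metis
  have e: "frechet_derivative \<phi> (at x) = (\<lambda>v. D v x)" for x
    using frechet_derivative_at[OF D(1)] by simp
  have "(\<lambda>x. frechet_derivative \<phi> (at x) v) = D v" for v by (simp add: e)
  then show ?case
    using D unfolding differentiable_def by auto
qed

text \<open>One factor for each face of the box from \<open>a\<close> to \<open>b\<close>. Since
  \<open>flat_exp 0\<close> tends to 1 at infinity, letting \<open>k\<close> grow turns the bump
  into the indicator of the open box.\<close>

definition bump :: "R2 \<Rightarrow> R2 \<Rightarrow> real \<Rightarrow> R2 \<Rightarrow> real" where
  "bump a b k x = (flat_exp 0 (k * (x $ 1 - a $ 1)) * flat_exp 0 (k * (b $ 1 - x $ 1))) *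
                  (flat_exp 0 (k * (x $ 2 - a $ 2)) * flat_exp 0 (k * (b $ 2 - x $ 2)))"

lemma flat_exp_0_bounds: "0 \<le> flat_exp 0 t" "flat_exp 0 t \<le> 1" "t \<le> 0 \<Longrightarrow> flat_exp 0 t = 0" "0 < t \<Longrightarrow> 0 < flat_exp 0 t"
  by (auto simp: flat_exp_def)

lemma smooth2_bump: "smooth2 (bump a b k)"
proof -
  have eq: "bump a b k = (\<lambda>x. (flat_exp 0 (k * x $ 1 + (- k * a $ 1)) * flat_exp 0 ((- k) * x $ 1 + k * b $ 1)) *
                  (flat_exp 0 (k * x $ 2 + (- k * a $ 2)) * flat_exp 0 ((- k) * x $ 2 + k * b $ 2)))"
    by (auto simp: bump_def algebra_simps fun_eq_iff)
  show ?thesis unfolding eq by (intro flat_alg_smooth2 flat_alg.intros)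
qed

lemma box_R2: "x \<in> box a b \<longleftrightarrow> a $ 1 < x $ 1 \<and> x $ 1 < b $ 1 \<and> a $ 2 < x $ 2 \<and> x $ 2 < (b :: R2) $ 2"
  by (auto simp: mem_box_cart forall_2)

lemma bump_nonneg: "0 \<le> bump a b k x"
  by (auto simp: bump_def flat_exp_0_bounds)

lemma bump_eq_0: "k \<ge> 0 \<Longrightarrow> x \<notin> box a b \<Longrightarrow> bump a b k x = 0"
  by (auto simp: bump_def flat_exp_def box_R2 not_less mult_le_0_iff)

lemma bump_pos: "k > 0 \<Longrightarrow> x \<in> box a b \<Longrightarrow> bump a b k x > 0"
  by (auto simp: bump_def box_R2 intro!: mult_pos_pos flat_exp_0_bounds(4))

lemma bump_le_1: "bump a b k x \<le> 1"
  unfolding bump_def by (intro mult_le_one mult_nonneg_nonneg flat_exp_0_bounds)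

lemma bump_test_fun:
  assumes "k \<ge> 0" shows "test_fun UNIV (bump a b k)"
proof -
  have "supp2 (bump a b k) \<subseteq> cbox a b"
    unfolding supp2_def
    by (rule closure_minimal) (use bump_eq_0[OF assms] box_subset_cbox in \<open>force+\<close>)
  moreover have "closed (supp2 (bump a b k))" by (simp add: supp2_def)
  ultimately have "compact (supp2 (bump a b k))"
    by (meson bounded_cbox bounded_subset compact_eq_bounded_closed)
  then show ?thesis using smooth2_bump by (auto simp: test_fun_def)
qed

lemma bump_tendsto: "(\<lambda>k. bump a b (real k) x) \<longlonglongrightarrow> indicator (box a b) x"
proof (cases "x \<in> box a b")
  case True
  have 1: "(\<lambda>k. flat_exp 0 (real k * s)) \<longlonglongrightarrow> 1" if "s > 0" for s
  proof -
    have "(\<lambda>k. exp (- (1 / s) * (1 / real k))) \<longlonglongrightarrow> exp (- (1 / s) * 0)"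
      by (intro tendsto_intros lim_1_over_n)
    moreover have "\<forall>\<^sub>F k in sequentially. exp (- (1 / s) * (1 / real k)) = flat_exp 0 (real k * s)"
      using eventually_gt_at_top[of "0::nat"]
      by eventually_elim (use that in \<open>auto simp: flat_exp_def mult_le_0_iff field_simps\<close>)
    ultimately show ?thesis using tendsto_cong by fastforce
  qed
  have "(\<lambda>k. bump a b (real k) x) \<longlonglongrightarrow> (1 * 1) * (1 * 1)"
    unfolding bump_def by (intro tendsto_mult 1) (use True in \<open>auto simp: box_R2\<close>)
  then show ?thesis using True by simp
next
  case False
  then show ?thesis by (simp add: bump_eq_0)
qed

lemma supp2_add_subset: "supp2 (\<lambda>x. \<phi> x + \<psi> x) \<subseteq> supp2 \<phi> \<union> supp2 \<psi>"
proof -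
  have "{x. \<phi> x + \<psi> x \<noteq> 0} \<subseteq> {x. \<phi> x \<noteq> 0} \<union> {x. \<psi> x \<noteq> 0}" by auto
  from closure_mono[OF this] show ?thesis unfolding supp2_def by simp
qed

lemma test_fun_add:
  assumes "test_fun UNIV \<phi>" "test_fun UNIV \<psi>" shows "test_fun UNIV (\<lambda>x. \<phi> x + \<psi> x)"
proof -
  have "compact (supp2 \<phi> \<union> supp2 \<psi>)" using assms by (auto simp: test_fun_def)
  moreover have "closed (supp2 (\<lambda>x. \<phi> x + \<psi> x))" by (simp add: supp2_def)
  ultimately have "compact (supp2 (\<lambda>x. \<phi> x + \<psi> x))"
    using supp2_add_subset[of \<phi> \<psi>] by (meson bounded_subset compact_eq_bounded_closed)
  then show ?thesis using assms smooth2_add by (auto simp: test_fun_def)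
qed

lemma test_fun_zero_outside:
  assumes "test_fun UNIV \<phi>"
  obtains R where "R > 0" "\<And>x. norm x \<ge> R \<Longrightarrow> \<phi> x = 0" "\<And>x v. norm x \<ge> R \<Longrightarrow> frechet_derivative \<phi> (at x) v = 0"
proof -
  have "bounded (supp2 \<phi>)" using assms by (auto simp: test_fun_def compact_imp_bounded)
  then obtain R where R: "R > 0" "\<And>x. x \<in> supp2 \<phi> \<Longrightarrow> norm x \<le> R" by (meson bounded_pos)
  have z: "\<phi> x = 0" if "norm x > R" for x
    using R(2)[of x] that closure_subset[of "{x. \<phi> x \<noteq> 0}"] by (auto simp: supp2_def)
  have d: "frechet_derivative \<phi> (at x) v = 0" if "norm x > R" for x v
  proof -
    have "((\<lambda>_. 0) has_derivative (\<lambda>_. 0)) (at x)" by simp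
    then have "(\<phi> has_derivative (\<lambda>_. 0)) (at x)"
      by (rule has_derivative_transform_within_open[where s = "{x. norm x > R}"])
         (use that z in \<open>auto intro!: open_Collect_less continuous_intros\<close>)
    from frechet_derivative_at[OF this] show ?thesis by metis
  qed
  show ?thesis
    by (rule that[of "R + 1"]) (use R z d in force)+
qed

lemma test_fun_affine:
  assumes \<phi>: "test_fun UNIV \<phi>" and l: "l \<noteq> 0"
  shows "test_fun UNIV (\<lambda>x. \<phi> (l *\<^sub>R x + a))"
proof -
  obtain R where R: "R > 0" "\<And>x. norm x \<ge> R \<Longrightarrow> \<phi> x = 0"
    using test_fun_zero_outside[OF \<phi>] by metis
  have "supp2 (\<lambda>x. \<phi> (l *\<^sub>R x + a)) \<subseteq> cball 0 ((R + norm a) / \<bar>l\<bar>)"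
    unfolding supp2_def
  proof (rule closure_minimal)
    show "{x. \<phi> (l *\<^sub>R x + a) \<noteq> 0} \<subseteq> cball 0 ((R + norm a) / \<bar>l\<bar>)"
    proof clarify
      fix x assume "\<phi> (l *\<^sub>R x + a) \<noteq> 0"
      then have "norm (l *\<^sub>R x + a) < R" using R(2) by force
      then have "norm (l *\<^sub>R x) < R + norm a" using norm_triangle_ineq4[of "l *\<^sub>R x + a" a] by simp
      then show "x \<in> cball 0 ((R + norm a) / \<bar>l\<bar>)" using l by (simp add: field_simps)
    qed
  qed simp
  moreover have "closed (supp2 (\<lambda>x. \<phi> (l *\<^sub>R x + a)))" by (simp add: supp2_def)
  ultimately have "compact (supp2 (\<lambda>x. \<phi> (l *\<^sub>R x + a)))"
    by (meson bounded_cball bounded_subset compact_eq_bounded_closed)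
  then show ?thesis using smooth2_affine[of \<phi> 1 l a] \<phi> by (auto simp: test_fun_def)
qed

lemma continuous_bounded_of_zero_outside:
  fixes h :: "R2 \<Rightarrow> real"
  assumes "continuous_on UNIV h" "\<And>x. norm x \<ge> R \<Longrightarrow> h x = 0"
  obtains L where "L > 0" "\<And>x. \<bar>h x\<bar> \<le> L"
proof -
  have "compact (h ` cball 0 R)"
    by (intro compact_continuous_image continuous_on_subset[OF assms(1)]) auto
  then obtain L where L: "L > 0" "\<And>x. x \<in> cball 0 R \<Longrightarrow> \<bar>h x\<bar> \<le> L"
    by (metis bounded_pos compact_imp_bounded imageI real_norm_def)
  have "\<bar>h x\<bar> \<le> L" for x
    using L assms(2)[of x] by (cases "norm x \<le> R") auto
  then show ?thesis using that L by blast
qed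

lemma test_fun_bounds:
  assumes "test_fun UNIV \<phi>"
  obtains R L where "R > 0" "L > 0"
    "\<And>x. norm x \<ge> R \<Longrightarrow> \<phi> x = 0" "\<And>x. norm x \<ge> R \<Longrightarrow> frechet_derivative \<phi> (at x) v = 0"
    "\<And>x. \<bar>\<phi> x\<bar> \<le> L" "\<And>x. \<bar>frechet_derivative \<phi> (at x) v\<bar> \<le> L"
proof -
  obtain R where R: "R > 0" "\<And>x. norm x \<ge> R \<Longrightarrow> \<phi> x = 0" "\<And>x v. norm x \<ge> R \<Longrightarrow> frechet_derivative \<phi> (at x) v = 0"
    using test_fun_zero_outside[OF assms] by metis
  have s: "smooth2 \<phi>" using assms by (simp add: test_fun_def)
  obtain L1 where L1: "L1 > 0" "\<And>x. \<bar>\<phi> x\<bar> \<le> L1"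
    using continuous_bounded_of_zero_outside[OF smooth2_continuous[OF s] R(2)] by metis
  obtain L2 where L2: "L2 > 0" "\<And>x. \<bar>frechet_derivative \<phi> (at x) v\<bar> \<le> L2"
    using continuous_bounded_of_zero_outside[OF smooth2_continuous[OF smooth2_frechet[OF s]] R(3)] by metis
  show ?thesis
    by (rule that[of R "max L1 L2"]) (use R L1 L2 in \<open>auto intro: le_max_iff_disj[THEN iffD2]\<close>)
qed

lemma test_fun_smooth2: "test_fun UNIV \<phi> \<Longrightarrow> smooth2 \<phi>"
  by (simp add: test_fun_def)

lemma test_fun_line_derivative:
  assumes "test_fun UNIV \<phi>"
  shows "((\<lambda>s. \<phi> (x + s *\<^sub>R e)) has_real_derivative frechet_derivative \<phi> (at (x + s *\<^sub>R e)) e) (at s within S)"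
proof -
  have lin: "linear (frechet_derivative \<phi> (at (x + s *\<^sub>R e)))"
    using assms by (intro linear_frechet_derivative smooth2_differentiable test_fun_smooth2)
  have 1: "((\<lambda>s. x + s *\<^sub>R e) has_derivative (\<lambda>h. h *\<^sub>R e)) (at s within S)"
    by (auto intro!: derivative_eq_intros)
  have 2: "(\<phi> has_derivative frechet_derivative \<phi> (at (x + s *\<^sub>R e))) (at (x + s *\<^sub>R e) within (\<lambda>s. x + s *\<^sub>R e) ` S)"
    using smooth2_has_derivative[OF test_fun_smooth2[OF assms]] has_derivative_at_withinI by blast
  have "((\<lambda>s. \<phi> (x + s *\<^sub>R e)) has_derivative (\<lambda>h. frechet_derivative \<phi> (at (x + s *\<^sub>R e)) (h *\<^sub>R e))) (at s within S)"
    using diff_chain_within[OF 1 2] by (simp add: o_def)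
  then show ?thesis
    unfolding has_field_derivative_def by (simp add: linear_scale[OF lin] mult.commute[of _ "frechet_derivative _ _ _"])
qed

lemma test_fun_lipschitz:
  assumes \<phi>: "test_fun UNIV \<phi>" and L: "\<And>x. \<bar>frechet_derivative \<phi> (at x) e\<bar> \<le> L"
  shows "\<bar>\<phi> (x + t *\<^sub>R e) - \<phi> x\<bar> \<le> L * \<bar>t\<bar>"
  using field_differentiable_bound[where S = UNIV and f = "\<lambda>s. \<phi> (x + s *\<^sub>R e)" and x = t and y = 0 and B = L,
      OF convex_UNIV test_fun_line_derivative[OF \<phi>]] L by simp

subsection \<open>The fundamental lemma of the calculus of variations\<close>

text \<open>Boxes form an intersection-stable generator of the Borel sets, so vanishing integrals
  spread to all Borel sets by a Dynkin argument. The complement step needs the integral over the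
  whole plane, which \<open>UN\<close> obtains by exhaustion with boxes.\<close>

lemma AE_zero_of_box_integrals:
  fixes h :: "R2 \<Rightarrow> real"
  assumes h: "integrable lborel h"
    and box: "\<And>a b. (LINT x:box a b|lborel. h x) = 0"
  shows "AE x in lborel. h x = 0"
proof (rule sigma_finite_measure.density_zero[OF sigma_finite_lborel h])
  fix A :: "R2 set" assume "A \<in> sets lborel"
  then have A: "A \<in> sigma_sets UNIV (range (\<lambda>(a, b). box a b))"
    unfolding sets_lborel borel_eq_box by simp
  have sub: "A \<in> sets borel" if "A \<in> sigma_sets UNIV (range (\<lambda>(a, b). box a b))" for A :: "R2 set"
    using that unfolding borel_eq_box by simp
  have si: "set_integrable lborel A h" if "A \<in> sets borel" for A
    unfolding set_integrable_def using integrable_mult_indicator[OF _ h, of A] that by simp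
  have UN: "(\<integral>x. h x \<partial>lborel) = 0"
  proof (rule LIMSEQ_unique)
    let ?B = "\<lambda>n::nat. box (- (real n *\<^sub>R One)) (real n *\<^sub>R One) :: R2 set"
    show "(\<lambda>n. \<integral>x. indicator (?B n) x *\<^sub>R h x \<partial>lborel) \<longlonglongrightarrow> (\<integral>x. h x \<partial>lborel)"
    proof (rule integral_dominated_convergence[where w = "\<lambda>x. \<bar>h x\<bar>"])
      show "AE x in lborel. (\<lambda>n. indicator (?B n) x *\<^sub>R h x) \<longlonglongrightarrow> h x"
      proof (rule AE_I2)
        fix x
        obtain N :: nat where N: "\<And>n. n \<ge> N \<Longrightarrow> x \<in> ?B n"
        proof -
          obtain N where "x \<in> ?B N" using UN_box_eq_UNIV by blast
          moreover have "?B N \<subseteq> ?B n" if "n \<ge> N" for n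
            using that by (intro subset_box_imp) (auto simp: inner_Basis)
          ultimately show ?thesis using that by blast
        qed
        have "\<forall>\<^sub>F n in sequentially. indicator (?B n) x *\<^sub>R h x = h x"
          using eventually_ge_at_top[of N] by eventually_elim (use N in auto)
        then show "(\<lambda>n. indicator (?B n) x *\<^sub>R h x) \<longlonglongrightarrow> h x"
          by (rule tendsto_eventually)
      qed
      show "AE x in lborel. norm (indicator (?B n) x *\<^sub>R h x) \<le> \<bar>h x\<bar>" for n
        by (auto split: split_indicator)
    qed (use h in auto)
    show "(\<lambda>n. \<integral>x. indicator (?B n) x *\<^sub>R h x \<partial>lborel) \<longlonglongrightarrow> 0"
      using box unfolding set_lebesgue_integral_def by simp
  qed
  have "Int_stable (range (\<lambda>(a, b). box a b :: R2 set))"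
    by (auto simp: Int_stable_def box_Int_box)
  moreover have "range (\<lambda>(a, b). box a b :: R2 set) \<subseteq> Pow UNIV" by simp
  ultimately show "(LINT x:A|lborel. h x) = 0"
    using A
  proof (induction rule: sigma_sets_induct_disjoint)
    case (compl A)
    have "(LINT x:UNIV - A|lborel. h x) = (\<integral>x. h x - indicator A x *\<^sub>R h x \<partial>lborel)"
      unfolding set_lebesgue_integral_def by (intro Bochner_Integration.integral_cong) (auto split: split_indicator)
    also have "\<dots> = 0"
      using UN compl(2) si[OF sub[OF compl(1)]] h
      by (subst Bochner_Integration.integral_diff) (auto simp: set_lebesgue_integral_def set_integrable_def)
    finally show ?case .
  next
    case (union A)
    have "(LINT x:(\<Union>i. A i)|lborel. h x) = (\<Sum>i. (LINT x:(A i)|lborel. h x))"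
    proof (rule lebesgue_integral_countable_add)
      show "A i \<in> sets lborel" for i using union(2) sub by auto
      then show "set_integrable lborel (\<Union>i. A i) h" using si by auto
    qed (use union(1) in \<open>auto simp: disjoint_family_on_def\<close>)
    then show ?case using union by simp
  qed (use box in \<open>auto simp: set_lebesgue_integral_def\<close>)
qed

text \<open>Enlarging the box by 1 on every side places the closed box inside the open set where the
  bump is positive; compactness gives the constant.\<close>

lemma bump_bounded_below:
  obtains c where "c > 0" "\<And>x. x \<in> box a b \<Longrightarrow> bump (a - 1) (b + 1) 1 x \<ge> c"
proof (cases "cbox a b = {}")
  case True
  then show ?thesis using that[of 1] box_subset_cbox by fastforce
next
  case False
  have sub: "cbox a b \<subseteq> box (a - 1) (b + 1)" by (auto simp: mem_box_cart box_R2 forall_2) 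
  have "continuous_on (cbox a b) (bump (a - 1) (b + 1) 1)"
    using smooth2_continuous[OF smooth2_bump] continuous_on_subset by blast
  then obtain x where x: "x \<in> cbox a b" "\<And>y. y \<in> cbox a b \<Longrightarrow> bump (a - 1) (b + 1) 1 x \<le> bump (a - 1) (b + 1) 1 y"
    using continuous_attains_inf[OF compact_cbox False] by blast
  then have "bump (a - 1) (b + 1) 1 x > 0" using sub by (intro bump_pos) auto
  then show ?thesis using x(2) box_subset_cbox by (intro that[of "bump (a - 1) (b + 1) 1 x"]) blast+
qed

text \<open>The integral of a non-integrable product is 0 by default, so integrability against test
  functions is a separate assumption. Dividing by a bump that is bounded below yields local
  integrability (\<open>ki\<close>); bumps converging to the indicator of a box then show that all
  box integrals vanish.\<close>

lemma fundamental_lemma_lborel: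
  fixes k :: "R2 \<Rightarrow> real"
  assumes k[measurable]: "k \<in> borel_measurable borel"
    and int: "\<And>\<phi>. test_fun UNIV \<phi> \<Longrightarrow> integrable lborel (\<lambda>x. k x * \<phi> x)"
    and zero: "\<And>\<phi>. test_fun UNIV \<phi> \<Longrightarrow> (\<integral>x. k x * \<phi> x \<partial>lborel) = 0"
  shows "AE x in lborel. k x = 0"
proof -
  have ki: "integrable lborel (\<lambda>x. indicator (box a b) x * k x)" for a b
  proof -
    obtain c where c: "c > 0" "\<And>x. x \<in> box a b \<Longrightarrow> bump (a - 1) (b + 1) 1 x \<ge> c"
      using bump_bounded_below by blast
    have "integrable lborel (\<lambda>x. (1/c) * (k x * bump (a - 1) (b + 1) 1 x))"
      by (intro integrable_mult_right int bump_test_fun) simp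
    then show ?thesis
    proof (rule Bochner_Integration.integrable_bound)
      show "AE x in lborel. norm (indicator (box a b) x * k x) \<le> norm ((1/c) * (k x * bump (a - 1) (b + 1) 1 x))"
      proof (rule AE_I2)
        fix x
        show "norm (indicator (box a b) x * k x) \<le> norm ((1/c) * (k x * bump (a - 1) (b + 1) 1 x))"
        proof (cases "x \<in> box a b")
          case True
          then have "\<bar>k x\<bar> * c \<le> \<bar>k x\<bar> * bump (a - 1) (b + 1) 1 x" using c by (intro mult_left_mono) auto
          then show ?thesis using c True by (simp add: abs_mult bump_nonneg field_simps)
        qed simp
      qed
    qed measurable
  qed
  have b0: "(\<integral>x. indicator (box a b) x * k x \<partial>lborel) = 0" for a b
  proof (rule LIMSEQ_unique)
    show "(\<lambda>n. \<integral>x. k x * bump a b (real n) x \<partial>lborel) \<longlonglongrightarrow> 0"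
      using zero[OF bump_test_fun] by simp
    show "(\<lambda>n. \<integral>x. k x * bump a b (real n) x \<partial>lborel) \<longlonglongrightarrow> (\<integral>x. indicator (box a b) x * k x \<partial>lborel)"
    proof (rule integral_dominated_convergence[where w = "\<lambda>x. \<bar>indicator (box a b) x * k x\<bar>"])
      show "AE x in lborel. (\<lambda>n. k x * bump a b (real n) x) \<longlonglongrightarrow> indicator (box a b) x * k x"
        using tendsto_mult_left[OF bump_tendsto] by (auto simp: mult.commute)
      show "AE x in lborel. norm (k x * bump a b (real n) x) \<le> \<bar>indicator (box a b) x * k x\<bar>" for n
        by (rule AE_I2) (auto simp: abs_mult bump_nonneg bump_eq_0 intro!: mult_left_le bump_le_1 split: split_indicator)
      show "(\<lambda>x. k x * bump a b (real n) x) \<in> borel_measurable lborel" for n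
        using borel_measurable_continuous_onI[OF smooth2_continuous[OF smooth2_bump]] by measurable
    qed (use ki[of a b] in \<open>auto\<close>)
  qed
  let ?B = "\<lambda>n::nat. box (- (real n *\<^sub>R One)) (real n *\<^sub>R One) :: R2 set"
  have "AE x in lborel. indicator (?B n) x * k x = 0" for n
  proof (rule AE_zero_of_box_integrals[OF ki])
    fix a b :: R2
    obtain a' b' where ab: "box a b \<inter> ?B n = box a' b'" by (simp only: box_Int_box)
    have "(LINT x:box a b|lborel. indicator (?B n) x * k x) = (\<integral>x. indicator (box a b \<inter> ?B n) x * k x \<partial>lborel)"
      unfolding set_lebesgue_integral_def by (intro Bochner_Integration.integral_cong) (auto split: split_indicator)
    then show "(LINT x:box a b|lborel. indicator (?B n) x * k x) = 0" unfolding ab b0 .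
  qed
  then have "AE x in lborel. \<forall>n. indicator (?B n) x * k x = 0" unfolding AE_all_countable by blast
  then show ?thesis
  proof eventually_elim
    case (elim x)
    obtain n where "x \<in> ?B n" using UN_box_eq_UNIV by blast
    then show ?case using elim by (metis indicator_simps(1) mult_1)
  qed
qed

text \<open>The Fubini and shear arguments below take place over \<open>lborel\<close>; a Borel
  representative carries over to them what is known over \<open>lebesgue\<close>.\<close>

lemma borel_representative:
  fixes k :: "R2 \<Rightarrow> real"
  assumes "k \<in> borel_measurable lebesgue"
  obtains k' where "k' \<in> borel_measurable borel" "AE x in lborel. k x = k' x" "AE x in lebesgue. k x = k' x"
proof -
  obtain k' where "k' \<in> borel_measurable lborel" "AE x in lborel. k x = k' x"
    using completion_ex_borel_measurable_real[OF assms] by blast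
  then show ?thesis using that[of k'] AE_completion by auto
qed

lemma borel_measurable_lebesgueI: "h \<in> borel_measurable borel \<Longrightarrow> h \<in> borel_measurable lebesgue"
  by (simp add: measurable_completion)

lemma test_fun_borel[measurable_dest]: "test_fun UNIV \<phi> \<Longrightarrow> \<phi> \<in> borel_measurable borel"
  by (intro borel_measurable_continuous_onI smooth2_continuous test_fun_smooth2)

lemma test_fun_deriv_borel: "test_fun UNIV \<phi> \<Longrightarrow> (\<lambda>x. frechet_derivative \<phi> (at x) e) \<in> borel_measurable borel"
  by (intro borel_measurable_continuous_onI smooth2_continuous smooth2_frechet test_fun_smooth2)

lemma fundamental_lemma:
  fixes k :: "R2 \<Rightarrow> real"
  assumes k[measurable]: "k \<in> borel_measurable lebesgue"
    and int: "\<And>\<phi>. test_fun UNIV \<phi> \<Longrightarrow> integrable lebesgue (\<lambda>x. k x * \<phi> x)"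
    and zero: "\<And>\<phi>. test_fun UNIV \<phi> \<Longrightarrow> (\<integral>x. k x * \<phi> x \<partial>lebesgue) = 0"
  shows "AE x in lebesgue. k x = 0"
proof -
  obtain k' where k'[measurable]: "k' \<in> borel_measurable borel" and ae: "AE x in lebesgue. k x = k' x"
    using borel_representative[OF k] by metis
  have k'l[measurable]: "k' \<in> borel_measurable lebesgue" by (rule borel_measurable_lebesgueI) fact
  have "AE x in lborel. k' x = 0"
  proof (rule fundamental_lemma_lborel[OF k'])
    fix \<phi> assume \<phi>: "test_fun UNIV \<phi>"
    note [measurable] = test_fun_borel[OF \<phi>] borel_measurable_lebesgueI[OF test_fun_borel[OF \<phi>]]
    have "integrable lebesgue (\<lambda>x. k' x * \<phi> x)"
      by (rule integrable_cong_AE_imp[OF int[OF \<phi>]]) (use ae in auto)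
    then show "integrable lborel (\<lambda>x. k' x * \<phi> x)" by (simp add: integrable_completion)
    have "(\<integral>x. k x * \<phi> x \<partial>lebesgue) = (\<integral>x. k' x * \<phi> x \<partial>lebesgue)"
      by (rule integral_cong_AE) (use ae in auto)
    then show "(\<integral>x. k' x * \<phi> x \<partial>lborel) = 0" using zero[OF \<phi>] by (simp add: integral_completion)
  qed
  from AE_completion[OF this] ae show ?thesis by eventually_elim simp
qed

subsection \<open>Weak directional derivatives and translations\<close>

definition sqi :: "(R2 \<Rightarrow> real) \<Rightarrow> bool" where
  "sqi u \<longleftrightarrow> u \<in> borel_measurable borel \<and> integrable lborel (\<lambda>x. (u x)\<^sup>2)"

text \<open>The vector \<open>e\<close> need not have length 1, so the step \<open>t\<close> of a
  difference quotient can be absorbed by passing to \<open>t *\<^sub>R e\<close>.\<close>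

definition wdir :: "R2 \<Rightarrow> (R2 \<Rightarrow> real) \<Rightarrow> (R2 \<Rightarrow> real) \<Rightarrow> bool" where
  "wdir e u g \<longleftrightarrow> (\<forall>\<phi>. test_fun UNIV \<phi> \<longrightarrow>
     (\<integral>x. u x * frechet_derivative \<phi> (at x) e \<partial>lborel) = - (\<integral>x. g x * \<phi> x \<partial>lborel))"

lemma sqi_borel: "sqi u \<Longrightarrow> u \<in> borel_measurable borel" by (simp add: sqi_def)

lemma sqi_local_integrable:
  assumes u: "sqi u" and \<xi>[measurable]: "\<xi> \<in> borel_measurable borel" and M: "\<And>x. \<bar>\<xi> x\<bar> \<le> M"
    and R: "\<forall>x. norm x \<ge> R \<longrightarrow> \<xi> x = 0"
  shows "integrable lborel (\<lambda>x. u x * \<xi> x)"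
proof -
  note [measurable] = sqi_borel[OF u]
  have "integrable lborel (\<lambda>x. M * (indicator (ball 0 R) x + (u x)\<^sup>2))"
    using u by (intro integrable_mult_right Bochner_Integration.integrable_add)
       (auto simp: sqi_def intro!: integrable_real_indicator emeasure_bounded_finite)
  then show ?thesis
  proof (rule Bochner_Integration.integrable_bound)
    have ab: "\<bar>s\<bar> \<le> 1 + s\<^sup>2" for s :: real
      using zero_le_power2[of "\<bar>s\<bar> - 1"] abs_ge_zero[of s] unfolding power2_diff by (simp add: power2_abs)
    have M0: "M \<ge> 0" using M[of 0] by (smt (verit))
    show "AE x in lborel. norm (u x * \<xi> x) \<le> norm (M * (indicator (ball 0 R) x + (u x)\<^sup>2))"
    proof (rule AE_I2)
      fix x
      show "norm (u x * \<xi> x) \<le> norm (M * (indicator (ball 0 R) x + (u x)\<^sup>2))"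
      proof (cases "norm x < R")
        case True
        have "\<bar>u x\<bar> * \<bar>\<xi> x\<bar> \<le> (1 + (u x)\<^sup>2) * M"
          by (intro mult_mono ab M) auto
        then show ?thesis using True M0 by (simp add: abs_mult mult.commute)
      next
        case False then show ?thesis using R by simp
      qed
    qed
  qed measurable
qed

lemma integrable_pair_product:
  fixes a :: "R2 \<Rightarrow> real" and b :: "real \<Rightarrow> real"
  assumes a: "integrable lborel a" and b: "integrable lborel b"
  shows "integrable (lborel \<Otimes>\<^sub>M lborel) (\<lambda>(x, y). a x * b y)"
proof (rule lborel_pair.Fubini_integrable)
  note [measurable] = borel_measurable_integrable[OF a] borel_measurable_integrable[OF b]
  show "(\<lambda>(x, y). a x * b y) \<in> borel_measurable (lborel \<Otimes>\<^sub>M lborel)" by measurable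
  show "integrable lborel (\<lambda>x. \<integral>y. norm (case (x, y) of (x, y) \<Rightarrow> a x * b y) \<partial>lborel)"
    using a by (simp add: abs_mult)
  show "AE x in lborel. integrable lborel (\<lambda>y. case (x, y) of (x, y) \<Rightarrow> a x * b y)"
    using b by simp
qed

section \<open>The shear (x, s) to (x + s e, s) and increments along segments\<close>

lemma shear_measurable[measurable]:
  "(\<lambda>(x, s). (x + s *\<^sub>R e, s)) \<in> (lborel \<Otimes>\<^sub>M lborel :: (R2 \<times> real) measure) \<rightarrow>\<^sub>M (lborel \<Otimes>\<^sub>M lborel)"
  by measurable

text \<open>For fixed \<open>s\<close> the map is a translation of the plane, so Tonelli and
  translation invariance suffice.\<close>

lemma shear_distr:
  "distr (lborel \<Otimes>\<^sub>M lborel) (lborel \<Otimes>\<^sub>M lborel) (\<lambda>(x, s). (x + s *\<^sub>R e, s)) = (lborel \<Otimes>\<^sub>M lborel :: (R2 \<times> real) measure)"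
proof (rule measure_eqI)
  let ?P = "lborel \<Otimes>\<^sub>M lborel :: (R2 \<times> real) measure"
  let ?T = "\<lambda>(x::R2, s::real). (x + s *\<^sub>R e, s)"
  fix A assume "A \<in> sets (distr ?P ?P ?T)"
  then have A[measurable]: "A \<in> sets ?P" by simp
  have tr: "(\<integral>\<^sup>+x. indicator A (x + s *\<^sub>R e, s) \<partial>lborel) = (\<integral>\<^sup>+x. indicator A (x, s) \<partial>lborel)" for s
  proof -
    have "(\<integral>\<^sup>+x. indicator A (x, s) \<partial>lborel) = (\<integral>\<^sup>+x. indicator A (x, s) \<partial>distr lborel borel ((+) (s *\<^sub>R e)))"
      by (simp add: lborel_distr_plus)
    also have "\<dots> = (\<integral>\<^sup>+x. indicator A (s *\<^sub>R e + x, s) \<partial>lborel)"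
      by (rule nn_integral_distr) measurable
    finally show ?thesis by (simp add: add.commute)
  qed
  have "emeasure (distr ?P ?P ?T) A = (\<integral>\<^sup>+z. indicator A z \<partial>distr ?P ?P ?T)"
    by (rule nn_integral_indicator[symmetric]) (use A in simp)
  also have "\<dots> = (\<integral>\<^sup>+z. indicator A (?T z) \<partial>?P)"
    by (rule nn_integral_distr) measurable
  also have "\<dots> = (\<integral>\<^sup>+s. \<integral>\<^sup>+x. indicator A (x + s *\<^sub>R e, s) \<partial>lborel \<partial>lborel)"
    by (subst lborel_pair.nn_integral_snd[symmetric]) (auto simp: case_prod_beta)
  also have "\<dots> = (\<integral>\<^sup>+s. \<integral>\<^sup>+x. indicator A (x, s) \<partial>lborel \<partial>lborel)"
    by (simp add: tr)
  also have "\<dots> = (\<integral>\<^sup>+z. indicator A z \<partial>?P)"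
    by (subst lborel_pair.nn_integral_snd[symmetric]) (auto simp: case_prod_beta)
  also have "\<dots> = emeasure ?P A" by (rule nn_integral_indicator) (rule A)
  finally show "emeasure (distr ?P ?P ?T) A = emeasure ?P A" .
qed simp

lemma shear_integral:
  fixes F :: "R2 \<times> real \<Rightarrow> real"
  assumes [measurable]: "F \<in> borel_measurable (lborel \<Otimes>\<^sub>M lborel)"
  shows "integrable (lborel \<Otimes>\<^sub>M lborel) (\<lambda>(x, s). F (x + s *\<^sub>R e, s)) \<longleftrightarrow> integrable (lborel \<Otimes>\<^sub>M lborel) F"
    and "(\<integral>z. (case z of (x, s) \<Rightarrow> F (x + s *\<^sub>R e, s)) \<partial>(lborel \<Otimes>\<^sub>M lborel)) = (\<integral>z. F z \<partial>(lborel \<Otimes>\<^sub>M lborel))"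
proof -
  have "integrable (lborel \<Otimes>\<^sub>M lborel) F \<longleftrightarrow> integrable (distr (lborel \<Otimes>\<^sub>M lborel) (lborel \<Otimes>\<^sub>M lborel) (\<lambda>(x, s). (x + s *\<^sub>R e, s))) F"
    by (simp add: shear_distr)
  also have "\<dots> \<longleftrightarrow> integrable (lborel \<Otimes>\<^sub>M lborel) (\<lambda>z. F ((\<lambda>(x, s). (x + s *\<^sub>R e, s)) z))"
    by (rule integrable_distr_eq) measurable
  finally show "integrable (lborel \<Otimes>\<^sub>M lborel) (\<lambda>(x, s). F (x + s *\<^sub>R e, s)) \<longleftrightarrow> integrable (lborel \<Otimes>\<^sub>M lborel) F"
    by (simp add: case_prod_beta')
  have "(\<integral>z. F z \<partial>(lborel \<Otimes>\<^sub>M lborel)) = (\<integral>z. F z \<partial>distr (lborel \<Otimes>\<^sub>M lborel) (lborel \<Otimes>\<^sub>M lborel) (\<lambda>(x, s). (x + s *\<^sub>R e, s)))"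
    by (simp add: shear_distr)
  also have "\<dots> = (\<integral>z. F ((\<lambda>(x, s). (x + s *\<^sub>R e, s)) z) \<partial>(lborel \<Otimes>\<^sub>M lborel))"
    by (rule integral_distr) measurable
  finally show "(\<integral>z. (case z of (x, s) \<Rightarrow> F (x + s *\<^sub>R e, s)) \<partial>(lborel \<Otimes>\<^sub>M lborel)) = (\<integral>z. F z \<partial>(lborel \<Otimes>\<^sub>M lborel))"
    by (simp add: case_prod_beta')
qed

lemma lborel_translate:
  fixes F :: "R2 \<Rightarrow> real"
  assumes [measurable]: "F \<in> borel_measurable borel"
  shows "integrable lborel (\<lambda>x. F (x + a)) \<longleftrightarrow> integrable lborel F"
    and "(\<integral>x. F (x + a) \<partial>lborel) = (\<integral>x. F x \<partial>lborel)"
proof -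
  have "integrable lborel F \<longleftrightarrow> integrable (distr lborel borel ((+) a)) F" by (simp add: lborel_distr_plus)
  also have "\<dots> \<longleftrightarrow> integrable lborel (\<lambda>x. F (a + x))" by (rule integrable_distr_eq) auto
  finally show "integrable lborel (\<lambda>x. F (x + a)) \<longleftrightarrow> integrable lborel F" by (simp add: add.commute)
  have "(\<integral>x. F x \<partial>lborel) = (\<integral>x. F x \<partial>distr lborel borel ((+) a))" by (simp add: lborel_distr_plus)
  also have "\<dots> = (\<integral>x. F (a + x) \<partial>lborel)" by (rule integral_distr) auto
  finally show "(\<integral>x. F (x + a) \<partial>lborel) = (\<integral>x. F x \<partial>lborel)" by (simp add: add.commute)
qed

lemma shear_local:
  fixes g \<xi> :: "R2 \<Rightarrow> real"
  assumes g: "sqi g" and \<xi>[measurable]: "\<xi> \<in> borel_measurable borel" and M: "\<And>x. \<bar>\<xi> x\<bar> \<le> M"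
    and R: "\<forall>x. norm x \<ge> R \<longrightarrow> \<xi> x = 0"
  shows "integrable (lborel \<Otimes>\<^sub>M lborel) (\<lambda>(x, s). g x * \<xi> (x - s *\<^sub>R e) * indicator {0..1} s)"
    and "integrable (lborel \<Otimes>\<^sub>M lborel) (\<lambda>(x, s). g (x + s *\<^sub>R e) * \<xi> x * indicator {0..1} s)"
    and "(\<integral>(x, s). g (x + s *\<^sub>R e) * \<xi> x * indicator {0..1} s \<partial>(lborel \<Otimes>\<^sub>M lborel)) =
         (\<integral>(x, s). g x * \<xi> (x - s *\<^sub>R e) * indicator {0..1} s \<partial>(lborel \<Otimes>\<^sub>M lborel))"
proof -
  note [measurable] = sqi_borel[OF g]
  have "M \<ge> 0" using M[of 0] by (smt (verit))
  \<comment> \<open>For \<open>s\<close> in [0, 1] the support of \<open>\<xi>\<close> is moved by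
    at most \<open>norm e\<close>; the ball of radius \<open>R + norm e\<close> contains all shifted
    supports and gives a majorant that does not depend on \<open>s\<close>.\<close>
  let ?b = "\<lambda>x::R2. M * indicator (ball 0 (R + norm e)) x :: real"
  have gi: "integrable lborel (\<lambda>x. g x * ?b x)"
    by (rule sqi_local_integrable[OF g, where M = M and R = "R + norm e"])
       (measurable, use \<open>M \<ge> 0\<close> in \<open>auto split: split_indicator\<close>)
  have "integrable (lborel \<Otimes>\<^sub>M lborel) (\<lambda>(x, s). g x * ?b x * indicator {0..1} (s::real))"
    by (rule integrable_pair_product[OF gi]) simp
  then show 1: "integrable (lborel \<Otimes>\<^sub>M lborel) (\<lambda>(x, s). g x * \<xi> (x - s *\<^sub>R e) * indicator {0..1} s)"
  proof (rule Bochner_Integration.integrable_bound)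
    have *: "\<bar>g x * \<xi> (x - s *\<^sub>R e) * indicator {0..1} s\<bar> \<le> \<bar>g x * ?b x * indicator {0..1} s\<bar>" for x s
    proof (cases "s \<in> {0..1}")
      case True
      have "\<bar>\<xi> (x - s *\<^sub>R e)\<bar> \<le> ?b x"
      proof (cases "norm x < R + norm e")
        case False
        have "norm (s *\<^sub>R e) \<le> norm e" using True by (simp add: mult_left_le_one_le)
        then have "norm (x - s *\<^sub>R e) \<ge> R" using False norm_triangle_ineq2[of x "s *\<^sub>R e"] by simp
        then show ?thesis using R False by simp
      qed (use M in simp)
      then show ?thesis using True \<open>M \<ge> 0\<close> by (auto simp: abs_mult intro!: mult_left_mono)
    qed simp
    show "AE z in lborel \<Otimes>\<^sub>M lborel. norm (case z of (x, s) \<Rightarrow> g x * \<xi> (x - s *\<^sub>R e) * indicator {0..1} s)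
          \<le> norm (case z of (x, s) \<Rightarrow> g x * ?b x * indicator {0..1} s)"
      using * by (intro AE_I2) (auto simp: case_prod_beta)
  qed measurable
  let ?F = "\<lambda>(x, s). g x * \<xi> (x - s *\<^sub>R e) * indicator {0..1} s"
  have m: "?F \<in> borel_measurable (lborel \<Otimes>\<^sub>M lborel)" by measurable
  show "integrable (lborel \<Otimes>\<^sub>M lborel) (\<lambda>(x, s). g (x + s *\<^sub>R e) * \<xi> x * indicator {0..1} s)"
    using shear_integral(1)[OF m, of e] 1 by simp
  show "(\<integral>(x, s). g (x + s *\<^sub>R e) * \<xi> x * indicator {0..1} s \<partial>(lborel \<Otimes>\<^sub>M lborel)) =
         (\<integral>(x, s). g x * \<xi> (x - s *\<^sub>R e) * indicator {0..1} s \<partial>(lborel \<Otimes>\<^sub>M lborel))"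
    using shear_integral(2)[OF m, of e] by simp
qed

lemma test_fun_diff_integral:
  assumes \<phi>: "test_fun UNIV \<phi>"
  shows "\<phi> (x - e) - \<phi> x = - (\<integral>s. frechet_derivative \<phi> (at (x - s *\<^sub>R e)) e * indicator {0..1} s \<partial>lborel)"
proof -
  have sm: "smooth2 \<phi>" using \<phi> by (rule test_fun_smooth2)
  have lin: "linear (frechet_derivative \<phi> (at y))" for y
    by (intro linear_frechet_derivative smooth2_differentiable sm)
  have d: "((\<lambda>s. \<phi> (x - s *\<^sub>R e)) has_vector_derivative - frechet_derivative \<phi> (at (x - s *\<^sub>R e)) e) (at s within {0..1})" for s
    using test_fun_line_derivative[OF \<phi>, of x "-e" s "{0..1}"] linear_neg[OF lin]
    by (simp add: has_real_derivative_iff_has_vector_derivative)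
  have c: "continuous_on {0..1} (\<lambda>s. - frechet_derivative \<phi> (at (x - s *\<^sub>R e)) e)"
    by (intro continuous_intros continuous_on_compose2[OF smooth2_continuous[OF smooth2_frechet[OF sm]]]) auto
  have "(\<integral>s. - frechet_derivative \<phi> (at (x - s *\<^sub>R e)) e * indicator {0..1} s \<partial>lborel) = \<phi> (x - 1 *\<^sub>R e) - \<phi> (x - 0 *\<^sub>R e)"
    using integral_FTC_atLeastAtMost[of 0 1 "\<lambda>s. \<phi> (x - s *\<^sub>R e)" "\<lambda>s. - frechet_derivative \<phi> (at (x - s *\<^sub>R e)) e"] d c
    by (simp add: mult.commute)
  then show ?thesis by simp
qed

lemma wdir_translate:
  assumes "wdir e u g" "test_fun UNIV \<phi>"
  shows "(\<integral>x. u x * frechet_derivative \<phi> (at (x - a)) e \<partial>lborel) = - (\<integral>x. g x * \<phi> (x - a) \<partial>lborel)"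
proof -
  have "frechet_derivative (\<lambda>x. \<phi> (x - a)) (at x) e = frechet_derivative \<phi> (at (x - a)) e" for x
  proof -
    have "((\<lambda>x. \<phi> (x - a)) has_derivative frechet_derivative \<phi> (at (x - a))) (at x)"
      using frechet_derivative_affine[of \<phi> 1 1 "-a" x] smooth2_differentiable[OF test_fun_smooth2[OF assms(2)]]
      by simp
    from frechet_derivative_at[OF this] show ?thesis by simp
  qed
  moreover have "test_fun UNIV (\<lambda>x. \<phi> (x - a))" using test_fun_affine[OF assms(2), of 1 "-a"] by simp
  then have "(\<integral>x. u x * frechet_derivative (\<lambda>x. \<phi> (x - a)) (at x) e \<partial>lborel) = - (\<integral>x. g x * \<phi> (x - a) \<partial>lborel)"
    using assms(1) unfolding wdir_def by blast
  ultimately show ?thesis by simp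
qed

text \<open>The increment of \<open>\<phi>\<close> is the integral of its derivative along the
  segment. After exchanging the integrals, the definition of the weak derivative applies to every
  translate of \<open>\<phi>\<close> separately.\<close>

lemma translation_integral:
  assumes u: "sqi u" and g: "sqi g" and w: "wdir e u g" and \<phi>: "test_fun UNIV \<phi>"
  shows "(\<integral>x. u x * (\<phi> (x - e) - \<phi> x) \<partial>lborel) =
         (\<integral>(x, s). g x * \<phi> (x - s *\<^sub>R e) * indicator {0..1} s \<partial>(lborel \<Otimes>\<^sub>M lborel))"
proof -
  let ?D = "\<lambda>x. frechet_derivative \<phi> (at x) e"
  note [measurable] = sqi_borel[OF u] sqi_borel[OF g] test_fun_borel[OF \<phi>] test_fun_deriv_borel[OF \<phi>]
  obtain R L where RL: "\<forall>x. norm x \<ge> R \<longrightarrow> \<phi> x = 0" "\<forall>x. norm x \<ge> R \<longrightarrow> ?D x = 0"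
    "\<And>x. \<bar>\<phi> x\<bar> \<le> L" "\<And>x. \<bar>?D x\<bar> \<le> L"
    using test_fun_bounds[OF \<phi>, of e] by metis
  note i1 = shear_local(1)[OF u test_fun_deriv_borel[OF \<phi>] RL(4) RL(2), where e = e]
  note i2 = shear_local(1)[OF g test_fun_borel[OF \<phi>] RL(3) RL(1), where e = e]
  have "(\<integral>x. u x * (\<phi> (x - e) - \<phi> x) \<partial>lborel) =
        - (\<integral>x. (\<integral>s. u x * ?D (x - s *\<^sub>R e) * indicator {0..1} s \<partial>lborel) \<partial>lborel)"
    by (simp add: test_fun_diff_integral[OF \<phi>] mult.assoc)
  also have "\<dots> = - (\<integral>s. (\<integral>x. u x * ?D (x - s *\<^sub>R e) * indicator {0..1} s \<partial>lborel) \<partial>lborel)"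
    by (subst lborel_pair.Fubini_integral[OF i1]) simp
  also have "\<dots> = (\<integral>s. (\<integral>x. g x * \<phi> (x - s *\<^sub>R e) * indicator {0..1} s \<partial>lborel) \<partial>lborel)"
    by (simp add: wdir_translate[OF w \<phi>])
  also have "\<dots> = (\<integral>(x, s). g x * \<phi> (x - s *\<^sub>R e) * indicator {0..1} s \<partial>(lborel \<Otimes>\<^sub>M lborel))"
    by (rule lborel_pair.integral_snd[OF i2])
  finally show ?thesis .
qed

text \<open>The fundamental theorem of calculus along segments, almost everywhere. Tested against
  \<open>\<phi>\<close>, the left side is handled by translation invariance and the right side by
  the shear, and both give the integral in \<open>translation_integral\<close>.\<close>

lemma translation_identity:
  assumes u: "sqi u" and g: "sqi g" and w: "wdir e u g"
  shows "AE x in lborel. u (x + e) - u x = (\<integral>s. g (x + s *\<^sub>R e) * indicator {0..1} s \<partial>lborel)"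
proof -
  note [measurable] = sqi_borel[OF u] sqi_borel[OF g]
  let ?I = "\<lambda>x. \<integral>s. g (x + s *\<^sub>R e) * indicator {0..1} s \<partial>lborel"
  have "AE x in lborel. u (x + e) - u x - ?I x = 0"
  proof (rule fundamental_lemma_lborel)
    show "(\<lambda>x. u (x + e) - u x - ?I x) \<in> borel_measurable borel" by measurable
    fix \<phi> assume \<phi>: "test_fun UNIV \<phi>"
    note [measurable] = test_fun_borel[OF \<phi>]
    obtain R L where RL: "\<forall>x. norm x \<ge> R \<longrightarrow> \<phi> x = 0" "\<And>x. \<bar>\<phi> x\<bar> \<le> L"
      using test_fun_bounds[OF \<phi>, of e] by metis
    note s = shear_local[OF g test_fun_borel[OF \<phi>] RL(2) RL(1), where e = e]
    have i0: "integrable lborel (\<lambda>x. u x * \<phi> x)" by (rule sqi_local_integrable[OF u _ RL(2) RL(1)]) auto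
    have i1: "integrable lborel (\<lambda>x. u x * \<phi> (x - e))"
      by (rule sqi_local_integrable[OF u, where M = L and R = "R + norm e"])
         (use RL norm_triangle_ineq2[of _ e] in \<open>auto simp: algebra_simps intro!: RL(1)[rule_format] order_trans[OF _ norm_triangle_ineq2]\<close>)
    have i1': "integrable lborel (\<lambda>x. u (x + e) * \<phi> x)"
      using lborel_translate(1)[of "\<lambda>x. u x * \<phi> (x - e)" e] i1 by simp
    have e1: "(\<integral>x. u (x + e) * \<phi> x \<partial>lborel) = (\<integral>x. u x * \<phi> (x - e) \<partial>lborel)"
      using lborel_translate(2)[of "\<lambda>x. u x * \<phi> (x - e)" e] by simp
    have eqI: "(\<lambda>x. \<integral>s. g (x + s *\<^sub>R e) * \<phi> x * indicator {0..1} s \<partial>lborel) = (\<lambda>x. ?I x * \<phi> x)"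
      by (rule ext, subst Bochner_Integration.integral_mult_left_zero[symmetric]) (simp add: mult_ac)
    have i2: "integrable lborel (\<lambda>x. ?I x * \<phi> x)"
      using lborel_pair.integrable_fst[OF s(2)] unfolding eqI .
    have e2: "(\<integral>x. ?I x * \<phi> x \<partial>lborel) = (\<integral>x. u x * (\<phi> (x - e) - \<phi> x) \<partial>lborel)"
      using lborel_pair.integral_fst[OF s(2)] unfolding eqI translation_integral[OF u g w \<phi>] s(3) .
    have *: "(\<lambda>x. (u (x + e) - u x - ?I x) * \<phi> x) = (\<lambda>x. u (x + e) * \<phi> x - u x * \<phi> x - ?I x * \<phi> x)"
      by (simp add: algebra_simps)
    show "integrable lborel (\<lambda>x. (u (x + e) - u x - ?I x) * \<phi> x)"
      unfolding * by (intro Bochner_Integration.integrable_diff i0 i1' i2)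
    have "(\<integral>x. u x * (\<phi> (x - e) - \<phi> x) \<partial>lborel) = (\<integral>x. u x * \<phi> (x - e) \<partial>lborel) - (\<integral>x. u x * \<phi> x \<partial>lborel)"
      using i0 i1 by (simp add: right_diff_distrib)
    then show "(\<integral>x. (u (x + e) - u x - ?I x) * \<phi> x \<partial>lborel) = 0"
      unfolding * using i0 i1' i2 e1 e2 by simp
  qed
  then show ?thesis by eventually_elim simp
qed

lemma square_integral_le:
  fixes h :: "real \<Rightarrow> real"
  assumes [measurable]: "h \<in> borel_measurable borel"
  shows "ennreal ((\<integral>s. h s * indicator {0..1} s \<partial>lborel)\<^sup>2) \<le> (\<integral>\<^sup>+s. ennreal ((h s)\<^sup>2) * indicator {0..1} s \<partial>lborel)"
proof (cases "integrable lborel (\<lambda>s. h s * indicator {0..1} s) \<and> (\<integral>\<^sup>+s. ennreal ((h s)\<^sup>2) * indicator {0..1} s \<partial>lborel) \<noteq> \<infinity>")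
  case True
  let ?i = "indicator {0..1} :: real \<Rightarrow> real"
  have eq: "(\<integral>\<^sup>+s. ennreal ((h s)\<^sup>2) * indicator {0..1} s \<partial>lborel) = (\<integral>\<^sup>+s. ennreal ((h s)\<^sup>2 * ?i s) \<partial>lborel)"
    by (intro nn_integral_cong) (auto split: split_indicator)
  have i2: "integrable lborel (\<lambda>s. (h s)\<^sup>2 * ?i s)"
    using True by (intro integrableI_bounded) (auto simp: eq top.not_eq_extremum)
  have i1: "integrable lborel (\<lambda>s. h s * ?i s)" and i0: "integrable lborel ?i" using True by auto
  \<comment> \<open>\<open>c\<close> is the mean of \<open>h\<close> over [0, 1]; the inequality
    expresses that the variance is nonnegative.\<close>
  define c where "c = (\<integral>s. h s * ?i s \<partial>lborel)"
  have "0 \<le> (\<integral>s. (h s - c)\<^sup>2 * ?i s \<partial>lborel)" by simp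
  also have "(\<lambda>s. (h s - c)\<^sup>2 * ?i s) = (\<lambda>s. (h s)\<^sup>2 * ?i s - (2 * c) * (h s * ?i s) + c\<^sup>2 * ?i s)"
    by (simp add: power2_diff algebra_simps)
  also have "(\<integral>s. (h s)\<^sup>2 * ?i s - (2 * c) * (h s * ?i s) + c\<^sup>2 * ?i s \<partial>lborel)
     = (\<integral>s. (h s)\<^sup>2 * ?i s \<partial>lborel) - 2 * c * c + c\<^sup>2"
    using i0 i1 i2 by (simp add: c_def)
  finally have "c\<^sup>2 \<le> (\<integral>s. (h s)\<^sup>2 * ?i s \<partial>lborel)" by (simp add: power2_eq_square)
  then have "ennreal (c\<^sup>2) \<le> ennreal (\<integral>s. (h s)\<^sup>2 * ?i s \<partial>lborel)" by (rule ennreal_leI)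
  also have "\<dots> = (\<integral>\<^sup>+s. ennreal ((h s)\<^sup>2 * ?i s) \<partial>lborel)"
    by (rule nn_integral_eq_integral[symmetric]) (use i2 in auto)
  finally show ?thesis by (simp add: eq c_def)
next
  \<comment> \<open>If \<open>h\<close> is not integrable on [0, 1], the left side is 0 by default;
    otherwise the right side is infinite.\<close>
  case False
  then show ?thesis by (auto simp: not_integrable_integral_eq)
qed

lemma nn_integral_translate:
  fixes F :: "R2 \<Rightarrow> ennreal"
  assumes [measurable]: "F \<in> borel_measurable borel"
  shows "(\<integral>\<^sup>+x. F (x + a) \<partial>lborel) = (\<integral>\<^sup>+x. F x \<partial>lborel)"
proof -
  have "(\<integral>\<^sup>+x. F x \<partial>lborel) = (\<integral>\<^sup>+x. F x \<partial>distr lborel borel ((+) a))" by (simp add: lborel_distr_plus)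
  also have "\<dots> = (\<integral>\<^sup>+x. F (a + x) \<partial>lborel)" by (rule nn_integral_distr) auto
  finally show ?thesis by (simp add: add.commute)
qed

text \<open>The square of a mean over a segment is at most the mean of the squares; Tonelli and
  translation invariance then remove the shift. The localized form is needed because the logarithmic
  gradient bound is only local: later \<open>B'\<close> is a convex box that contains the points of
  \<open>B\<close> and their translates.\<close>

lemma translation_estimate:
  assumes u: "sqi u" and g: "sqi g" and w: "wdir e u g"
    and [measurable]: "B \<in> sets borel" "B' \<in> sets borel"
    and sub: "\<And>x s. x \<in> B \<Longrightarrow> 0 \<le> s \<Longrightarrow> s \<le> 1 \<Longrightarrow> x + s *\<^sub>R e \<in> B'"
  shows "(\<integral>\<^sup>+x. ennreal ((u (x + e) - u x)\<^sup>2) * indicator B x \<partial>lborel)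
         \<le> (\<integral>\<^sup>+x. ennreal ((g x)\<^sup>2) * indicator B' x \<partial>lborel)"
proof -
  note [measurable] = sqi_borel[OF u] sqi_borel[OF g]
  have "(\<integral>\<^sup>+x. ennreal ((u (x + e) - u x)\<^sup>2) * indicator B x \<partial>lborel)
      \<le> (\<integral>\<^sup>+x. (\<integral>\<^sup>+s. ennreal ((g (x + s *\<^sub>R e))\<^sup>2) * indicator {0..1} s \<partial>lborel) * indicator B x \<partial>lborel)"
  proof (rule nn_integral_mono_AE)
    show "AE x in lborel. ennreal ((u (x + e) - u x)\<^sup>2) * indicator B x \<le> (\<integral>\<^sup>+s. ennreal ((g (x + s *\<^sub>R e))\<^sup>2) * indicator {0..1} s \<partial>lborel) * indicator B x"
      using translation_identity[OF u g w]
    proof eventually_elim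
      case (elim x)
      then show ?case using square_integral_le[of "\<lambda>s. g (x + s *\<^sub>R e)"]
        by (auto split: split_indicator)
    qed
  qed
  also have "\<dots> = (\<integral>\<^sup>+x. \<integral>\<^sup>+s. ennreal ((g (x + s *\<^sub>R e))\<^sup>2) * indicator {0..1} s * indicator B x \<partial>lborel \<partial>lborel)"
    by (subst nn_integral_multc) auto
  also have "\<dots> = (\<integral>\<^sup>+s. \<integral>\<^sup>+x. ennreal ((g (x + s *\<^sub>R e))\<^sup>2) * indicator {0..1} s * indicator B x \<partial>lborel \<partial>lborel)"
    by (rule lborel_pair.Fubini') measurable
  also have "\<dots> \<le> (\<integral>\<^sup>+s. \<integral>\<^sup>+x. (ennreal ((g (x + s *\<^sub>R e))\<^sup>2) * indicator B' (x + s *\<^sub>R e)) * indicator {0..1} s \<partial>lborel \<partial>lborel)"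
    using sub by (intro nn_integral_mono) (auto split: split_indicator)
  also have "\<dots> = (\<integral>\<^sup>+s. (\<integral>\<^sup>+x. ennreal ((g (x + s *\<^sub>R e))\<^sup>2) * indicator B' (x + s *\<^sub>R e) \<partial>lborel) * indicator {0..1} s \<partial>lborel)"
    by (subst nn_integral_multc) auto
  also have "\<dots> = (\<integral>\<^sup>+s. (\<integral>\<^sup>+x. ennreal ((g x)\<^sup>2) * indicator B' x \<partial>lborel) * indicator {0..1::real} s \<partial>lborel)"
    by (simp add: nn_integral_translate[where F = "\<lambda>x. ennreal ((g x)\<^sup>2) * indicator B' x"])
  also have "\<dots> = (\<integral>\<^sup>+x. ennreal ((g x)\<^sup>2) * indicator B' x \<partial>lborel)"
    by (simp add: nn_integral_cmult_indicator)
  finally show ?thesis .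
qed

lemma wdir_scale:
  assumes "wdir e u g" shows "wdir (t *\<^sub>R e) u (\<lambda>x. t * g x)"
  unfolding wdir_def
proof (intro allI impI)
  fix \<phi> assume \<phi>: "test_fun UNIV \<phi>"
  have lin: "linear (frechet_derivative \<phi> (at y))" for y
    by (intro linear_frechet_derivative smooth2_differentiable test_fun_smooth2 \<phi>)
  have "(\<integral>x. u x * frechet_derivative \<phi> (at x) (t *\<^sub>R e) \<partial>lborel) = (\<integral>x. t * (u x * frechet_derivative \<phi> (at x) e) \<partial>lborel)"
    by (simp add: linear_scale[OF lin] mult_ac)
  also have "\<dots> = t * - (\<integral>x. g x * \<phi> x \<partial>lborel)"
    using assms \<phi> unfolding wdir_def by simp
  also have "\<dots> = - (\<integral>x. t * g x * \<phi> x \<partial>lborel)"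
    by (simp add: mult.assoc)
  finally show "(\<integral>x. u x * frechet_derivative \<phi> (at x) (t *\<^sub>R e) \<partial>lborel) = - (\<integral>x. t * g x * \<phi> x \<partial>lborel)" .
qed

lemma sqi_scale: "sqi g \<Longrightarrow> sqi (\<lambda>x. t * g x)"
  by (auto simp: sqi_def power_mult_distrib)

text \<open>All values lie in (0, 1], so a shift by \<open>tn n *\<^sub>R e\<close> moves supports
  by at most \<open>norm e\<close>.\<close>

definition tn :: "nat \<Rightarrow> real" where "tn n = 1 / (real n + 1)"

lemma tn_pos: "tn n > 0" and tn_le_1: "tn n \<le> 1" and tn_lim: "tn \<longlonglongrightarrow> 0"
  and tn_summable: "summable (\<lambda>n. (tn n)\<^sup>2)"
proof -
  show "tn n > 0" "tn n \<le> 1" by (auto simp: tn_def)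
  show "tn \<longlonglongrightarrow> 0" unfolding tn_def using LIMSEQ_inverse_real_of_nat by (simp add: inverse_eq_divide add.commute)
  have "summable (\<lambda>n. inverse (real (Suc n) ^ 2))" by (rule inverse_power_summable[THEN summable_Suc_iff[THEN iffD2]]) simp
  then show "summable (\<lambda>n. (tn n)\<^sup>2)" by (simp add: tn_def power_divide inverse_eq_divide add.commute)
qed

text \<open>Since the increments are square summable along \<^term>\<open>tn\<close>, no subsequence is needed.\<close>

lemma translation_continuous_AE:
  fixes r :: "real \<Rightarrow> real"
  assumes u: "sqi u" and g: "sqi g" and w: "wdir e u g"
    and r[measurable]: "r \<in> borel_measurable borel" and r1: "\<And>s. 0 \<le> s \<Longrightarrow> s \<le> 1 \<Longrightarrow> \<bar>r s\<bar> \<le> 1"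
  shows "AE z in lborel \<Otimes>\<^sub>M lborel. case z of (x, s) \<Rightarrow> 0 \<le> s \<longrightarrow> s \<le> 1 \<longrightarrow> (\<lambda>n. u (x + (tn n * r s) *\<^sub>R e)) \<longlonglongrightarrow> u x"
proof -
  note [measurable] = sqi_borel[OF u] sqi_borel[OF g]
  let ?P = "lborel \<Otimes>\<^sub>M lborel :: (R2 \<times> real) measure"
  \<comment> \<open>In the application \<open>r s\<close> is \<open>- s\<close> or
    \<open>1 - s\<close>, giving the two ends of a shifted segment; convergence is therefore needed
    almost everywhere jointly in \<open>x\<close> and \<open>s\<close>.\<close>
  define F where "F n = (\<lambda>(x, s). ennreal ((u (x + (tn n * r s) *\<^sub>R e) - u x)\<^sup>2) * indicator {0..1} s)" for n
  have [measurable]: "F n \<in> borel_measurable ?P" for n unfolding F_def by measurable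
  define K where "K = (\<integral>x. (g x)\<^sup>2 \<partial>lborel)"
  have K: "(\<integral>\<^sup>+x. ennreal ((g x)\<^sup>2) \<partial>lborel) = ennreal K"
    unfolding K_def by (rule nn_integral_eq_integral) (use g in \<open>auto simp: sqi_def\<close>)
  have K0: "K \<ge> 0" by (simp add: K_def)
  have *: "(\<integral>\<^sup>+x. ennreal ((u (x + (tn n * r s) *\<^sub>R e) - u x)\<^sup>2) \<partial>lborel) \<le> ennreal ((tn n)\<^sup>2 * K)"
    if "0 \<le> s" "s \<le> 1" for n s
  proof -
    have "(\<integral>\<^sup>+x. ennreal ((u (x + (tn n * r s) *\<^sub>R e) - u x)\<^sup>2) \<partial>lborel)
         \<le> (\<integral>\<^sup>+x. ennreal ((tn n * r s * g x)\<^sup>2) \<partial>lborel)"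
      using translation_estimate[OF u sqi_scale[OF g] wdir_scale[OF w], of UNIV UNIV "tn n * r s"] by simp
    also have "\<dots> \<le> (\<integral>\<^sup>+x. ennreal ((tn n)\<^sup>2) * ennreal ((g x)\<^sup>2) \<partial>lborel)"
    proof (rule nn_integral_mono)
      fix x
      have "(r s)\<^sup>2 \<le> 1" using r1[OF that] by (simp add: abs_square_le_1)
      then have "(tn n)\<^sup>2 * (r s)\<^sup>2 * (g x)\<^sup>2 \<le> (tn n)\<^sup>2 * 1 * (g x)\<^sup>2"
        by (intro mult_right_mono mult_left_mono) auto
      then show "ennreal ((tn n * r s * g x)\<^sup>2) \<le> ennreal ((tn n)\<^sup>2) * ennreal ((g x)\<^sup>2)"
        by (simp add: power_mult_distrib ennreal_mult[symmetric])
    qed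
    also have "\<dots> = ennreal ((tn n)\<^sup>2 * K)"
      by (simp add: nn_integral_cmult K ennreal_mult K0)
    finally show ?thesis .
  qed
  have Fn: "(\<integral>\<^sup>+z. F n z \<partial>?P) \<le> ennreal ((tn n)\<^sup>2 * K)" for n
  proof -
    have "(\<integral>\<^sup>+z. F n z \<partial>?P) = (\<integral>\<^sup>+s. \<integral>\<^sup>+x. F n (x, s) \<partial>lborel \<partial>lborel)"
      by (rule lborel_pair.nn_integral_snd[symmetric]) measurable
    also have "\<dots> = (\<integral>\<^sup>+s. (\<integral>\<^sup>+x. ennreal ((u (x + (tn n * r s) *\<^sub>R e) - u x)\<^sup>2) \<partial>lborel) * indicator {0..1} s \<partial>lborel)"
      unfolding F_def by (simp add: nn_integral_multc)
    also have "\<dots> \<le> (\<integral>\<^sup>+s. ennreal ((tn n)\<^sup>2 * K) * indicator {0..1::real} s \<partial>lborel)"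
      using * by (intro nn_integral_mono) (auto split: split_indicator)
    also have "\<dots> = ennreal ((tn n)\<^sup>2 * K)" by (simp add: nn_integral_cmult_indicator)
    finally show ?thesis .
  qed
  have "(\<integral>\<^sup>+z. (\<Sum>n. F n z) \<partial>?P) = (\<Sum>n. \<integral>\<^sup>+z. F n z \<partial>?P)"
    by (rule nn_integral_suminf) measurable
  also have "\<dots> \<le> (\<Sum>n. ennreal ((tn n)\<^sup>2 * K))" by (intro suminf_le Fn) auto
  also have "\<dots> = ennreal (\<Sum>n. (tn n)\<^sup>2 * K)"
    by (rule suminf_ennreal2) (use K0 tn_summable in \<open>auto intro: summable_mult2\<close>)
  finally have "(\<integral>\<^sup>+z. (\<Sum>n. F n z) \<partial>?P) \<noteq> \<infinity>"
    using neq_top_trans[OF ennreal_neq_top] by auto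
  then have "AE z in ?P. (\<Sum>n. F n z) \<noteq> \<infinity>"
    by (rule nn_integral_noteq_infinite[rotated]) measurable
  then show ?thesis
  proof eventually_elim
    case (elim z)
    obtain x s where z: "z = (x, s)" by (cases z)
    show ?case unfolding z prod.case
    proof (intro impI)
      assume s: "0 \<le> s" "s \<le> 1"
      have "(\<Sum>n. ennreal ((u (x + (tn n * r s) *\<^sub>R e) - u x)\<^sup>2)) \<noteq> top"
        using elim s by (simp add: F_def z)
      then have "summable (\<lambda>n. (u (x + (tn n * r s) *\<^sub>R e) - u x)\<^sup>2)"
        by (intro summable_suminf_not_top) auto
      then have "(\<lambda>n. (u (x + (tn n * r s) *\<^sub>R e) - u x)\<^sup>2) \<longlonglongrightarrow> 0"
        by (rule summable_LIMSEQ_zero)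
      then have "(\<lambda>n. sqrt ((u (x + (tn n * r s) *\<^sub>R e) - u x)\<^sup>2)) \<longlonglongrightarrow> sqrt 0"
        by (rule tendsto_real_sqrt)
      then show "(\<lambda>n. u (x + (tn n * r s) *\<^sub>R e)) \<longlonglongrightarrow> u x"
        by (simp add: tendsto_rabs_zero_iff LIM_zero_iff)
    qed
  qed
qed

text \<open>Writing the quotient as a mean of \<open>g\<close> and shearing moves the translation
  onto \<open>\<xi> n\<close>. Then \<open>g\<close> stays fixed, and dominated convergence needs
  only the almost everywhere convergence of the shifted \<open>\<xi> n\<close>, not any strong
  convergence of the quotients.\<close>

lemma difference_quotient_limit:
  assumes u: "sqi u" and g: "sqi g" and w: "wdir e u g"
    and [measurable]: "\<And>n. \<xi> n \<in> borel_measurable borel" "\<xi>0 \<in> borel_measurable borel"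
    and M: "\<And>n x. \<bar>\<xi> n x\<bar> \<le> M" and R: "\<And>n. \<forall>x. norm x \<ge> R \<longrightarrow> \<xi> n x = 0"
    and lim: "AE z in lborel \<Otimes>\<^sub>M lborel. case z of (x, s) \<Rightarrow> 0 \<le> s \<longrightarrow> s \<le> 1 \<longrightarrow> (\<lambda>n. \<xi> n (x - (tn n * s) *\<^sub>R e)) \<longlonglongrightarrow> \<xi>0 x"
  shows "(\<lambda>n. \<integral>x. (u (x + tn n *\<^sub>R e) - u x) / tn n * \<xi> n x \<partial>lborel) \<longlonglongrightarrow> (\<integral>x. g x * \<xi>0 x \<partial>lborel)"
proof -
  note [measurable] = sqi_borel[OF u] sqi_borel[OF g]
  let ?P = "lborel \<Otimes>\<^sub>M lborel :: (R2 \<times> real) measure"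
  have M0: "M \<ge> 0" using M[of 0 0] by (smt (verit))
  have eq: "(\<integral>x. (u (x + tn n *\<^sub>R e) - u x) / tn n * \<xi> n x \<partial>lborel)
          = (\<integral>(x, s). g x * \<xi> n (x - (tn n * s) *\<^sub>R e) * indicator {0..1} s \<partial>?P)" for n
  proof -
    note s = shear_local[OF g _ M R, of n, where e = "tn n *\<^sub>R e"]
    have "(\<integral>x. (u (x + tn n *\<^sub>R e) - u x) / tn n * \<xi> n x \<partial>lborel)
        = (\<integral>x. (\<integral>s. g (x + s *\<^sub>R (tn n *\<^sub>R e)) * \<xi> n x * indicator {0..1} s \<partial>lborel) \<partial>lborel)"
    proof (rule integral_cong_AE)
      show "AE x in lborel. (u (x + tn n *\<^sub>R e) - u x) / tn n * \<xi> n x = (\<integral>s. g (x + s *\<^sub>R (tn n *\<^sub>R e)) * \<xi> n x * indicator {0..1} s \<partial>lborel)"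
        using translation_identity[OF u sqi_scale[OF g] wdir_scale[OF w], of "tn n"]
      proof eventually_elim
        case (elim x)
        have "(\<integral>s. tn n * g (x + s *\<^sub>R tn n *\<^sub>R e) * indicator {0..1} s \<partial>lborel) = tn n * (\<integral>s. g (x + s *\<^sub>R tn n *\<^sub>R e) * indicator {0..1} s \<partial>lborel)"
          by (simp add: mult.assoc)
        moreover have "(\<integral>s. g (x + s *\<^sub>R (tn n *\<^sub>R e)) * \<xi> n x * indicator {0..1} s \<partial>lborel) = (\<integral>s. g (x + s *\<^sub>R (tn n *\<^sub>R e)) * indicator {0..1} s \<partial>lborel) * \<xi> n x"
          by (subst Bochner_Integration.integral_mult_left_zero[symmetric]) (simp add: mult_ac)
        ultimately show ?case using elim tn_pos[of n] by simp
      qed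
    qed measurable
    also have "\<dots> = (\<integral>(x, s). g (x + s *\<^sub>R (tn n *\<^sub>R e)) * \<xi> n x * indicator {0..1} s \<partial>?P)"
      by (rule lborel_pair.integral_fst) (use s(2) in simp)
    also have "\<dots> = (\<integral>(x, s). g x * \<xi> n (x - s *\<^sub>R (tn n *\<^sub>R e)) * indicator {0..1} s \<partial>?P)"
      using s(3) by simp
    finally show ?thesis by (simp add: mult.commute)
  qed
  let ?b = "\<lambda>x::R2. M * indicator (ball 0 (R + norm e)) x :: real"
  have gi: "integrable lborel (\<lambda>x. g x * ?b x)"
    by (rule sqi_local_integrable[OF g, where M = M and R = "R + norm e"])
       (measurable, use M0 in \<open>auto split: split_indicator\<close>)
  have "(\<lambda>n. \<integral>z. (case z of (x, s) \<Rightarrow> g x * \<xi> n (x - (tn n * s) *\<^sub>R e) * indicator {0..1} s) \<partial>?P)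
      \<longlonglongrightarrow> (\<integral>z. (case z of (x, s) \<Rightarrow> g x * \<xi>0 x * indicator {0..1} s) \<partial>?P)"
  proof (rule integral_dominated_convergence[where w = "\<lambda>z. \<bar>case z of (x, s) \<Rightarrow> g x * ?b x * indicator {0..1} s\<bar>"])
    show "integrable ?P (\<lambda>z. \<bar>case z of (x, s) \<Rightarrow> g x * ?b x * indicator {0..1} s\<bar>)"
      by (intro integrable_abs integrable_pair_product[OF gi]) simp
    show "AE z in ?P. (\<lambda>n. case z of (x, s) \<Rightarrow> g x * \<xi> n (x - (tn n * s) *\<^sub>R e) * indicator {0..1} s)
         \<longlonglongrightarrow> (case z of (x, s) \<Rightarrow> g x * \<xi>0 x * indicator {0..1} s)"
      using lim
    proof eventually_elim
      case (elim z)
      then show ?case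
        by (cases z, cases "snd z \<in> {0..1}") (auto intro!: tendsto_intros)
    qed
    have "\<bar>g x * \<xi> n (x - (tn n * s) *\<^sub>R e) * indicator {0..1} s\<bar> \<le> \<bar>g x * ?b x * indicator {0..1} s\<bar>" for x s n
    proof (cases "s \<in> {0..1}")
      case True
      have "\<bar>\<xi> n (x - (tn n * s) *\<^sub>R e)\<bar> \<le> ?b x"
      proof (cases "norm x < R + norm e")
        case False
        have "\<bar>tn n * s\<bar> \<le> 1" using True tn_le_1[of n] tn_pos[of n] by (simp add: abs_mult mult_le_one)
        then have "norm ((tn n * s) *\<^sub>R e) \<le> norm e" by (simp add: mult_left_le_one_le)
        then have "norm (x - (tn n * s) *\<^sub>R e) \<ge> R" using False norm_triangle_ineq2[of x "(tn n * s) *\<^sub>R e"] by simp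
        then show ?thesis using R False by simp
      qed (use M in simp)
      then show ?thesis using True M0 by (auto simp: abs_mult intro!: mult_left_mono)
    qed simp
    then show "AE z in ?P. norm (case z of (x, s) \<Rightarrow> g x * \<xi> n (x - (tn n * s) *\<^sub>R e) * indicator {0..1} s)
       \<le> \<bar>case z of (x, s) \<Rightarrow> g x * ?b x * indicator {0..1} s\<bar>" for n
      by (intro AE_I2) (auto simp: case_prod_beta)
  qed measurable
  also have "(\<integral>z. (case z of (x, s) \<Rightarrow> g x * \<xi>0 x * indicator {0..1} s) \<partial>?P) = (\<integral>x. g x * \<xi>0 x \<partial>lborel)"
  proof -
    \<comment> \<open>The limit \<open>\<xi>0\<close> inherits the bound and the support of the
      \<open>\<xi> n\<close>. For almost every \<open>x\<close> some \<open>s\<close> in [0, 1] is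
      available at which the limit exists, since an exceptional null set cannot contain the whole
      interval.\<close>
    have AEb: "AE x in lborel. \<bar>g x * \<xi>0 x\<bar> \<le> \<bar>g x * ?b x\<bar>"
    proof -
      have "AE x in lborel. AE s in lborel. 0 \<le> s \<longrightarrow> s \<le> 1 \<longrightarrow> (\<lambda>n. \<xi> n (x - (tn n * s) *\<^sub>R e)) \<longlonglongrightarrow> \<xi>0 x"
        using lborel_pair.AE_pair[OF lim] by simp
      then show ?thesis
      proof eventually_elim
        case (elim x)
        have "\<exists>s. 0 \<le> s \<and> s \<le> 1 \<and> (\<lambda>n. \<xi> n (x - (tn n * s) *\<^sub>R e)) \<longlonglongrightarrow> \<xi>0 x"
        proof (rule ccontr)
          assume n: "\<not> ?thesis"
          have "AE s::real in lborel. s \<notin> {0..1}" using elim by eventually_elim (use n in auto)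
          then have "emeasure lborel {s. 0 \<le> s \<and> s \<le> (1::real)} = 0"
            by (subst (asm) AE_iff_measurable[OF _ refl]) auto
          moreover have "{s. 0 \<le> s \<and> s \<le> (1::real)} = {0..1}" by auto
          ultimately show False by simp
        qed
        then obtain s where s: "0 \<le> s" "s \<le> 1" "(\<lambda>n. \<xi> n (x - (tn n * s) *\<^sub>R e)) \<longlonglongrightarrow> \<xi>0 x" by blast
        have "\<bar>\<xi> n (x - (tn n * s) *\<^sub>R e)\<bar> \<le> ?b x" for n
        proof (cases "norm x < R + norm e")
          case False
          have "\<bar>tn n * s\<bar> \<le> 1" using s tn_le_1[of n] tn_pos[of n] by (simp add: abs_mult mult_le_one)
          then have "norm ((tn n * s) *\<^sub>R e) \<le> norm e" by (simp add: mult_left_le_one_le)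
          then have "norm (x - (tn n * s) *\<^sub>R e) \<ge> R" using False norm_triangle_ineq2[of x "(tn n * s) *\<^sub>R e"] by simp
          then show ?thesis using R False by simp
        qed (use M in simp)
        then have "\<bar>\<xi>0 x\<bar> \<le> ?b x"
          using tendsto_upperbound[OF tendsto_rabs[OF s(3)]] by (simp add: eventually_sequentially)
        then show ?case using M0 by (auto simp: abs_mult intro!: mult_left_mono)
      qed
    qed
    have "integrable lborel (\<lambda>x. g x * \<xi>0 x)"
      by (rule Bochner_Integration.integrable_bound[OF gi]) (use AEb in auto)
    then have "integrable ?P (\<lambda>(x, s). g x * \<xi>0 x * indicator {0..1} s)"
      by (rule integrable_pair_product) simp
    from lborel_pair.integral_fst[OF this] show ?thesis by simp
  qed
  finally show ?thesis unfolding eq .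
qed

section \<open>Product and chain rule by difference quotients\<close>

lemma affine_bound_local_integrable:
  assumes u: "sqi u" and z[measurable]: "z \<in> borel_measurable borel" and zb: "\<And>x. \<bar>z x\<bar> \<le> C + D * \<bar>u x\<bar>" "C \<ge> 0" "D \<ge> 0"
    and \<xi>[measurable]: "\<xi> \<in> borel_measurable borel" and M: "\<And>x. \<bar>\<xi> x\<bar> \<le> M"
    and R: "\<forall>x. norm x \<ge> R \<longrightarrow> \<xi> x = 0"
  shows "integrable lborel (\<lambda>x. z x * \<xi> x)"
proof -
  note [measurable] = sqi_borel[OF u]
  have M0: "M \<ge> 0" using M[of 0] by (smt (verit))
  have "integrable lborel (\<lambda>x. (C * M) * indicator (ball 0 R) x + D * \<bar>u x * \<xi> x\<bar>)"
    by (intro Bochner_Integration.integrable_add integrable_mult_right integrable_abs sqi_local_integrable[OF u \<xi> M R]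
        integrable_real_indicator emeasure_bounded_finite) auto
  then show ?thesis
  proof (rule Bochner_Integration.integrable_bound)
    have *: "\<bar>z x * \<xi> x\<bar> \<le> (C * M) * indicator (ball 0 R) x + D * \<bar>u x * \<xi> x\<bar>" for x
    proof (cases "norm x < R")
      case True
      have "\<bar>z x\<bar> * \<bar>\<xi> x\<bar> \<le> (C + D * \<bar>u x\<bar>) * \<bar>\<xi> x\<bar>" by (intro mult_right_mono zb) auto
      also have "\<dots> \<le> C * M + D * \<bar>u x * \<xi> x\<bar>"
        using mult_left_mono[OF M[of x] zb(2)] by (simp add: abs_mult algebra_simps)
      finally show ?thesis using True by (simp add: abs_mult)
    qed (use R zb in simp)
    show "AE x in lborel. norm (z x * \<xi> x) \<le> norm ((C * M) * indicator (ball 0 R) x + D * \<bar>u x * \<xi> x\<bar>)"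
      by (intro AE_I2) (use * in \<open>force simp only: real_norm_def intro: order_trans[OF _ abs_ge_self]\<close>)
  qed measurable
qed

lemma tn_difference_quotient:
  assumes "((\<lambda>s. h s) has_real_derivative D) (at 0)" "c \<noteq> 0"
  shows "(\<lambda>n. (h (c * tn n) - h 0) / tn n) \<longlonglongrightarrow> c * D"
proof -
  have "filterlim (\<lambda>n. c * tn n) (at 0) sequentially"
  proof -
    have "(\<lambda>n. c * tn n) \<longlonglongrightarrow> c * 0" by (intro tendsto_intros tn_lim)
    then show ?thesis using tn_pos assms(2) by (intro filterlim_atI) (auto simp: less_imp_neq[symmetric])
  qed
  then have "(\<lambda>n. (h (c * tn n) - h 0) / (c * tn n - 0)) \<longlonglongrightarrow> D"
    using assms(1) unfolding has_field_derivative_iff by (rule filterlim_compose[rotated])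
  then have "(\<lambda>n. c * ((h (c * tn n) - h 0) / (c * tn n - 0))) \<longlonglongrightarrow> c * D" by (intro tendsto_intros)
  moreover have "c * ((h (c * tn n) - h 0) / (c * tn n - 0)) = (h (c * tn n) - h 0) / tn n" for n
    using assms(2) tn_pos[of n] by (simp add: field_simps)
  ultimately show ?thesis by simp
qed

text \<open>Discrete integration by parts: translation invariance moves the quotient onto
  \<open>\<psi>\<close> with step \<open>- tn n\<close>. An affine bound by
  \<open>\<bar>u\<bar>\<close> is assumed instead of square integrability because
  \<open>T (u)\<close> need not decay when \<open>T 0\<close> is not 0.\<close>

lemma difference_quotient_test:
  assumes u: "sqi u" and z[measurable]: "z \<in> borel_measurable borel" and zb: "\<And>x. \<bar>z x\<bar> \<le> C + D * \<bar>u x\<bar>" "C \<ge> 0" "D \<ge> 0"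
    and \<psi>: "test_fun UNIV \<psi>"
  shows "(\<lambda>n. \<integral>x. (z (x + tn n *\<^sub>R e) - z x) / tn n * \<psi> x \<partial>lborel) \<longlonglongrightarrow> - (\<integral>x. z x * frechet_derivative \<psi> (at x) e \<partial>lborel)"
proof -
  let ?D = "\<lambda>x. frechet_derivative \<psi> (at x) e"
  note [measurable] = sqi_borel[OF u] test_fun_borel[OF \<psi>] test_fun_deriv_borel[OF \<psi>]
  obtain R L where RL: "\<forall>x. norm x \<ge> R \<longrightarrow> \<psi> x = 0" "\<forall>x. norm x \<ge> R \<longrightarrow> ?D x = 0"
    "\<And>x. \<bar>\<psi> x\<bar> \<le> L" "\<And>x. \<bar>?D x\<bar> \<le> L" "L > 0" "R > 0"
    using test_fun_bounds[OF \<psi>, of e] by metis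
  let ?q = "\<lambda>n x. (\<psi> (x - tn n *\<^sub>R e) - \<psi> x) / tn n"
  have shift: "norm (x - tn n *\<^sub>R e) \<ge> R" if "norm x \<ge> R + norm e" for x n
  proof -
    have "norm (tn n *\<^sub>R e) \<le> norm e" using tn_pos[of n] tn_le_1[of n] by (simp add: mult_left_le_one_le)
    then show ?thesis using that norm_triangle_ineq2[of x "tn n *\<^sub>R e"] by simp
  qed
  have q0: "?q n x = 0" if "norm x \<ge> R + norm e" for n x
    using shift[OF that] that RL(1) by (smt (verit) norm_ge_zero divide_eq_0_iff)
  have q1: "\<bar>?q n x\<bar> \<le> L" for n x
  proof -
    have "\<bar>\<psi> (x + (- tn n) *\<^sub>R e) - \<psi> x\<bar> \<le> L * \<bar>- tn n\<bar>"
      by (rule test_fun_lipschitz[OF \<psi> RL(4)])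
    then show ?thesis using tn_pos[of n] by (simp add: divide_le_eq)
  qed
  have eq: "(\<integral>x. (z (x + tn n *\<^sub>R e) - z x) / tn n * \<psi> x \<partial>lborel) = (\<integral>x. z x * ?q n x \<partial>lborel)" for n
  proof -
    have i0: "integrable lborel (\<lambda>x. z x * \<psi> x)"
      by (rule affine_bound_local_integrable[OF u z zb _ RL(3) RL(1)]) measurable
    have i1: "integrable lborel (\<lambda>x. z x * \<psi> (x - tn n *\<^sub>R e))"
      by (rule affine_bound_local_integrable[OF u z zb, where M = L and R = "R + norm e"])
         (use RL(1,3) shift in auto)
    have i1': "integrable lborel (\<lambda>x. z (x + tn n *\<^sub>R e) * \<psi> x)"
      using lborel_translate(1)[of "\<lambda>x. z x * \<psi> (x - tn n *\<^sub>R e)" "tn n *\<^sub>R e"] i1 by simp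
    have e1: "(\<integral>x. z (x + tn n *\<^sub>R e) * \<psi> x \<partial>lborel) = (\<integral>x. z x * \<psi> (x - tn n *\<^sub>R e) \<partial>lborel)"
      using lborel_translate(2)[of "\<lambda>x. z x * \<psi> (x - tn n *\<^sub>R e)" "tn n *\<^sub>R e"] by simp
    have "(\<integral>x. (z (x + tn n *\<^sub>R e) - z x) / tn n * \<psi> x \<partial>lborel) =
       (\<integral>x. (1 / tn n) * (z (x + tn n *\<^sub>R e) * \<psi> x - z x * \<psi> x) \<partial>lborel)"
      by (simp add: algebra_simps diff_divide_distrib)
    also have "\<dots> = (1 / tn n) * ((\<integral>x. z x * \<psi> (x - tn n *\<^sub>R e) \<partial>lborel) - (\<integral>x. z x * \<psi> x \<partial>lborel))"
      using i0 i1' e1 by (subst Bochner_Integration.integral_mult_right_zero) simp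
    also have "\<dots> = (\<integral>x. (1 / tn n) * (z x * \<psi> (x - tn n *\<^sub>R e) - z x * \<psi> x) \<partial>lborel)"
      using i0 i1 by (subst Bochner_Integration.integral_mult_right_zero) simp
    also have "\<dots> = (\<integral>x. z x * ?q n x \<partial>lborel)"
      by (simp add: algebra_simps diff_divide_distrib)
    finally show ?thesis .
  qed
  let ?b = "\<lambda>x::R2. L * indicator (ball 0 (R + norm e)) x :: real"
  have "(\<lambda>n. \<integral>x. z x * ?q n x \<partial>lborel) \<longlonglongrightarrow> (\<integral>x. z x * (- ?D x) \<partial>lborel)"
  proof (rule integral_dominated_convergence[where w = "\<lambda>x. \<bar>z x * ?b x\<bar>"])
    show "integrable lborel (\<lambda>x. \<bar>z x * ?b x\<bar>)"
      by (intro integrable_abs affine_bound_local_integrable[OF u z zb, where M = L and R = "R + norm e"])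
         (measurable, use RL in \<open>auto split: split_indicator\<close>)
    have "(\<lambda>n. ?q n x) \<longlonglongrightarrow> - ?D x" for x
      using tn_difference_quotient[OF test_fun_line_derivative[OF \<psi>, of x e 0 UNIV], of "-1"] by simp
    then show "AE x in lborel. (\<lambda>n. z x * ?q n x) \<longlonglongrightarrow> z x * (- ?D x)"
      by (intro AE_I2 tendsto_intros)
    have "\<bar>?q n x\<bar> \<le> ?b x" for n x
      using q0[of x n] q1[of x n] by (cases "norm x < R + norm e") auto
    then have "\<bar>z x\<bar> * \<bar>?q n x\<bar> \<le> \<bar>z x\<bar> * \<bar>?b x\<bar>" for n x
      by (intro mult_left_mono) (auto intro: order_trans[OF _ abs_ge_self])
    then show "AE x in lborel. norm (z x * ?q n x) \<le> \<bar>z x * ?b x\<bar>" for n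
      unfolding real_norm_def abs_mult[of "z _"] by (intro AE_I2)
  qed measurable
  then show ?thesis unfolding eq by simp
qed

text \<open>With the value \<open>T' a\<close> on the diagonal,
  \<open>T b - T a = slope T T' a b * (b - a)\<close> holds without exception, and the slope is
  continuous up to the diagonal for continuously differentiable \<open>T\<close>.\<close>

definition slope :: "(real \<Rightarrow> real) \<Rightarrow> (real \<Rightarrow> real) \<Rightarrow> real \<Rightarrow> real \<Rightarrow> real" where
  "slope T T' a b = (if a = b then T' a else (T b - T a) / (b - a))"

text \<open>The intermediate point lies between \<open>a\<close> and \<open>b\<close>; its position
  is recorded by the distance to an arbitrary \<open>d\<close>, the form in which it passes to the
  limit in \<open>slope_tendsto\<close>.\<close>

lemma slope_mean_value:
  assumes I: "is_interval I" and T: "\<And>s. s \<in> I \<Longrightarrow> (T has_real_derivative T' s) (at s within I)"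
    and ab: "a \<in> I" "b \<in> I"
  obtains c where "c \<in> I" "\<bar>c - d\<bar> \<le> max \<bar>a - d\<bar> \<bar>b - d\<bar>" "slope T T' a b = T' c"
proof -
  have *: "\<exists>c\<in>{a..b}. T b - T a = T' c * (b - a)" if "a < b" "a \<in> I" "b \<in> I" for a b
  proof -
    have sub: "{a..b} \<subseteq> I" using mem_is_interval_1_I[OF I that(2,3)] by auto
    have "\<exists>x\<in>{a<..<b}. T b - T a = T' x * (b - a)"
    proof (rule mvt_simple[OF that(1)])
      fix x assume "a \<le> x" "x \<le> b"
      then have "x \<in> I" using sub by auto
      then have "(T has_real_derivative T' x) (at x within {a..b})"
        by (rule DERIV_subset[OF T sub])
      then show "(T has_derivative (*) (T' x)) (at x within {a..b})"
        by (simp add: has_field_derivative_def)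
    qed
    then show ?thesis by force
  qed
  consider "a = b" | "a < b" | "b < a" by linarith
  then show ?thesis
  proof cases
    case 1 then show ?thesis using that[of a] ab by (auto simp: slope_def)
  next
    case 2
    then obtain c where c: "c \<in> {a..b}" "T b - T a = T' c * (b - a)" using * ab by blast
    then have "c \<in> I" using mem_is_interval_1_I[OF I ab] by auto
    then show ?thesis using that[of c] c 2 by (auto simp: slope_def)
  next
    case 3
    then obtain c where c: "c \<in> {b..a}" "T a - T b = T' c * (a - b)" using * ab by blast
    then have "c \<in> I" using mem_is_interval_1_I[OF I ab(2,1)] by auto
    moreover have "(T b - T a) / (b - a) = T' c" using c(2) 3 by (simp add: field_simps)
    ultimately show ?thesis using that[of c] c 3 by (auto simp: slope_def)
  qed
qed

lemma slope_tendsto: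
  assumes I: "is_interval I" and T: "\<And>s. s \<in> I \<Longrightarrow> (T has_real_derivative T' s) (at s within I)"
    and T': "continuous_on I T'"
    and ab: "\<And>n. a n \<in> I" "\<And>n. b n \<in> I" "d \<in> I" and lim: "a \<longlonglongrightarrow> d" "b \<longlonglongrightarrow> d"
  shows "(\<lambda>n. slope T T' (a n) (b n)) \<longlonglongrightarrow> T' d"
proof -
  have "\<exists>c. c \<in> I \<and> \<bar>c - d\<bar> \<le> max \<bar>a n - d\<bar> \<bar>b n - d\<bar> \<and> slope T T' (a n) (b n) = T' c" for n
    using slope_mean_value[OF I T ab(1)[of n] ab(2)[of n], of d] by metis
  then obtain c where c: "\<And>n. c n \<in> I" "\<And>n. \<bar>c n - d\<bar> \<le> max \<bar>a n - d\<bar> \<bar>b n - d\<bar>"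
    "\<And>n. slope T T' (a n) (b n) = T' (c n)" by metis
  have "(\<lambda>n. max \<bar>a n - d\<bar> \<bar>b n - d\<bar>) \<longlonglongrightarrow> max \<bar>d - d\<bar> \<bar>d - d\<bar>"
    by (intro tendsto_intros lim)
  then have "(\<lambda>n. max \<bar>a n - d\<bar> \<bar>b n - d\<bar>) \<longlonglongrightarrow> 0" by simp
  then have "(\<lambda>n. c n - d) \<longlonglongrightarrow> 0"
    by (rule Lim_null_comparison[rotated]) (use c(2) in auto)
  then have "c \<longlonglongrightarrow> d" by (simp add: LIM_zero_iff)
  then have "(\<lambda>n. T' (c n)) \<longlonglongrightarrow> T' d"
    using T' ab(3) c(1) by (intro continuous_on_tendsto_compose[OF T']) auto
  then show ?thesis by (simp add: c(3))
qed

text \<open>The difference quotient of the product splits exactly into a term with the quotient of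
  \<open>u\<close> and a term with that of \<open>\<phi>\<close>. Both converge when tested with
  \<open>\<psi>\<close>, and \<open>difference_quotient_test\<close> identifies the limit of the
  whole. The interval \<open>I\<close> admits functions such as \<open>Sf d\<close>, which are
  regular only on the half-line where \<open>u\<close> takes its values.\<close>

lemma wdir_product_chain:
  fixes T T' :: "real \<Rightarrow> real" and \<phi> \<phi>' :: "R2 \<Rightarrow> real"
  assumes u: "sqi u" and g: "sqi g" and w: "wdir e u g"
    and I: "is_interval I" and uI: "\<And>x. u x \<in> I"
    and T: "\<And>s. s \<in> I \<Longrightarrow> (T has_real_derivative T' s) (at s within I)" and T': "continuous_on I T'"
    and L: "\<And>s. s \<in> I \<Longrightarrow> \<bar>T' s\<bar> \<le> L"
    and [measurable]: "T \<in> borel_measurable borel" "T' \<in> borel_measurable borel" "\<phi>' \<in> borel_measurable borel"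
    and \<phi>: "continuous_on UNIV \<phi>" and M: "\<And>x. \<bar>\<phi> x\<bar> \<le> M" and N: "\<And>x t. \<bar>\<phi> (x + t *\<^sub>R e) - \<phi> x\<bar> \<le> N * \<bar>t\<bar>"
    and N': "\<And>x. \<bar>\<phi>' x\<bar> \<le> N"
    and \<phi>': "AE x in lborel. (\<lambda>n. (\<phi> (x + tn n *\<^sub>R e) - \<phi> x) / tn n) \<longlonglongrightarrow> \<phi>' x"
  shows "wdir e (\<lambda>x. \<phi> x * T (u x)) (\<lambda>x. \<phi> x * T' (u x) * g x + T (u x) * \<phi>' x)"
  unfolding wdir_def
proof (intro allI impI)
  fix \<psi> assume \<psi>: "test_fun UNIV \<psi>"
  note [measurable] = sqi_borel[OF u] sqi_borel[OF g] test_fun_borel[OF \<psi>] borel_measurable_continuous_onI[OF \<phi>]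
  have \<psi>c: "continuous_on UNIV \<psi>" using \<psi> by (intro smooth2_continuous test_fun_smooth2)
  obtain R K where RK: "\<forall>x. norm x \<ge> R \<longrightarrow> \<psi> x = 0" "\<And>x. \<bar>\<psi> x\<bar> \<le> K" "K > 0" "R > 0"
    using test_fun_bounds[OF \<psi>, of e] by metis
  define a0 where "a0 = u 0"
  have a0: "a0 \<in> I" using uI by (simp add: a0_def)
  have L0: "L \<ge> 0" using L[OF a0] by linarith
  have M0: "M \<ge> 0" using M[of 0] by linarith
  have sl: "\<bar>slope T T' a b\<bar> \<le> L" if ab: "a \<in> I" "b \<in> I" for a b
    using slope_mean_value[OF I T ab, of 0] L by metis
  have slT: "T b - T a = slope T T' a b * (b - a)" for a b by (simp add: slope_def)
  define C where "C = \<bar>T a0\<bar> + L * \<bar>a0\<bar>"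
  have C0: "C \<ge> 0" using L0 by (simp add: C_def)
  have Tb: "\<bar>T (u x)\<bar> \<le> C + L * \<bar>u x\<bar>" for x
  proof -
    have "\<bar>T (u x) - T a0\<bar> \<le> L * \<bar>u x - a0\<bar>"
      unfolding slT[of "u x" a0] abs_mult by (intro mult_right_mono sl a0 uI) auto
    also have "\<dots> \<le> L * (\<bar>u x\<bar> + \<bar>a0\<bar>)" using L0 by (intro mult_left_mono) auto
    finally show ?thesis by (simp add: C_def algebra_simps)
  qed
  let ?z = "\<lambda>x. \<phi> x * T (u x)"
  have zb: "\<bar>?z x\<bar> \<le> M * C + (M * L) * \<bar>u x\<bar>" for x
  proof -
    have "\<bar>\<phi> x\<bar> * \<bar>T (u x)\<bar> \<le> M * (C + L * \<bar>u x\<bar>)" by (intro mult_mono M Tb M0) auto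
    then show ?thesis by (simp add: abs_mult algebra_simps)
  qed
  have lim1: "(\<lambda>n. \<integral>x. (?z (x + tn n *\<^sub>R e) - ?z x) / tn n * \<psi> x \<partial>lborel) \<longlonglongrightarrow> - (\<integral>x. ?z x * frechet_derivative \<psi> (at x) e \<partial>lborel)"
    by (rule difference_quotient_test[OF u _ zb _ _ \<psi>]) (use M0 C0 L0 in auto)
  define \<xi> where "\<xi> n x = \<phi> (x + tn n *\<^sub>R e) * slope T T' (u x) (u (x + tn n *\<^sub>R e)) * \<psi> x" for n x
  have [measurable]: "\<xi> n \<in> borel_measurable borel" for n
    unfolding \<xi>_def slope_def by measurable
  have \<xi>M: "\<bar>\<xi> n x\<bar> \<le> M * L * K" for n x
    unfolding \<xi>_def abs_mult by (intro mult_mono M sl uI RK) (use M0 L0 in auto)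
  have \<xi>R: "\<forall>x. norm x \<ge> R \<longrightarrow> \<xi> n x = 0" for n using RK by (auto simp: \<xi>_def)
  have lim2: "(\<lambda>n. \<integral>x. (u (x + tn n *\<^sub>R e) - u x) / tn n * \<xi> n x \<partial>lborel) \<longlonglongrightarrow> (\<integral>x. g x * (\<phi> x * T' (u x) * \<psi> x) \<partial>lborel)"
  proof (rule difference_quotient_limit[OF u g w _ _ \<xi>M \<xi>R])
    \<comment> \<open>After the shear, \<open>\<xi> n\<close> at
      \<open>x - (tn n * s) *\<^sub>R e\<close> involves \<open>u\<close> at both ends of a segment
      through \<open>x\<close>; these two facts let both arguments of \<open>slope\<close> tend to
      \<open>u x\<close>.\<close>
    have c1: "AE z in lborel \<Otimes>\<^sub>M lborel. case z of (x, s) \<Rightarrow> 0 \<le> s \<longrightarrow> s \<le> 1 \<longrightarrow> (\<lambda>n. u (x + (tn n * (- s)) *\<^sub>R e)) \<longlonglongrightarrow> u x"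
      by (rule translation_continuous_AE[OF u g w]) auto
    have c2: "AE z in lborel \<Otimes>\<^sub>M lborel. case z of (x, s) \<Rightarrow> 0 \<le> s \<longrightarrow> s \<le> 1 \<longrightarrow> (\<lambda>n. u (x + (tn n * (1 - s)) *\<^sub>R e)) \<longlonglongrightarrow> u x"
      by (rule translation_continuous_AE[OF u g w]) auto
    show "AE z in lborel \<Otimes>\<^sub>M lborel. case z of (x, s) \<Rightarrow> 0 \<le> s \<longrightarrow> s \<le> 1 \<longrightarrow> (\<lambda>n. \<xi> n (x - (tn n * s) *\<^sub>R e)) \<longlonglongrightarrow> \<phi> x * T' (u x) * \<psi> x"
      using c1 c2
    proof eventually_elim
      case (elim z)
      obtain x s where z: "z = (x, s)" by (cases z)
      show ?case unfolding z prod.case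
      proof (intro impI)
        assume s: "0 \<le> s" "s \<le> 1"
        have e1: "x - (tn n * s) *\<^sub>R e + tn n *\<^sub>R e = x + (tn n * (1 - s)) *\<^sub>R e" for n
          by (simp add: algebra_simps)
        have l1: "(\<lambda>n. u (x - (tn n * s) *\<^sub>R e)) \<longlonglongrightarrow> u x" and l2: "(\<lambda>n. u (x + (tn n * (1 - s)) *\<^sub>R e)) \<longlonglongrightarrow> u x"
          using elim s by (auto simp: z)
        have p1: "(\<lambda>n. x + (tn n * (1 - s)) *\<^sub>R e) \<longlonglongrightarrow> x + (0 * (1 - s)) *\<^sub>R e"
          by (intro tendsto_intros tn_lim)
        have p2: "(\<lambda>n. x - (tn n * s) *\<^sub>R e) \<longlonglongrightarrow> x - (0 * s) *\<^sub>R e"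
          by (intro tendsto_intros tn_lim)
        have "(\<lambda>n. \<phi> (x + (tn n * (1 - s)) *\<^sub>R e)) \<longlonglongrightarrow> \<phi> x"
          by (rule continuous_on_tendsto_compose[OF \<phi>]) (use p1 in auto)
        moreover have "(\<lambda>n. \<psi> (x - (tn n * s) *\<^sub>R e)) \<longlonglongrightarrow> \<psi> x"
          by (rule continuous_on_tendsto_compose[OF \<psi>c]) (use p2 in auto)
        ultimately show "(\<lambda>n. \<xi> n (x - (tn n * s) *\<^sub>R e)) \<longlonglongrightarrow> \<phi> x * T' (u x) * \<psi> x"
          unfolding \<xi>_def e1 by (intro tendsto_mult slope_tendsto[OF I T T'] uI l1 l2)
      qed
    qed
  qed measurable
  let ?q = "\<lambda>n x. (\<phi> (x + tn n *\<^sub>R e) - \<phi> x) / tn n"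
  have qN: "\<bar>?q n x\<bar> \<le> N" for n x
    using N[of x "tn n"] tn_pos[of n] by (simp add: divide_le_eq)
  have N0: "N \<ge> 0" using N'[of 0] by linarith
  have Ti: "integrable lborel (\<lambda>x. T (u x) * \<zeta> x)" if "\<zeta> \<in> borel_measurable borel" "\<And>x. \<bar>\<zeta> x\<bar> \<le> N * \<bar>\<psi> x\<bar>" for \<zeta>
  proof (rule affine_bound_local_integrable[OF u _ Tb C0 L0 that(1), where M = "N * K" and R = R])
    show "\<bar>\<zeta> x\<bar> \<le> N * K" for x using that(2)[of x] mult_left_mono[OF RK(2)[of x] N0] by linarith
    show "\<forall>x. R \<le> norm x \<longrightarrow> \<zeta> x = 0" using that(2) RK(1) by (metis abs_le_zero_iff abs_zero mult_zero_right)
  qed measurable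
  have qb: "\<bar>?q n x * \<psi> x\<bar> \<le> N * \<bar>\<psi> x\<bar>" for n x
    unfolding abs_mult by (intro mult_right_mono qN) auto
  have \<phi>'b: "\<bar>\<phi>' x * \<psi> x\<bar> \<le> N * \<bar>\<psi> x\<bar>" for x
    unfolding abs_mult by (intro mult_right_mono N') auto
  have lim3: "(\<lambda>n. \<integral>x. T (u x) * (?q n x * \<psi> x) \<partial>lborel) \<longlonglongrightarrow> (\<integral>x. T (u x) * (\<phi>' x * \<psi> x) \<partial>lborel)"
  proof (rule integral_dominated_convergence[where w = "\<lambda>x. \<bar>T (u x) * (N * \<psi> x)\<bar>"])
    show "integrable lborel (\<lambda>x. \<bar>T (u x) * (N * \<psi> x)\<bar>)"
      by (intro integrable_abs Ti) (auto simp: abs_mult N0)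
    show "AE x in lborel. (\<lambda>n. T (u x) * (?q n x * \<psi> x)) \<longlonglongrightarrow> T (u x) * (\<phi>' x * \<psi> x)"
      using \<phi>' by eventually_elim (intro tendsto_intros)
    show "AE x in lborel. norm (T (u x) * (?q n x * \<psi> x)) \<le> \<bar>T (u x) * (N * \<psi> x)\<bar>" for n
      using mult_left_mono[OF qb abs_ge_zero] N0 by (auto simp: abs_mult)
  qed measurable
  have split: "(\<integral>x. (?z (x + tn n *\<^sub>R e) - ?z x) / tn n * \<psi> x \<partial>lborel) =
     (\<integral>x. (u (x + tn n *\<^sub>R e) - u x) / tn n * \<xi> n x \<partial>lborel) + (\<integral>x. T (u x) * (?q n x * \<psi> x) \<partial>lborel)" for n
  proof -
    have i0: "integrable lborel (\<lambda>x. u x * \<xi> n x)" by (rule sqi_local_integrable[OF u _ \<xi>M \<xi>R]) measurable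
    have i1: "integrable lborel (\<lambda>x. u x * \<xi> n (x - tn n *\<^sub>R e))"
    proof (rule sqi_local_integrable[OF u _ \<xi>M])
      have "norm (tn n *\<^sub>R e) \<le> norm e" using tn_pos[of n] tn_le_1[of n] by (simp add: mult_left_le_one_le)
      then show "\<forall>x. R + norm e \<le> norm x \<longrightarrow> \<xi> n (x - tn n *\<^sub>R e) = 0"
        using \<xi>R[of n] by (smt (verit) norm_triangle_ineq2)
    qed measurable
    have i1': "integrable lborel (\<lambda>x. u (x + tn n *\<^sub>R e) * \<xi> n x)"
      using lborel_translate(1)[of "\<lambda>x. u x * \<xi> n (x - tn n *\<^sub>R e)" "tn n *\<^sub>R e"] i1 by simp
    have "integrable lborel (\<lambda>x. (1 / tn n) * (u (x + tn n *\<^sub>R e) * \<xi> n x - u x * \<xi> n x))"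
      by (intro integrable_mult_right Bochner_Integration.integrable_diff i0 i1')
    then have i2: "integrable lborel (\<lambda>x. (u (x + tn n *\<^sub>R e) - u x) / tn n * \<xi> n x)"
      by (simp add: algebra_simps diff_divide_distrib)
    have i3: "integrable lborel (\<lambda>x. T (u x) * (?q n x * \<psi> x))" by (rule Ti[OF _ qb]) measurable
    have "(?z (x + tn n *\<^sub>R e) - ?z x) / tn n * \<psi> x = (u (x + tn n *\<^sub>R e) - u x) / tn n * \<xi> n x + T (u x) * (?q n x * \<psi> x)" for x
    proof -
      have "?z (x + tn n *\<^sub>R e) - ?z x = \<phi> (x + tn n *\<^sub>R e) * (T (u (x + tn n *\<^sub>R e)) - T (u x)) + T (u x) * (\<phi> (x + tn n *\<^sub>R e) - \<phi> x)"
        by (simp add: algebra_simps)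
      also have "\<dots> = \<phi> (x + tn n *\<^sub>R e) * slope T T' (u x) (u (x + tn n *\<^sub>R e)) * (u (x + tn n *\<^sub>R e) - u x) + T (u x) * (\<phi> (x + tn n *\<^sub>R e) - \<phi> x)"
        by (simp only: slT mult.assoc)
      finally show ?thesis unfolding \<xi>_def by (simp add: add_divide_distrib distrib_left distrib_right mult_ac)
    qed
    then show ?thesis using i2 i3 by simp
  qed
  have "- (\<integral>x. ?z x * frechet_derivative \<psi> (at x) e \<partial>lborel) = (\<integral>x. g x * (\<phi> x * T' (u x) * \<psi> x) \<partial>lborel) + (\<integral>x. T (u x) * (\<phi>' x * \<psi> x) \<partial>lborel)"
    by (rule LIMSEQ_unique[OF lim1]) (use tendsto_add[OF lim2 lim3] split in simp)
  also have "\<dots> = (\<integral>x. g x * (\<phi> x * T' (u x) * \<psi> x) + T (u x) * (\<phi>' x * \<psi> x) \<partial>lborel)"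
  proof (rule Bochner_Integration.integral_add[symmetric])
    have "\<bar>\<phi> x\<bar> * \<bar>T' (u x)\<bar> * \<bar>\<psi> x\<bar> \<le> M * L * K" for x
      by (intro mult_mono M L uI RK) (use M0 L0 in auto)
    then show "integrable lborel (\<lambda>x. g x * (\<phi> x * T' (u x) * \<psi> x))"
      using RK by (intro sqi_local_integrable[OF g, where M = "M * L * K" and R = R]) (auto simp: abs_mult)
    show "integrable lborel (\<lambda>x. T (u x) * (\<phi>' x * \<psi> x))" by (rule Ti[OF _ \<phi>'b]) measurable
  qed
  also have "\<dots> = (\<integral>x. (\<phi> x * T' (u x) * g x + T (u x) * \<phi>' x) * \<psi> x \<partial>lborel)"
    by (simp add: algebra_simps)
  finally show "(\<integral>x. ?z x * frechet_derivative \<psi> (at x) e \<partial>lborel) = - (\<integral>x. (\<phi> x * T' (u x) * g x + T (u x) * \<phi>' x) * \<psi> x \<partial>lborel)"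
    by simp
qed

subsection \<open>Functions with square integrable weak gradient\<close>

lemma two_abs_mult_le: "2 * \<bar>a * b\<bar> \<le> a\<^sup>2 + (b::real)\<^sup>2"
  using zero_le_power2[of "\<bar>a\<bar> - \<bar>b\<bar>"] by (simp add: power2_diff abs_mult)

lemma L2_mult:
  fixes u v :: "'a \<Rightarrow> real"
  assumes [measurable]: "u \<in> borel_measurable M" "v \<in> borel_measurable M"
    and "integrable M (\<lambda>x. (u x)\<^sup>2)" "integrable M (\<lambda>x. (v x)\<^sup>2)"
  shows "integrable M (\<lambda>x. u x * v x)"
proof (rule Bochner_Integration.integrable_bound[OF Bochner_Integration.integrable_add[OF assms(3,4)]])
  show "AE x in M. norm (u x * v x) \<le> norm ((u x)\<^sup>2 + (v x)\<^sup>2)"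
    using two_abs_mult_le by (intro AE_I2) (smt (verit) abs_ge_zero real_norm_def)
qed measurable

lemma L2_bound:
  fixes u :: "'a \<Rightarrow> real" and v :: "'a \<Rightarrow> 'b::{banach, second_countable_topology}"
  assumes "integrable M (\<lambda>x. (u x)\<^sup>2)" and [measurable]: "v \<in> borel_measurable M"
    and "\<And>x. norm (v x) \<le> c * \<bar>u x\<bar>"
  shows "integrable M (\<lambda>x. (norm (v x))\<^sup>2)"
proof (rule Bochner_Integration.integrable_bound[OF integrable_mult_right[OF assms(1), of "c\<^sup>2"]])
  have "(norm (v x))\<^sup>2 \<le> (c * \<bar>u x\<bar>)\<^sup>2" for x by (intro power_mono assms) auto
  then show "AE x in M. norm ((norm (v x))\<^sup>2) \<le> norm (c\<^sup>2 * (u x)\<^sup>2)"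
    by (intro AE_I2) (simp add: power_mult_distrib)
qed measurable

lemma norm_add_square_le: "(norm (a + b))\<^sup>2 \<le> 2 * (norm a)\<^sup>2 + 2 * (norm (b :: 'a :: real_normed_vector))\<^sup>2"
proof -
  have "(norm (a + b))\<^sup>2 \<le> (norm a + norm b)\<^sup>2" by (intro power_mono norm_triangle_ineq) auto
  also have "\<dots> \<le> 2 * (norm a)\<^sup>2 + 2 * (norm b)\<^sup>2"
    using two_abs_mult_le[of "norm a" "norm b"] by (simp add: power2_sum)
  finally show ?thesis .
qed

lemma L2_add:
  fixes u v :: "'a \<Rightarrow> 'b::{banach, second_countable_topology}"
  assumes [measurable]: "u \<in> borel_measurable M" "v \<in> borel_measurable M"
    and "integrable M (\<lambda>x. (norm (u x))\<^sup>2)" "integrable M (\<lambda>x. (norm (v x))\<^sup>2)"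
  shows "integrable M (\<lambda>x. (norm (u x + v x))\<^sup>2)"
proof (rule Bochner_Integration.integrable_bound)
  show "integrable M (\<lambda>x. 2 * (norm (u x))\<^sup>2 + 2 * (norm (v x))\<^sup>2)" using assms by simp
  show "AE x in M. norm ((norm (u x + v x))\<^sup>2) \<le> norm (2 * (norm (u x))\<^sup>2 + 2 * (norm (v x))\<^sup>2)"
    using norm_add_square_le by (intro AE_I2) (simp add: abs_of_nonneg)
qed measurable

lemma L2_inner:
  fixes g h :: "'a \<Rightarrow> R2"
  assumes [measurable]: "g \<in> borel_measurable M" "h \<in> borel_measurable M"
    and "integrable M (\<lambda>x. (norm (g x))\<^sup>2)" "integrable M (\<lambda>x. (norm (h x))\<^sup>2)"
  shows "integrable M (\<lambda>x. g x \<bullet> h x)"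
proof (rule Bochner_Integration.integrable_bound)
  show "integrable M (\<lambda>x. norm (g x) * norm (h x))" using assms by (intro L2_mult) auto
  show "AE x in M. norm (g x \<bullet> h x) \<le> norm (norm (g x) * norm (h x))"
    using Cauchy_Schwarz_ineq2 by (intro AE_I2) simp
qed measurable

text \<open>The gradient is carried as an explicit argument because the chosen
  \<open>wgrad u\<close> is shown to agree with it only when \<open>u\<close> is not zero almost
  everywhere.\<close>

definition isgrad :: "(R2 \<Rightarrow> real) \<Rightarrow> (R2 \<Rightarrow> R2) \<Rightarrow> bool" where
  "isgrad u g \<longleftrightarrow> u \<in> borel_measurable lebesgue \<and> integrable lebesgue (\<lambda>x. (u x)\<^sup>2) \<and>
     g \<in> borel_measurable lebesgue \<and> integrable lebesgue (\<lambda>x. (norm (g x))\<^sup>2) \<and> has_weak_grad u g"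

lemma isgradD:
  assumes "isgrad u g"
  shows "u \<in> borel_measurable lebesgue" "integrable lebesgue (\<lambda>x. (u x)\<^sup>2)"
    "g \<in> borel_measurable lebesgue" "integrable lebesgue (\<lambda>x. (norm (g x))\<^sup>2)" "has_weak_grad u g"
  using assms by (auto simp: isgrad_def)

lemma H1_iff: "u \<in> H1 \<longleftrightarrow> (\<exists>g. isgrad u g)"
  by (auto simp: H1_def isgrad_def)

lemma vec_nth_borel[measurable (raw)]:
  fixes g :: "'a \<Rightarrow> R2" shows "g \<in> borel_measurable M \<Longrightarrow> (\<lambda>x. g x $ i) \<in> borel_measurable M"
  by (rule measurable_compose[OF _ borel_measurable_continuous_onI]) (auto intro!: continuous_intros)

lemma vec_borelI:
  fixes g :: "'a \<Rightarrow> R2" assumes "\<And>i. (\<lambda>x. g x $ i) \<in> borel_measurable M"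
  shows "g \<in> borel_measurable M"
proof -
  have "(\<lambda>x. \<Sum>i\<in>UNIV. (g x $ i) *\<^sub>R (axis i 1 :: R2)) \<in> borel_measurable M"
    by (intro borel_measurable_sum borel_measurable_scaleR assms) auto
  moreover have "(\<lambda>x. \<Sum>i\<in>UNIV. (g x $ i) *\<^sub>R (axis i 1 :: R2)) = g"
    using basis_expansion[where 'a = real and 'n = 2] unfolding scalar_mult_eq_scaleR by (simp add: fun_eq_iff)
  ultimately show ?thesis by simp
qed

lemma L2_component:
  fixes g :: "'a \<Rightarrow> R2"
  assumes [measurable]: "g \<in> borel_measurable M" and "integrable M (\<lambda>x. (norm (g x))\<^sup>2)"
  shows "integrable M (\<lambda>x. (g x $ i)\<^sup>2)"
  using L2_bound[of M "\<lambda>x. norm (g x)" "\<lambda>x. g x $ i" 1] assms component_le_norm_cart[of "g _" i] by simp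

lemma test_fun_L2:
  assumes \<phi>: "test_fun UNIV \<phi>"
  shows "\<phi> \<in> borel_measurable lebesgue" "integrable lebesgue (\<lambda>x. (\<phi> x)\<^sup>2)"
    "(\<lambda>x. cgrad \<phi> x $ i) \<in> borel_measurable lebesgue" "integrable lebesgue (\<lambda>x. (cgrad \<phi> x $ i)\<^sup>2)"
proof -
  obtain R L where RL: "\<And>x. norm x \<ge> R \<Longrightarrow> \<phi> x = 0" "\<And>x. norm x \<ge> R \<Longrightarrow> frechet_derivative \<phi> (at x) (axis i 1) = 0"
    "\<And>x. \<bar>\<phi> x\<bar> \<le> L" "\<And>x. \<bar>frechet_derivative \<phi> (at x) (axis i 1)\<bar> \<le> L" "L > 0" "R > 0"
    using test_fun_bounds[OF \<phi>, of "axis i 1"] by metis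
  have c: "(\<lambda>x. cgrad \<phi> x $ i) = (\<lambda>x. frechet_derivative \<phi> (at x) (axis i 1))" by (simp add: cgrad_def)
  show m: "\<phi> \<in> borel_measurable lebesgue" "(\<lambda>x. cgrad \<phi> x $ i) \<in> borel_measurable lebesgue"
    unfolding c by (intro borel_measurable_lebesgueI test_fun_borel test_fun_deriv_borel \<phi>)+
  have *: "integrable lebesgue (\<lambda>x. (h x)\<^sup>2)" if "h \<in> borel_measurable lebesgue" "\<And>x. norm x \<ge> R \<Longrightarrow> h x = 0" "\<And>x. \<bar>h x\<bar> \<le> L" for h :: "R2 \<Rightarrow> real"
  proof -
    have "integrable lebesgue (\<lambda>x::R2. (indicator (ball 0 R) x)\<^sup>2 :: real)"
    proof -
      have "integrable lborel (indicator (ball (0::R2) R) :: _ \<Rightarrow> real)"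
        by (intro integrable_real_indicator emeasure_bounded_finite) auto
      moreover have "(\<lambda>x::R2. (indicator (ball 0 R) x)\<^sup>2 :: real) = indicator (ball 0 R)" by (auto simp: indicator_def)
      ultimately show ?thesis by (simp add: integrable_completion)
    qed
    from L2_bound[OF this that(1), of L] show ?thesis
      using that(2,3) RL(5) by (auto simp: indicator_def not_less)
  qed
  show "integrable lebesgue (\<lambda>x. (\<phi> x)\<^sup>2)" using * m RL by blast
  show "integrable lebesgue (\<lambda>x. (cgrad \<phi> x $ i)\<^sup>2)" using *[OF m(2)] RL unfolding c by (simp add: cgrad_def)
qed

lemma has_weak_grad_iff_wdir:
  assumes [measurable]: "u \<in> borel_measurable lebesgue" "g \<in> borel_measurable lebesgue" "u' \<in> borel_measurable borel" "g' \<in> borel_measurable borel"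
    and ae: "AE x in lebesgue. u x = u' x" "AE x in lebesgue. g x = g' x"
  shows "has_weak_grad u g \<longleftrightarrow> (\<forall>i. wdir (axis i 1) u' (\<lambda>x. g' x $ i))"
proof -
  note [measurable] = borel_measurable_lebesgueI[OF assms(3)] borel_measurable_lebesgueI[OF assms(4)]
  have "(\<integral>x. u x * cgrad \<phi> x $ i \<partial>lebesgue) = (\<integral>x. u' x * frechet_derivative \<phi> (at x) (axis i 1) \<partial>lborel)"
    "(\<integral>x. g x $ i * \<phi> x \<partial>lebesgue) = (\<integral>x. g' x $ i * \<phi> x \<partial>lborel)" if \<phi>: "test_fun UNIV \<phi>" for \<phi> i
  proof -
    note [measurable] = test_fun_L2(1,3)[OF \<phi>] test_fun_borel[OF \<phi>] test_fun_deriv_borel[OF \<phi>]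
    have "(\<integral>x. u x * cgrad \<phi> x $ i \<partial>lebesgue) = (\<integral>x. u' x * cgrad \<phi> x $ i \<partial>lebesgue)"
      by (rule integral_cong_AE) (use ae in auto)
    also have "\<dots> = (\<integral>x. u' x * frechet_derivative \<phi> (at x) (axis i 1) \<partial>lborel)"
      by (simp add: cgrad_def integral_completion)
    finally show "(\<integral>x. u x * cgrad \<phi> x $ i \<partial>lebesgue) = (\<integral>x. u' x * frechet_derivative \<phi> (at x) (axis i 1) \<partial>lborel)" .
    have "(\<integral>x. g x $ i * \<phi> x \<partial>lebesgue) = (\<integral>x. g' x $ i * \<phi> x \<partial>lebesgue)"
      by (rule integral_cong_AE) (use ae in auto)
    also have "\<dots> = (\<integral>x. g' x $ i * \<phi> x \<partial>lborel)"
      by (simp add: integral_completion)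
    finally show "(\<integral>x. g x $ i * \<phi> x \<partial>lebesgue) = (\<integral>x. g' x $ i * \<phi> x \<partial>lborel)" .
  qed
  then show ?thesis unfolding has_weak_grad_def wdir_def by auto
qed

lemma borel_representative_vec:
  fixes g :: "R2 \<Rightarrow> R2"
  assumes [measurable]: "g \<in> borel_measurable lebesgue"
  obtains g' where "g' \<in> borel_measurable borel" "AE x in lebesgue. g x = g' x"
proof -
  have "\<exists>h. h \<in> borel_measurable borel \<and> (AE x in lebesgue. g x $ i = h x)" for i
  proof -
    have "(\<lambda>x. g x $ i) \<in> borel_measurable lebesgue" by measurable
    from borel_representative[OF this] show ?thesis by blast
  qed
  then obtain h where h: "\<And>i. h i \<in> borel_measurable borel" "\<And>i. AE x in lebesgue. g x $ i = h i x" by metis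
  show ?thesis
  proof
    show "(\<lambda>x. \<chi> i. h i x) \<in> borel_measurable borel" using h by (intro vec_borelI) simp
    have "AE x in lebesgue. \<forall>i. g x $ i = h i x" using h(2) by (simp add: AE_all_countable)
    then show "AE x in lebesgue. g x = (\<chi> i. h i x)" by eventually_elim (simp add: vec_eq_iff)
  qed
qed

lemma sqi_of_lebesgue:
  assumes [measurable]: "u \<in> borel_measurable lebesgue" "u' \<in> borel_measurable borel" and "AE x in lebesgue. u x = u' x"
    and "integrable lebesgue (\<lambda>x. (u x)\<^sup>2)"
  shows "sqi u'"
proof -
  note [measurable] = borel_measurable_lebesgueI[OF assms(2)]
  have "integrable lebesgue (\<lambda>x. (u' x)\<^sup>2)"
    by (rule integrable_cong_AE_imp[OF assms(4)]) (use assms(3) in auto)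
  then show ?thesis using assms(2) by (simp add: sqi_def integrable_completion)
qed

lemma isgrad_representative:
  assumes ug: "isgrad u g" and I: "I \<in> sets borel" "\<And>x. u x \<in> I"
  obtains u' g' where "u' \<in> borel_measurable borel" "g' \<in> borel_measurable borel"
    "AE x in lebesgue. u x = u' x" "AE x in lebesgue. g x = g' x" "\<And>x. u' x \<in> I"
    "sqi u'" "\<And>i. sqi (\<lambda>x. g' x $ i)" "\<And>i. wdir (axis i 1) u' (\<lambda>x. g' x $ i)"
proof -
  note [measurable] = isgradD(1,3)[OF ug] I(1)
  obtain v where v[measurable]: "v \<in> borel_measurable borel" and av: "AE x in lebesgue. u x = v x"
    using borel_representative[OF isgradD(1)[OF ug]] by metis
  \<comment> \<open>Redefinition on a null set keeps all values in \<open>I\<close>, as the chain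
    rule on \<open>I\<close> requires; \<open>u 0\<close> is merely some element of
    \<open>I\<close>.\<close>
  define u' where "u' x = (if v x \<in> I then v x else u 0)" for x
  have u'[measurable]: "u' \<in> borel_measurable borel" unfolding u'_def by measurable
  have au: "AE x in lebesgue. u x = u' x" using av by eventually_elim (use I(2) in \<open>metis u'_def\<close>)
  have uI: "u' x \<in> I" for x using I by (auto simp: u'_def)
  obtain g' where g'[measurable]: "g' \<in> borel_measurable borel" and ag: "AE x in lebesgue. g x = g' x"
    using borel_representative_vec[OF isgradD(3)[OF ug]] by metis
  have "sqi u'" by (rule sqi_of_lebesgue[OF _ u' au]) (use isgradD[OF ug] in auto)
  moreover have "sqi (\<lambda>x. g' x $ i)" for i
    by (rule sqi_of_lebesgue[where u = "\<lambda>x. g x $ i"])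
       (use ag in \<open>auto intro!: L2_component isgradD[OF ug]\<close>)
  moreover have "wdir (axis i 1) u' (\<lambda>x. g' x $ i)" for i
    using has_weak_grad_iff_wdir[OF isgradD(1,3)[OF ug] u' g' au ag] isgradD(5)[OF ug] by blast
  ultimately show ?thesis using that[OF u' g' au ag uI] by blast
qed

lemma has_weak_grad_product_chain:
  fixes T T' :: "real \<Rightarrow> real" and \<phi> :: "R2 \<Rightarrow> real" and \<Phi> :: "R2 \<Rightarrow> R2"
  assumes ug: "isgrad u g"
    and I: "is_interval I" "I \<in> sets borel" and uI: "\<And>x. u x \<in> I"
    and T: "\<And>s. s \<in> I \<Longrightarrow> (T has_real_derivative T' s) (at s within I)" and T': "continuous_on I T'"
    and L: "\<And>s. s \<in> I \<Longrightarrow> \<bar>T' s\<bar> \<le> L"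
    and [measurable]: "T \<in> borel_measurable borel" "T' \<in> borel_measurable borel" "\<Phi> \<in> borel_measurable borel"
    and \<phi>: "continuous_on UNIV \<phi>" and M: "\<And>x. \<bar>\<phi> x\<bar> \<le> M" and N: "\<And>i x t. \<bar>\<phi> (x + t *\<^sub>R axis i 1) - \<phi> x\<bar> \<le> N * \<bar>t\<bar>"
    and N': "\<And>i x. \<bar>\<Phi> x $ i\<bar> \<le> N"
    and \<phi>': "\<And>i. AE x in lborel. (\<lambda>n. (\<phi> (x + tn n *\<^sub>R axis i 1) - \<phi> x) / tn n) \<longlonglongrightarrow> \<Phi> x $ i"
  shows "has_weak_grad (\<lambda>x. \<phi> x * T (u x)) (\<lambda>x. (\<phi> x * T' (u x)) *\<^sub>R g x + T (u x) *\<^sub>R \<Phi> x)"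
    and "(\<lambda>x. \<phi> x * T (u x)) \<in> borel_measurable lebesgue"
    and "(\<lambda>x. (\<phi> x * T' (u x)) *\<^sub>R g x + T (u x) *\<^sub>R \<Phi> x) \<in> borel_measurable lebesgue"
proof -
  obtain u' g' where r: "u' \<in> borel_measurable borel" "g' \<in> borel_measurable borel"
    "AE x in lebesgue. u x = u' x" "AE x in lebesgue. g x = g' x" "\<And>x. u' x \<in> I"
    "sqi u'" "\<And>i. sqi (\<lambda>x. g' x $ i)" "\<And>i. wdir (axis i 1) u' (\<lambda>x. g' x $ i)"
    using isgrad_representative[OF ug I(2) uI] by blast
  note [measurable] = r(1,2) isgradD(1,3)[OF ug] borel_measurable_continuous_onI[OF \<phi>]
  note [measurable] = borel_measurable_lebesgueI[OF borel_measurable_continuous_onI[OF \<phi>]] borel_measurable_lebesgueI[of T']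
    borel_measurable_lebesgueI[of T]
  have \<Phi>l[measurable]: "\<Phi> \<in> borel_measurable lebesgue" by (simp add: measurable_completion)
  show m1: "(\<lambda>x. \<phi> x * T (u x)) \<in> borel_measurable lebesgue" by measurable
  show m2: "(\<lambda>x. (\<phi> x * T' (u x)) *\<^sub>R g x + T (u x) *\<^sub>R \<Phi> x) \<in> borel_measurable lebesgue" by measurable
  have "wdir (axis i 1) (\<lambda>x. \<phi> x * T (u' x)) (\<lambda>x. \<phi> x * T' (u' x) * g' x $ i + T (u' x) * \<Phi> x $ i)" for i
    by (rule wdir_product_chain[OF r(6,7,8) I(1) r(5) T T' L _ _ _ \<phi> M N N' \<phi>']) measurable
  then show "has_weak_grad (\<lambda>x. \<phi> x * T (u x)) (\<lambda>x. (\<phi> x * T' (u x)) *\<^sub>R g x + T (u x) *\<^sub>R \<Phi> x)"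
    using r(3,4)
    by (subst has_weak_grad_iff_wdir[OF m1 m2, where u' = "\<lambda>x. \<phi> x * T (u' x)" and g' = "\<lambda>x. (\<phi> x * T' (u' x)) *\<^sub>R g' x + T (u' x) *\<^sub>R \<Phi> x"])
       auto
qed

lemma has_weak_grad_chain:
  fixes T T' :: "real \<Rightarrow> real"
  assumes ug: "isgrad u g"
    and I: "is_interval I" "I \<in> sets borel" and uI: "\<And>x. u x \<in> I"
    and T: "\<And>s. s \<in> I \<Longrightarrow> (T has_real_derivative T' s) (at s within I)" and T': "continuous_on I T'"
    and L: "\<And>s. s \<in> I \<Longrightarrow> \<bar>T' s\<bar> \<le> L"
    and m: "T \<in> borel_measurable borel" "T' \<in> borel_measurable borel"
  shows "has_weak_grad (\<lambda>x. T (u x)) (\<lambda>x. T' (u x) *\<^sub>R g x)"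
  using has_weak_grad_product_chain(1)[OF ug I uI T T' L m, of "\<lambda>x. 0" "\<lambda>x. 1" 1 0] by simp

lemma has_weak_grad_limit:
  assumes w: "\<And>k. has_weak_grad (U k) (G k)"
    and [measurable]: "\<And>k. U k \<in> borel_measurable lebesgue" "\<And>k. G k \<in> borel_measurable lebesgue"
      "U0 \<in> borel_measurable lebesgue" "G0 \<in> borel_measurable lebesgue" "b \<in> borel_measurable lebesgue" "c \<in> borel_measurable lebesgue"
    and b: "integrable lebesgue (\<lambda>x. (b x :: real)\<^sup>2)" "\<And>k x. \<bar>U k x\<bar> \<le> b x"
    and c: "integrable lebesgue (\<lambda>x. (c x :: real)\<^sup>2)" "\<And>k x. norm (G k x) \<le> c x"
    and U: "\<And>x. (\<lambda>k. U k x) \<longlonglongrightarrow> U0 x" and G: "\<And>x. (\<lambda>k. G k x) \<longlonglongrightarrow> G0 x"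
  shows "has_weak_grad U0 G0"
  unfolding has_weak_grad_def
proof (intro allI impI)
  fix \<phi> i assume \<phi>: "test_fun UNIV \<phi>"
  note [measurable] = test_fun_L2(1,3)[OF \<phi>]
  have lU: "(\<lambda>k. \<integral>x. U k x * cgrad \<phi> x $ i \<partial>lebesgue) \<longlonglongrightarrow> (\<integral>x. U0 x * cgrad \<phi> x $ i \<partial>lebesgue)"
  proof (rule integral_dominated_convergence[where w = "\<lambda>x. \<bar>b x * cgrad \<phi> x $ i\<bar>"])
    show "integrable lebesgue (\<lambda>x. \<bar>b x * cgrad \<phi> x $ i\<bar>)"
      by (intro integrable_abs L2_mult b test_fun_L2[OF \<phi>]) auto
    show "AE x in lebesgue. (\<lambda>k. U k x * cgrad \<phi> x $ i) \<longlonglongrightarrow> U0 x * cgrad \<phi> x $ i"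
      by (intro AE_I2 tendsto_intros U)
    show "AE x in lebesgue. norm (U k x * cgrad \<phi> x $ i) \<le> \<bar>b x * cgrad \<phi> x $ i\<bar>" for k
      using mult_right_mono[OF order_trans[OF b(2) abs_ge_self] abs_ge_zero] by (intro AE_I2) (simp add: abs_mult)
  qed measurable
  have "(\<lambda>k. \<integral>x. G k x $ i * \<phi> x \<partial>lebesgue) \<longlonglongrightarrow> (\<integral>x. G0 x $ i * \<phi> x \<partial>lebesgue)"
  proof (rule integral_dominated_convergence[where w = "\<lambda>x. \<bar>c x * \<phi> x\<bar>"])
    show "integrable lebesgue (\<lambda>x. \<bar>c x * \<phi> x\<bar>)"
      by (intro integrable_abs L2_mult c test_fun_L2[OF \<phi>]) auto
    show "AE x in lebesgue. (\<lambda>k. G k x $ i * \<phi> x) \<longlonglongrightarrow> G0 x $ i * \<phi> x"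
      by (intro AE_I2 tendsto_intros G)
    have "\<bar>G k x $ i\<bar> \<le> \<bar>c x\<bar>" for k x
      using component_le_norm_cart[of "G k x" i] c(2)[of k x] by linarith
    then show "AE x in lebesgue. norm (G k x $ i * \<phi> x) \<le> \<bar>c x * \<phi> x\<bar>" for k
      by (intro AE_I2) (auto simp: abs_mult intro!: mult_right_mono)
  qed measurable
  then have "(\<lambda>k. - (\<integral>x. G k x $ i * \<phi> x \<partial>lebesgue)) \<longlonglongrightarrow> - (\<integral>x. G0 x $ i * \<phi> x \<partial>lebesgue)"
    by (rule tendsto_minus)
  moreover have "(\<integral>x. U k x * cgrad \<phi> x $ i \<partial>lebesgue) = - (\<integral>x. G k x $ i * \<phi> x \<partial>lebesgue)" for k
    using w \<phi> unfolding has_weak_grad_def by blast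
  ultimately show "(\<integral>x. U0 x * cgrad \<phi> x $ i \<partial>lebesgue) = - (\<integral>x. G0 x $ i * \<phi> x \<partial>lebesgue)"
    using LIMSEQ_unique[OF lU] by simp
qed

lemma has_weak_grad_unique:
  assumes [measurable]: "g \<in> borel_measurable lebesgue" "h \<in> borel_measurable lebesgue"
    and g: "integrable lebesgue (\<lambda>x. (norm (g x))\<^sup>2)" and h: "integrable lebesgue (\<lambda>x. (norm (h x))\<^sup>2)"
    and w: "has_weak_grad u g" "has_weak_grad u h"
  shows "AE x in lebesgue. g x = h x"
proof -
  have "AE x in lebesgue. g x $ i - h x $ i = 0" for i
  proof (rule fundamental_lemma)
    fix \<phi> assume \<phi>: "test_fun UNIV \<phi>"
    note [measurable] = test_fun_L2(1,3)[OF \<phi>]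
    have i: "integrable lebesgue (\<lambda>x. g x $ i * \<phi> x)" "integrable lebesgue (\<lambda>x. h x $ i * \<phi> x)"
      by (intro L2_mult L2_component g h test_fun_L2[OF \<phi>]; measurable)+
    then show "integrable lebesgue (\<lambda>x. (g x $ i - h x $ i) * \<phi> x)" by (simp add: left_diff_distrib)
    have "- (\<integral>x. g x $ i * \<phi> x \<partial>lebesgue) = - (\<integral>x. h x $ i * \<phi> x \<partial>lebesgue)"
      using w[unfolded has_weak_grad_def, rule_format, OF \<phi>, of i] by simp
    then show "(\<integral>x. (g x $ i - h x $ i) * \<phi> x \<partial>lebesgue) = 0" using i by (simp add: left_diff_distrib)
  qed measurable
  then have "AE x in lebesgue. \<forall>i. g x $ i - h x $ i = 0" by (simp add: AE_all_countable)
  then show ?thesis by eventually_elim (simp add: vec_eq_iff)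
qed

lemma isgrad_lincomb:
  assumes u: "isgrad u g" and v: "isgrad v h"
  shows "isgrad (\<lambda>x. a * u x + c * v x) (\<lambda>x. a *\<^sub>R g x + c *\<^sub>R h x)"
proof -
  note [measurable] = isgradD(1,3)[OF u] isgradD(1,3)[OF v]
  have "integrable lebesgue (\<lambda>x. (norm (a * u x + c * v x))\<^sup>2)"
    by (rule L2_add) (use isgradD(2)[OF u] isgradD(2)[OF v] in \<open>auto simp: power_mult_distrib\<close>)
  moreover have "integrable lebesgue (\<lambda>x. (norm (a *\<^sub>R g x + c *\<^sub>R h x))\<^sup>2)"
    by (rule L2_add) (use isgradD(4)[OF u] isgradD(4)[OF v] in \<open>auto simp: power_mult_distrib\<close>)
  moreover have "has_weak_grad (\<lambda>x. a * u x + c * v x) (\<lambda>x. a *\<^sub>R g x + c *\<^sub>R h x)"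
    unfolding has_weak_grad_def
  proof (intro allI impI)
    fix \<phi> i assume \<phi>: "test_fun UNIV \<phi>"
    note [measurable] = test_fun_L2(1,3)[OF \<phi>]
    have i: "integrable lebesgue (\<lambda>x. u x * cgrad \<phi> x $ i)" "integrable lebesgue (\<lambda>x. v x * cgrad \<phi> x $ i)"
      "integrable lebesgue (\<lambda>x. g x $ i * \<phi> x)" "integrable lebesgue (\<lambda>x. h x $ i * \<phi> x)"
      by (intro L2_mult L2_component isgradD[OF u] isgradD[OF v] test_fun_L2[OF \<phi>]; measurable)+
    have w: "(\<integral>x. u x * cgrad \<phi> x $ i \<partial>lebesgue) = - (\<integral>x. g x $ i * \<phi> x \<partial>lebesgue)"
      "(\<integral>x. v x * cgrad \<phi> x $ i \<partial>lebesgue) = - (\<integral>x. h x $ i * \<phi> x \<partial>lebesgue)"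
      using isgradD(5)[OF u] isgradD(5)[OF v] \<phi> unfolding has_weak_grad_def by blast+
    have "(\<integral>x. (a * u x + c * v x) * cgrad \<phi> x $ i \<partial>lebesgue) = (\<integral>x. a * (u x * cgrad \<phi> x $ i) + c * (v x * cgrad \<phi> x $ i) \<partial>lebesgue)"
      by (simp add: algebra_simps)
    also have "\<dots> = - (\<integral>x. a * (g x $ i * \<phi> x) + c * (h x $ i * \<phi> x) \<partial>lebesgue)"
      using i w by simp
    finally show "(\<integral>x. (a * u x + c * v x) * cgrad \<phi> x $ i \<partial>lebesgue) = - (\<integral>x. (a *\<^sub>R g x + c *\<^sub>R h x) $ i * \<phi> x \<partial>lebesgue)"
      by (simp add: algebra_simps)
  qed
  ultimately show ?thesis by (simp add: isgrad_def)
qed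

lemma isgrad_cong_AE:
  assumes u: "isgrad u g" and [measurable]: "h \<in> borel_measurable lebesgue" and ae: "AE x in lebesgue. g x = h x"
  shows "isgrad u h"
proof -
  note [measurable] = isgradD(1,3)[OF u]
  have "integrable lebesgue (\<lambda>x. (norm (h x))\<^sup>2)"
    by (rule integrable_cong_AE_imp[OF isgradD(4)[OF u]]) (use ae in auto)
  moreover have "has_weak_grad u h"
    unfolding has_weak_grad_def
  proof (intro allI impI)
    fix \<phi> i assume \<phi>: "test_fun UNIV \<phi>"
    note [measurable] = test_fun_L2(1,3)[OF \<phi>]
    have "(\<integral>x. g x $ i * \<phi> x \<partial>lebesgue) = (\<integral>x. h x $ i * \<phi> x \<partial>lebesgue)"
      by (rule integral_cong_AE) (use ae in auto)
    moreover have "(\<integral>x. u x * cgrad \<phi> x $ i \<partial>lebesgue) = - (\<integral>x. g x $ i * \<phi> x \<partial>lebesgue)"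
      using isgradD(5)[OF u] \<phi> unfolding has_weak_grad_def by blast
    ultimately show "(\<integral>x. u x * cgrad \<phi> x $ i \<partial>lebesgue) = - (\<integral>x. h x $ i * \<phi> x \<partial>lebesgue)" by simp
  qed
  ultimately show ?thesis using isgradD[OF u] by (simp add: isgrad_def)
qed

section \<open>Behaviour under dilations and translations of the plane\<close>

lemma lebesgue_affine_R2:
  fixes a :: R2 assumes l: "l \<noteq> 0"
  shows "(\<lambda>x. a + l *\<^sub>R x) \<in> lebesgue \<rightarrow>\<^sub>M lebesgue"
    and "lebesgue = density (distr lebesgue lebesgue (\<lambda>x. a + l *\<^sub>R x)) (\<lambda>_. ennreal (l\<^sup>2))"
proof -
  have eq: "(\<lambda>x. a + (\<Sum>j\<in>Basis. (l * (x \<bullet> j)) *\<^sub>R j)) = (\<lambda>x. a + l *\<^sub>R x)"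
    unfolding scaleR_scaleR[symmetric] scaleR_sum_right[symmetric] euclidean_representation ..
  show "(\<lambda>x. a + l *\<^sub>R x) \<in> lebesgue \<rightarrow>\<^sub>M lebesgue"
    using lebesgue_affine_measurable[of "\<lambda>_. l" a] l unfolding eq by simp
  show "lebesgue = density (distr lebesgue lebesgue (\<lambda>x. a + l *\<^sub>R x)) (\<lambda>_. ennreal (l\<^sup>2))"
    using lebesgue_affine_euclidean[of "\<lambda>_. l" a] l unfolding eq by simp
qed

lemma lebesgue_integral_affine_R2:
  fixes f :: "R2 \<Rightarrow> real"
  assumes l: "l \<noteq> 0" and f[measurable]: "f \<in> borel_measurable lebesgue"
  shows "(\<lambda>x. f (a + l *\<^sub>R x)) \<in> borel_measurable lebesgue"
    and "integrable lebesgue (\<lambda>x. f (a + l *\<^sub>R x)) \<longleftrightarrow> integrable lebesgue f"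
    and "(\<integral>x. f (a + l *\<^sub>R x) \<partial>lebesgue) = (\<integral>x. f x \<partial>lebesgue) / l\<^sup>2"
proof -
  let ?T = "\<lambda>x. a + l *\<^sub>R x"
  note T[measurable] = lebesgue_affine_R2(1)[OF l, of a]
  show "(\<lambda>x. f (a + l *\<^sub>R x)) \<in> borel_measurable lebesgue" using measurable_compose[OF T f] .
  have "integrable lebesgue f \<longleftrightarrow> integrable (density (distr lebesgue lebesgue ?T) (\<lambda>_. ennreal (l\<^sup>2))) f"
    using lebesgue_affine_R2(2)[OF l, of a] by simp
  also have "\<dots> \<longleftrightarrow> integrable (distr lebesgue lebesgue ?T) (\<lambda>x. l\<^sup>2 *\<^sub>R f x)"
    by (rule integrable_density) auto
  also have "\<dots> \<longleftrightarrow> integrable lebesgue (\<lambda>x. l\<^sup>2 *\<^sub>R f (?T x))" by (rule integrable_distr_eq) auto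
  finally show "integrable lebesgue (\<lambda>x. f (a + l *\<^sub>R x)) \<longleftrightarrow> integrable lebesgue f" using l by simp
  have "(\<integral>x. f x \<partial>lebesgue) = (\<integral>x. f x \<partial>density (distr lebesgue lebesgue ?T) (\<lambda>_. ennreal (l\<^sup>2)))"
    using lebesgue_affine_R2(2)[OF l, of a] by simp
  also have "\<dots> = (\<integral>x. l\<^sup>2 *\<^sub>R f x \<partial>distr lebesgue lebesgue ?T)"
    by (rule integral_density) auto
  also have "\<dots> = (\<integral>x. l\<^sup>2 *\<^sub>R f (?T x) \<partial>lebesgue)" by (rule integral_distr) auto
  finally show "(\<integral>x. f (a + l *\<^sub>R x) \<partial>lebesgue) = (\<integral>x. f x \<partial>lebesgue) / l\<^sup>2" using l by simp
qed

text \<open>Negative \<open>l\<close> is allowed: the reflection it contains later places the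
  negative part in the opposite half-plane.\<close>

lemma isgrad_affine:
  assumes u: "isgrad u g" and l: "l \<noteq> 0"
  shows "isgrad (\<lambda>x. u (a + l *\<^sub>R x)) (\<lambda>x. l *\<^sub>R g (a + l *\<^sub>R x))"
proof -
  note um[measurable] = isgradD(1)[OF u] and gm[measurable] = isgradD(3)[OF u]
  have [measurable]: "(\<lambda>x. u (a + l *\<^sub>R x)) \<in> borel_measurable lebesgue"
    by (rule lebesgue_integral_affine_R2(1)[OF l um])
  have [measurable]: "(\<lambda>x. g (a + l *\<^sub>R x)) \<in> borel_measurable lebesgue"
    using measurable_compose[OF lebesgue_affine_R2(1)[OF l] gm] .
  have "integrable lebesgue (\<lambda>x. (u (a + l *\<^sub>R x))\<^sup>2)"
    using lebesgue_integral_affine_R2(2)[OF l, of "\<lambda>x. (u x)\<^sup>2" a] isgradD(2)[OF u] by simp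
  moreover have "integrable lebesgue (\<lambda>x. (norm (g (a + l *\<^sub>R x)))\<^sup>2)"
    using lebesgue_integral_affine_R2(2)[OF l, of "\<lambda>x. (norm (g x))\<^sup>2" a] isgradD(4)[OF u] by simp
  then have "integrable lebesgue (\<lambda>x. (norm (l *\<^sub>R g (a + l *\<^sub>R x)))\<^sup>2)" by (simp add: power_mult_distrib)
  moreover have "has_weak_grad (\<lambda>x. u (a + l *\<^sub>R x)) (\<lambda>x. l *\<^sub>R g (a + l *\<^sub>R x))"
    unfolding has_weak_grad_def
  proof (intro allI impI)
    fix \<phi> i assume \<phi>: "test_fun UNIV \<phi>"
    \<comment> \<open>The test function is transported by the inverse map, so that its values and
      derivatives at \<open>a + l *\<^sub>R x\<close> are those of \<open>\<phi>\<close> at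
      \<open>x\<close>, up to the factor \<open>l\<close>.\<close>
    define \<psi> where "\<psi> y = \<phi> ((1/l) *\<^sub>R y + (- (1/l) *\<^sub>R a))" for y
    have \<psi>: "test_fun UNIV \<psi>" unfolding \<psi>_def by (rule test_fun_affine[OF \<phi>]) (use l in simp)
    note [measurable] = test_fun_L2(1,3)[OF \<phi>] test_fun_L2(1,3)[OF \<psi>]
    have eqx: "(1/l) *\<^sub>R (a + l *\<^sub>R x) + (- (1/l) *\<^sub>R a) = x" for x
      using l by (simp add: algebra_simps)
    have \<psi>x: "\<psi> (a + l *\<^sub>R x) = \<phi> x" for x unfolding \<psi>_def eqx ..
    have cg: "l * cgrad \<psi> (a + l *\<^sub>R x) $ i = cgrad \<phi> x $ i" for x
    proof -
      have "(\<psi> has_derivative (\<lambda>v. 1 * (1/l) * frechet_derivative \<phi> (at ((1/l) *\<^sub>R (a + l *\<^sub>R x) + (- (1/l) *\<^sub>R a))) v)) (at (a + l *\<^sub>R x))"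
        using frechet_derivative_affine[of \<phi> 1 "1/l" "- (1/l) *\<^sub>R a" "a + l *\<^sub>R x"]
          smooth2_differentiable[OF test_fun_smooth2[OF \<phi>]] unfolding \<psi>_def by simp
      from frechet_derivative_at[OF this] show ?thesis
        unfolding eqx cgrad_def using l by (simp add: fun_eq_iff field_simps)
    qed
    have "(\<integral>x. u (a + l *\<^sub>R x) * cgrad \<phi> x $ i \<partial>lebesgue) = (\<integral>x. l * (u (a + l *\<^sub>R x) * cgrad \<psi> (a + l *\<^sub>R x) $ i) \<partial>lebesgue)"
      by (simp add: cg[symmetric] mult_ac)
    also have "\<dots> = l * ((\<integral>x. u x * cgrad \<psi> x $ i \<partial>lebesgue) / l\<^sup>2)"
      using lebesgue_integral_affine_R2(3)[OF l, of "\<lambda>x. u x * cgrad \<psi> x $ i" a] by simp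
    also have "(\<integral>x. u x * cgrad \<psi> x $ i \<partial>lebesgue) = - (\<integral>x. g x $ i * \<psi> x \<partial>lebesgue)"
      using isgradD(5)[OF u] \<psi> unfolding has_weak_grad_def by blast
    also have "l * (- (\<integral>x. g x $ i * \<psi> x \<partial>lebesgue) / l\<^sup>2) = - (l * ((\<integral>x. g x $ i * \<psi> x \<partial>lebesgue) / l\<^sup>2))" by simp
    also have "(\<integral>x. g x $ i * \<psi> x \<partial>lebesgue) / l\<^sup>2 = (\<integral>x. g (a + l *\<^sub>R x) $ i * \<phi> x \<partial>lebesgue)"
      using lebesgue_integral_affine_R2(3)[OF l, of "\<lambda>x. g x $ i * \<psi> x" a] by (simp add: \<psi>x)
    finally show "(\<integral>x. u (a + l *\<^sub>R x) * cgrad \<phi> x $ i \<partial>lebesgue) = - (\<integral>x. (l *\<^sub>R g (a + l *\<^sub>R x)) $ i * \<phi> x \<partial>lebesgue)"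
      by (simp add: mult.assoc)
  qed
  ultimately show ?thesis by (simp add: isgrad_def)
qed

subsection \<open>Positive and negative parts\<close>

text \<open>The functions \<open>tn k * arctan (s / tn k)\<close> tend to 0 while their derivatives,
  bounded by 1, tend to the indicator of \<open>s = 0\<close>. In the limit the restriction of
  \<open>g\<close> to the zero level is a weak gradient of the zero function, and uniqueness
  applies.\<close>

lemma isgrad_zero_level:
  assumes u: "isgrad u g"
  shows "AE x in lebesgue. u x = 0 \<longrightarrow> g x = 0"
proof -
  note [measurable] = isgradD(1,3)[OF u]
  define T where "T k s = tn k * arctan (s / tn k)" for k s
  define T' where "T' k s = inverse (1 + (s / tn k)\<^sup>2)" for k s
  have dT: "(T k has_real_derivative T' k s) (at s)" for k s
    unfolding T_def T'_def using tn_pos[of k]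
    by (auto intro!: derivative_eq_intros simp: divide_inverse)
  have T'b: "\<bar>T' k s\<bar> \<le> 1" "T' k s \<ge> 0" for k s
    unfolding T'_def by (auto simp: inverse_le_1_iff add_nonneg_nonneg)
  have T'c: "continuous_on UNIV (T' k)" for k
    unfolding T'_def using tn_pos[of k] by (intro continuous_intros) (auto simp: add_nonneg_eq_0_iff)
  have Tc: "continuous_on UNIV (T k)" for k using dT by (meson DERIV_isCont continuous_at_imp_continuous_on)
  note [measurable] = borel_measurable_continuous_onI[OF Tc] borel_measurable_continuous_onI[OF T'c]
  have Tb: "\<bar>T k s\<bar> \<le> \<bar>s\<bar>" for k s
  proof -
    have "\<bar>T k s - T k 0\<bar> \<le> 1 * \<bar>s - 0\<bar>"
      using field_differentiable_bound[of UNIV "T k" "T' k" 1 s 0] dT T'b by simp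
    then show ?thesis by (simp add: T_def)
  qed
  have "has_weak_grad (\<lambda>x. 0) (\<lambda>x. if u x = 0 then g x else 0)"
  proof (rule has_weak_grad_limit[where U = "\<lambda>k x. T k (u x)" and G = "\<lambda>k x. T' k (u x) *\<^sub>R g x" and b = "\<lambda>x. \<bar>u x\<bar>" and c = "\<lambda>x. norm (g x)"])
    show "has_weak_grad (\<lambda>x. T k (u x)) (\<lambda>x. T' k (u x) *\<^sub>R g x)" for k
      by (rule has_weak_grad_chain[OF u, where I = UNIV and L = 1]) (use dT T'c T'b in auto)
    show "(\<lambda>k. T k (u x)) \<longlonglongrightarrow> 0" for x
    proof (rule Lim_null_comparison)
      show "\<forall>\<^sub>F k in sequentially. norm (T k (u x)) \<le> tn k * (pi / 2)"
      proof (rule always_eventually, rule allI)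
        fix k
        have "\<bar>arctan (u x / tn k)\<bar> \<le> pi / 2" using arctan_bounded[of "u x / tn k"] by auto
        then show "norm (T k (u x)) \<le> tn k * (pi / 2)"
          using tn_pos[of k] by (auto simp: T_def abs_mult intro!: mult_left_mono)
      qed
      have "(\<lambda>k. tn k * (pi / 2)) \<longlonglongrightarrow> 0 * (pi / 2)" by (intro tendsto_intros tn_lim)
      then show "(\<lambda>k. tn k * (pi / 2)) \<longlonglongrightarrow> 0" by simp
    qed
    show "(\<lambda>k. T' k (u x) *\<^sub>R g x) \<longlonglongrightarrow> (if u x = 0 then g x else 0)" for x
    proof (cases "u x = 0")
      case True then show ?thesis by (simp add: T'_def)
    next
      case False
      have "(\<lambda>k. (tn k)\<^sup>2 / ((tn k)\<^sup>2 + (u x)\<^sup>2)) \<longlonglongrightarrow> 0\<^sup>2 / (0\<^sup>2 + (u x)\<^sup>2)"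
        by (intro tendsto_intros tn_lim) (use False in auto)
      moreover have "(tn k)\<^sup>2 / ((tn k)\<^sup>2 + (u x)\<^sup>2) = T' k (u x)" for k
        using tn_pos[of k] by (simp add: T'_def power_divide field_simps)
      ultimately have "(\<lambda>k. T' k (u x)) \<longlonglongrightarrow> 0" by simp
      then have "(\<lambda>k. T' k (u x) *\<^sub>R g x) \<longlonglongrightarrow> 0 *\<^sub>R g x" by (intro tendsto_intros)
      then show ?thesis using False by simp
    qed
    show "norm (T' k (u x) *\<^sub>R g x) \<le> norm (g x)" for k x
      using T'b[of k "u x"] by (simp add: mult_left_le_one_le)
  qed (use isgradD[OF u] Tb in auto)
  then have "AE x in lebesgue. (if u x = 0 then g x else 0) = (0 :: R2)"
  proof (rule has_weak_grad_unique[rotated 4])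
    show "has_weak_grad (\<lambda>x. 0) (\<lambda>x. 0 :: R2)" by (simp add: has_weak_grad_def)
    show "integrable lebesgue (\<lambda>x. (norm (if u x = 0 then g x else 0))\<^sup>2)"
      using L2_bound[of lebesgue "\<lambda>x. norm (g x)" "\<lambda>x. if u x = 0 then g x else 0" 1] isgradD(4)[OF u] by simp
  qed auto
  then show ?thesis by eventually_elim (simp split: if_splits)
qed

text \<open>The absolute value is approximated by
  \<open>sqrt (s\<^sup>2 + (tn k)\<^sup>2) - tn k\<close>; subtracting \<open>tn k\<close> makes the
  approximations vanish at 0 and hence stay below \<open>\<bar>s\<bar>\<close>.\<close>

lemma isgrad_abs:
  assumes u: "isgrad u g"
  shows "isgrad (\<lambda>x. \<bar>u x\<bar>) (\<lambda>x. sgn (u x) *\<^sub>R g x)"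
proof -
  note [measurable] = isgradD(1,3)[OF u]
  define T where "T k s = sqrt (s\<^sup>2 + (tn k)\<^sup>2) - tn k" for k s
  define T' where "T' k s = s / sqrt (s\<^sup>2 + (tn k)\<^sup>2)" for k s
  have p: "0 < s\<^sup>2 + (tn k)\<^sup>2" for s k using tn_pos[of k] by (simp add: add_nonneg_pos)
  have dT: "(T k has_real_derivative T' k s) (at s)" for k s
    unfolding T_def T'_def using p[of s k] by (auto intro!: derivative_eq_intros simp: field_simps)
  have T'b: "\<bar>T' k s\<bar> \<le> 1" for k s
  proof -
    have "\<bar>s\<bar> = sqrt (s\<^sup>2)" by simp
    also have "\<dots> \<le> sqrt (s\<^sup>2 + (tn k)\<^sup>2)" by (intro real_sqrt_le_mono) auto
    finally show ?thesis using p[of s k] by (simp add: T'_def divide_le_eq)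
  qed
  have T'c: "continuous_on UNIV (T' k)" for k
    unfolding T'_def using p[of _ k] by (intro continuous_intros) (auto simp: less_imp_neq[symmetric])
  have Tc: "continuous_on UNIV (T k)" for k using dT by (meson DERIV_isCont continuous_at_imp_continuous_on)
  note [measurable] = borel_measurable_continuous_onI[OF Tc] borel_measurable_continuous_onI[OF T'c]
  have Tb: "\<bar>T k s\<bar> \<le> \<bar>s\<bar>" for k s
  proof -
    have "\<bar>T k s - T k 0\<bar> \<le> 1 * \<bar>s - 0\<bar>"
      using field_differentiable_bound[of UNIV "T k" "T' k" 1 s 0] dT T'b by simp
    then show ?thesis using tn_pos[of k] by (simp add: T_def)
  qed
  have "has_weak_grad (\<lambda>x. \<bar>u x\<bar>) (\<lambda>x. sgn (u x) *\<^sub>R g x)"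
  proof (rule has_weak_grad_limit[where U = "\<lambda>k x. T k (u x)" and G = "\<lambda>k x. T' k (u x) *\<^sub>R g x" and b = "\<lambda>x. \<bar>u x\<bar>" and c = "\<lambda>x. norm (g x)"])
    show "has_weak_grad (\<lambda>x. T k (u x)) (\<lambda>x. T' k (u x) *\<^sub>R g x)" for k
      by (rule has_weak_grad_chain[OF u, where I = UNIV and L = 1]) (use dT T'c T'b in auto)
    have l: "(\<lambda>k. sqrt (s\<^sup>2 + (tn k)\<^sup>2)) \<longlonglongrightarrow> \<bar>s\<bar>" for s
    proof -
      have "(\<lambda>k. sqrt (s\<^sup>2 + (tn k)\<^sup>2)) \<longlonglongrightarrow> sqrt (s\<^sup>2 + 0\<^sup>2)" by (intro tendsto_intros tn_lim)
      then show ?thesis by simp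
    qed
    show "(\<lambda>k. T k (u x)) \<longlonglongrightarrow> \<bar>u x\<bar>" for x
      using tendsto_diff[OF l tn_lim] by (simp add: T_def)
    show "(\<lambda>k. T' k (u x) *\<^sub>R g x) \<longlonglongrightarrow> sgn (u x) *\<^sub>R g x" for x
    proof (cases "u x = 0")
      case True then show ?thesis by (simp add: T'_def)
    next
      case False
      have "(\<lambda>k. T' k (u x)) \<longlonglongrightarrow> u x / \<bar>u x\<bar>"
        unfolding T'_def by (intro tendsto_divide l tendsto_const) (use False in auto)
      then show ?thesis using False by (intro tendsto_intros) (simp add: sgn_div_norm divide_inverse mult.commute)
    qed
    show "norm (T' k (u x) *\<^sub>R g x) \<le> norm (g x)" for k x
      using T'b[of k "u x"] by (simp add: mult_left_le_one_le)
  qed (use isgradD[OF u] Tb in auto)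
  moreover have "integrable lebesgue (\<lambda>x. (norm (sgn (u x) *\<^sub>R g x))\<^sup>2)"
    using L2_bound[of lebesgue "\<lambda>x. norm (g x)" "\<lambda>x. sgn (u x) *\<^sub>R g x" 1] isgradD(4)[OF u]
    by (simp add: abs_sgn_eq)
  ultimately show ?thesis using isgradD[OF u] by (simp add: isgrad_def)
qed

lemma isgrad_pos_part:
  assumes u: "isgrad u g"
  shows "isgrad (pos_part u) (\<lambda>x. if u x > 0 then g x else 0)"
proof (rule isgrad_cong_AE)
  note [measurable] = isgradD(1,3)[OF u]
  have "pos_part u = (\<lambda>x. (1/2) * u x + (1/2) * \<bar>u x\<bar>)" by (auto simp: pos_part_def fun_eq_iff max_def)
  then show "isgrad (pos_part u) (\<lambda>x. (1/2) *\<^sub>R g x + (1/2) *\<^sub>R (sgn (u x) *\<^sub>R g x))"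
    using isgrad_lincomb[OF u isgrad_abs[OF u], of "1/2" "1/2"] by simp
  show "AE x in lebesgue. (1/2) *\<^sub>R g x + (1/2) *\<^sub>R (sgn (u x) *\<^sub>R g x) = (if u x > 0 then g x else 0)"
    using isgrad_zero_level[OF u]
    by eventually_elim (auto simp: sgn_real_def scaleR_add_left[symmetric])
  show "(\<lambda>x. if u x > 0 then g x else 0) \<in> borel_measurable lebesgue" by measurable
qed

lemma isgrad_neg_part:
  assumes u: "isgrad u g"
  shows "isgrad (neg_part u) (\<lambda>x. if u x < 0 then g x else 0)"
proof (rule isgrad_cong_AE)
  note [measurable] = isgradD(1,3)[OF u]
  have "neg_part u = (\<lambda>x. (1/2) * u x + (-1/2) * \<bar>u x\<bar>)" by (auto simp: neg_part_def fun_eq_iff min_def)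
  then show "isgrad (neg_part u) (\<lambda>x. (1/2) *\<^sub>R g x + (-1/2) *\<^sub>R (sgn (u x) *\<^sub>R g x))"
    using isgrad_lincomb[OF u isgrad_abs[OF u], of "1/2" "-1/2"] by simp
  show "AE x in lebesgue. (1/2) *\<^sub>R g x + (-1/2) *\<^sub>R (sgn (u x) *\<^sub>R g x) = (if u x < 0 then g x else 0)"
    using isgrad_zero_level[OF u]
    by eventually_elim (auto simp: sgn_real_def scaleR_add_left[symmetric])
  show "(\<lambda>x. if u x < 0 then g x else 0) \<in> borel_measurable lebesgue" by measurable
qed

subsection \<open>The chosen weak gradient\<close>

text \<open>A vanishing derivative makes \<open>u\<close> invariant under translations in that
  direction. The integral of \<open>u\<^sup>2\<close> over a ball then equals that over translates
  moving off to infinity, which tends to 0 by integrability.\<close>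

lemma isgrad_partial_zero:
  assumes u: "isgrad u g" and z: "AE x in lebesgue. g x $ i = 0"
  shows "AE x in lebesgue. u x = 0"
proof -
  obtain u' g' where r: "u' \<in> borel_measurable borel" "g' \<in> borel_measurable borel"
    "AE x in lebesgue. u x = u' x" "AE x in lebesgue. g x = g' x"
    "sqi u'" "\<And>i. sqi (\<lambda>x. g' x $ i)" "\<And>i. wdir (axis i 1) u' (\<lambda>x. g' x $ i)"
    using isgrad_representative[OF u, of UNIV] by auto
  note [measurable] = r(1,2)
  define e :: R2 where "e = axis i 1"
  have ne: "norm e = 1" by (simp add: e_def)
  have "AE x in lebesgue. g' x $ i = 0" using z r(4) by eventually_elim simp
  then have g0: "AE x in lborel. g' x $ i = 0" by (simp add: AE_completion_iff)
  have w0: "wdir e u' (\<lambda>x. 0)"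
    unfolding wdir_def
  proof (intro allI impI)
    fix \<phi> assume \<phi>: "test_fun UNIV \<phi>"
    note [measurable] = test_fun_borel[OF \<phi>]
    have "(\<integral>x. g' x $ i * \<phi> x \<partial>lborel) = (\<integral>x. 0 * \<phi> x \<partial>lborel)"
      by (rule integral_cong_AE) (use g0 in auto)
    then show "(\<integral>x. u' x * frechet_derivative \<phi> (at x) e \<partial>lborel) = - (\<integral>x. 0 * \<phi> x \<partial>lborel)"
      using r(7)[of i] \<phi> unfolding wdir_def e_def by simp
  qed
  have s0: "sqi (\<lambda>x. 0)" by (simp add: sqi_def)
  have per: "AE x in lborel. u' (x + real n *\<^sub>R e) = u' x" for n
    using translation_identity[OF r(5) sqi_scale[OF s0] wdir_scale[OF w0], of "real n"]
    by eventually_elim simp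
  have u2: "integrable lborel (\<lambda>x. (u' x)\<^sup>2)" using r(5) by (simp add: sqi_def)
  have "AE x in lborel. x \<in> ball 0 (real m) \<longrightarrow> u' x = 0" for m :: nat
  proof -
    let ?B = "ball (0::R2) (real m)"
    have [measurable]: "?B \<in> sets borel" by simp
    have "(\<lambda>n. \<integral>x. (u' x)\<^sup>2 * indicator ?B (x - real n *\<^sub>R e) \<partial>lborel) \<longlonglongrightarrow> (\<integral>x. 0 \<partial>(lborel :: R2 measure))"
    proof (rule integral_dominated_convergence[where w = "\<lambda>x. (u' x)\<^sup>2"])
      show "AE x in lborel. (\<lambda>n. (u' x)\<^sup>2 * indicator ?B (x - real n *\<^sub>R e)) \<longlonglongrightarrow> 0"
      proof (rule AE_I2, rule tendsto_eventually)
        fix x :: R2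
        obtain N :: nat where N: "norm x + real m < real N" using reals_Archimedean2 by blast
        show "\<forall>\<^sub>F n in sequentially. (u' x)\<^sup>2 * indicator ?B (x - real n *\<^sub>R e) = 0"
          using eventually_ge_at_top[of N]
        proof eventually_elim
          case (elim n)
          have "norm (real n *\<^sub>R e) \<le> norm (x - real n *\<^sub>R e) + norm x"
            by (metis norm_minus_commute norm_triangle_sub add.commute)
          then have "norm (x - real n *\<^sub>R e) \<ge> real m" using N elim by (simp add: ne)
          then show ?case by simp
        qed
      qed
      show "AE x in lborel. norm ((u' x)\<^sup>2 * indicator ?B (x - real n *\<^sub>R e)) \<le> (u' x)\<^sup>2" for n
        by (intro AE_I2) (auto split: split_indicator)
      show "(\<lambda>x. (u' x)\<^sup>2 * indicator ?B (x - real n *\<^sub>R e)) \<in> borel_measurable lborel" for n by measurable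
    qed (use u2 in auto)
    moreover have "(\<integral>x. (u' x)\<^sup>2 * indicator ?B (x - real n *\<^sub>R e) \<partial>lborel) = (\<integral>x. (u' x)\<^sup>2 * indicator ?B x \<partial>lborel)" for n
    proof -
      have "(\<integral>x. (u' x)\<^sup>2 * indicator ?B (x - real n *\<^sub>R e) \<partial>lborel) = (\<integral>x. (u' (x + real n *\<^sub>R e))\<^sup>2 * indicator ?B x \<partial>lborel)"
        using lborel_translate(2)[of "\<lambda>x. (u' x)\<^sup>2 * indicator ?B (x - real n *\<^sub>R e)" "real n *\<^sub>R e"] by simp
      also have "\<dots> = (\<integral>x. (u' x)\<^sup>2 * indicator ?B x \<partial>lborel)"
        by (rule integral_cong_AE) (use per[of n] in auto)
      finally show ?thesis .
    qed
    ultimately have "(\<integral>x. (u' x)\<^sup>2 * indicator ?B x \<partial>lborel) = 0"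
      by (simp add: LIMSEQ_const_iff)
    moreover have "integrable lborel (\<lambda>x. (u' x)\<^sup>2 * indicator ?B x)"
      using integrable_mult_indicator[OF _ u2, of ?B] by (simp add: mult.commute)
    ultimately have "AE x in lborel. (u' x)\<^sup>2 * indicator ?B x = 0"
      by (subst (asm) integral_nonneg_eq_0_iff_AE) auto
    then show ?thesis by eventually_elim auto
  qed
  then have "AE x in lborel. \<forall>m::nat. x \<in> ball 0 (real m) \<longrightarrow> u' x = 0" unfolding AE_all_countable by blast
  then have "AE x in lborel. u' x = 0"
  proof eventually_elim
    case (elim x)
    obtain m :: nat where "norm x < real m" using reals_Archimedean2 by blast
    then show ?case using elim by auto
  qed
  from AE_completion[OF this] r(3) show ?thesis by eventually_elim simp
qed

text \<open>For functions that vanish almost everywhere this fails: a nowhere locally integrable field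
  \<open>g\<close> also satisfies \<^term>\<open>has_weak_grad (\<lambda>x. 0) g\<close>, because all the integrals involved are the junk value 0.\<close>

lemma wgrad_AE:
  assumes u: "isgrad u g" and nz: "nonzero u"
  shows "AE x in lebesgue. wgrad u x = g x"
proof -
  note [measurable] = isgradD(1,3)[OF u]
  define h where "h = wgrad u"
  have "h \<in> borel_measurable lebesgue \<and> has_weak_grad u h"
    unfolding h_def wgrad_def by (rule someI[of _ g]) (use isgradD[OF u] in auto)
  then have h[measurable]: "h \<in> borel_measurable lebesgue" and hw: "has_weak_grad u h" by auto
  have "AE x in lebesgue. h x $ i - g x $ i = 0" for i
  proof -
    have eq: "(\<integral>x. h x $ i * \<phi> x \<partial>lebesgue) = (\<integral>x. g x $ i * \<phi> x \<partial>lebesgue)" if "test_fun UNIV \<phi>" for \<phi>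
      using hw[unfolded has_weak_grad_def, rule_format, OF that, of i]
        isgradD(5)[OF u, unfolded has_weak_grad_def, rule_format, OF that, of i] by simp
    have gi: "integrable lebesgue (\<lambda>x. g x $ i * \<phi> x)" if "test_fun UNIV \<phi>" for \<phi>
      using test_fun_L2[OF that] by (intro L2_mult L2_component isgradD[OF u]) auto
    \<comment> \<open>If \<open>g\<close> has a nonzero integral against \<open>\<psi>\<close>, then
      so has \<open>h\<close>; hence \<open>h x $ i * \<psi> x\<close> is genuinely integrable,
      since the default value would be 0.\<close>
    obtain \<psi> where \<psi>: "test_fun UNIV \<psi>" "(\<integral>x. g x $ i * \<psi> x \<partial>lebesgue) \<noteq> 0"
    proof (rule ccontr)
      assume "\<not> thesis"
      then have "AE x in lebesgue. g x $ i = 0"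
        using that by (intro fundamental_lemma gi) auto
      from isgrad_partial_zero[OF u this] nz show False by (simp add: nonzero_def)
    qed
    have \<psi>i: "integrable lebesgue (\<lambda>x. h x $ i * \<psi> x)"
      by (rule ccontr) (use \<psi>(2) eq[OF \<psi>(1)] in \<open>simp add: not_integrable_integral_eq\<close>)
    \<comment> \<open>If the product of \<open>h\<close> with \<open>\<phi>\<close> were not
      integrable, neither would be that with \<open>\<phi> + \<psi>\<close>. Both integrals would be
      0 by default, so \<open>g\<close> would integrate to 0 against \<open>\<phi>\<close> and
      \<open>\<phi> + \<psi>\<close>, hence also against \<open>\<psi>\<close>.\<close>
    have hi: "integrable lebesgue (\<lambda>x. h x $ i * \<phi> x)" if \<phi>: "test_fun UNIV \<phi>" for \<phi>
    proof (rule ccontr)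
      assume n: "\<not> integrable lebesgue (\<lambda>x. h x $ i * \<phi> x)"
      have "\<not> integrable lebesgue (\<lambda>x. h x $ i * (\<phi> x + \<psi> x))"
      proof
        assume "integrable lebesgue (\<lambda>x. h x $ i * (\<phi> x + \<psi> x))"
        from Bochner_Integration.integrable_diff[OF this \<psi>i] n show False by (simp add: algebra_simps)
      qed
      then have "(\<integral>x. g x $ i * (\<phi> x + \<psi> x) \<partial>lebesgue) = 0"
        using eq[OF test_fun_add[OF \<phi> \<psi>(1)]] by (simp add: not_integrable_integral_eq)
      moreover have "(\<integral>x. g x $ i * \<phi> x \<partial>lebesgue) = 0"
        using eq[OF \<phi>] n by (simp add: not_integrable_integral_eq)
      ultimately show False using \<psi>(2) gi[OF \<phi>] gi[OF \<psi>(1)] by (simp add: distrib_left)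
    qed
    show ?thesis
      by (rule fundamental_lemma) (use hi gi eq in \<open>auto simp: left_diff_distrib\<close>)
  qed
  then have "AE x in lebesgue. \<forall>i. h x $ i - g x $ i = 0" unfolding AE_all_countable by blast
  then show ?thesis unfolding h_def by eventually_elim (simp add: vec_eq_iff)
qed

lemma isgrad_norm_pos:
  assumes u: "isgrad u g" and nz: "nonzero u"
  shows "(\<integral>x. (norm (g x))\<^sup>2 \<partial>lebesgue) > 0"
proof -
  have "(\<integral>x. (norm (g x))\<^sup>2 \<partial>lebesgue) \<noteq> 0"
  proof
    assume "(\<integral>x. (norm (g x))\<^sup>2 \<partial>lebesgue) = 0"
    then have "AE x in lebesgue. (norm (g x))\<^sup>2 = 0"
      using isgradD(4)[OF u] by (subst (asm) integral_nonneg_eq_0_iff_AE) auto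
    then have "AE x in lebesgue. g x $ 1 = 0" by eventually_elim simp
    from isgrad_partial_zero[OF u this] nz show False by (simp add: nonzero_def)
  qed
  moreover have "(\<integral>x. (norm (g x))\<^sup>2 \<partial>lebesgue) \<ge> 0" by simp
  ultimately show ?thesis by linarith
qed

subsection \<open>Cutting off to a half-plane\<close>

text \<open>On the transition strip the value is \<open>x $ 1 + R\<close>, so for fixed
  \<open>x\<close> it runs through [0, 1] at unit speed as \<open>R\<close> varies. This makes
  averages over \<open>R\<close> into averages over the factor \<open>\<sigma>\<close>.\<close>

definition ramp :: "real \<Rightarrow> R2 \<Rightarrow> real" where
  "ramp R x = max 0 (min 1 (x $ 1 + R))"

definition ramp_grad :: "real \<Rightarrow> R2 \<Rightarrow> R2" where
  "ramp_grad R x = (if - R < x $ 1 \<and> x $ 1 < 1 - R then axis 1 1 else 0)"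

lemma ramp_bounds: "0 \<le> ramp R x" "ramp R x \<le> 1" by (auto simp: ramp_def)

lemma ramp_continuous: "continuous_on UNIV (ramp R)"
  unfolding ramp_def by (intro continuous_intros)

lemma AE_not_hyperplane: "AE x :: R2 in lborel. x $ 1 \<noteq> c"
proof -
  have "negligible {x :: R2. x $ 1 = c}" 
    using negligible_standard_hyperplane[of "axis 1 1 :: R2" c] by (simp add: inner_axis axis_in_Basis_iff)
  then have "{x :: R2. x $ 1 = c} \<in> null_sets lebesgue" by (simp add: negligible_iff_null_sets)
  then have "AE x :: R2 in lebesgue. x \<notin> {x. x $ 1 = c}" by (rule AE_not_in)
  then show ?thesis by (simp add: AE_completion_iff)
qed

lemma ramp_line_derivative:
  assumes "x $ 1 \<noteq> - R" "x $ 1 \<noteq> 1 - R"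
  shows "((\<lambda>s. ramp R (x + s *\<^sub>R e)) has_real_derivative (if - R < x $ 1 \<and> x $ 1 < 1 - R then e $ 1 else 0)) (at 0)"
proof -
  have o: "open {s. x $ 1 + s * e $ 1 < a}" "open {s. a < x $ 1 + s * e $ 1}" for a
    by (intro open_Collect_less continuous_intros)+
  consider "x $ 1 < - R" | "- R < x $ 1" "x $ 1 < 1 - R" | "1 - R < x $ 1" using assms by linarith
  then show ?thesis
  proof cases
    case 1
    have "((\<lambda>s. 0) has_real_derivative 0) (at 0)" by simp
    then have "((\<lambda>s. ramp R (x + s *\<^sub>R e)) has_real_derivative 0) (at 0)"
      by (rule has_field_derivative_transform_within_open[OF _ o(1)[of "- R"]]) (use 1 in \<open>auto simp: ramp_def\<close>)
    then show ?thesis using 1 by simp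
  next
    case 2
    have "((\<lambda>s. x $ 1 + s * e $ 1 + R) has_real_derivative e $ 1) (at 0)" by (auto intro!: derivative_eq_intros)
    then have "((\<lambda>s. ramp R (x + s *\<^sub>R e)) has_real_derivative e $ 1) (at 0)"
      by (rule has_field_derivative_transform_within_open[OF _ open_Int[OF o(2)[of "- R"] o(1)[of "1 - R"]]])
         (use 2 in \<open>auto simp: ramp_def\<close>)
    then show ?thesis using 2 by simp
  next
    case 3
    have "((\<lambda>s. 1) has_real_derivative 0) (at 0)" by simp
    then have "((\<lambda>s. ramp R (x + s *\<^sub>R e)) has_real_derivative 0) (at 0)"
      by (rule has_field_derivative_transform_within_open[OF _ o(2)[of "1 - R"]]) (use 3 in \<open>auto simp: ramp_def\<close>)
    then show ?thesis using 3 by simp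
  qed
qed

lemma ramp_grad_borel[measurable]: "ramp_grad R \<in> borel_measurable borel"
  unfolding ramp_grad_def by measurable

lemma norm_cut_grad_le: "norm (ramp_grad R x) \<le> 1"
  by (simp add: ramp_grad_def)

text \<open>The ramp is only Lipschitz. The product rule was therefore stated with almost everywhere
  convergence of difference quotients, which here fails at most on the two lines bounding the
  strip.\<close>

lemma isgrad_ramp:
  assumes v: "isgrad v g"
  shows "isgrad (\<lambda>x. ramp R x * v x) (\<lambda>x. ramp R x *\<^sub>R g x + v x *\<^sub>R ramp_grad R x)"
proof -
  note [measurable] = isgradD(1,3)[OF v]
  have ax: "axis i (1::real) $ (1::2) = (if i = 1 then 1 else 0)" for i by (simp add: axis_def)
  note pc = has_weak_grad_product_chain[OF v, where I = UNIV and T = "\<lambda>s. s" and T' = "\<lambda>s. 1" and L = 1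
      and \<phi> = "ramp R" and \<Phi> = "ramp_grad R" and M = 1 and N = 1]
  have a1: "\<bar>ramp R (x + t *\<^sub>R axis i 1) - ramp R x\<bar> \<le> 1 * \<bar>t\<bar>" for i x t
    by (auto simp: ramp_def ax max_def min_def abs_if)
  have a2: "\<bar>ramp_grad R x $ i\<bar> \<le> 1" for i x
    using component_le_norm_cart[of "ramp_grad R x" i] norm_cut_grad_le[of R x] by linarith
  have a3: "AE x in lborel. (\<lambda>n. (ramp R (x + tn n *\<^sub>R axis i 1) - ramp R x) / tn n) \<longlonglongrightarrow> ramp_grad R x $ i" for i
    using AE_not_hyperplane[of "- R"] AE_not_hyperplane[of "1 - R"]
  proof eventually_elim
    case (elim x)
    have "ramp_grad R x $ i = (if - R < x $ 1 \<and> x $ 1 < 1 - R then (axis i 1 :: R2) $ 1 else 0)"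
      by (auto simp: ramp_grad_def axis_def)
    then show ?case
      using tn_difference_quotient[OF ramp_line_derivative[OF elim, of "axis i 1"], of 1] by simp
  qed
  have hw: "has_weak_grad (\<lambda>x. ramp R x * v x) (\<lambda>x. (ramp R x * 1) *\<^sub>R g x + v x *\<^sub>R ramp_grad R x)"
    "(\<lambda>x. ramp R x * v x) \<in> borel_measurable lebesgue"
    "(\<lambda>x. (ramp R x * 1) *\<^sub>R g x + v x *\<^sub>R ramp_grad R x) \<in> borel_measurable lebesgue"
    by (rule pc; use a1 a2 a3 ramp_continuous ramp_bounds in \<open>auto simp: is_interval_univ\<close>)+
  have [measurable]: "ramp R \<in> borel_measurable lebesgue"
    by (intro borel_measurable_lebesgueI borel_measurable_continuous_onI ramp_continuous)
  have [measurable]: "ramp_grad R \<in> borel_measurable lebesgue" by (simp add: measurable_completion)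
  have i1: "integrable lebesgue (\<lambda>x. (norm (ramp R x * v x))\<^sup>2)"
    by (rule L2_bound[OF isgradD(2)[OF v] _, of _ 1]) (use ramp_bounds in \<open>auto simp: abs_mult mult_left_le_one_le\<close>)
  have "integrable lebesgue (\<lambda>x. (norm (ramp R x *\<^sub>R g x + v x *\<^sub>R ramp_grad R x))\<^sup>2)"
  proof (rule L2_add)
    show "integrable lebesgue (\<lambda>x. (norm (ramp R x *\<^sub>R g x))\<^sup>2)"
      by (rule L2_bound[of _ "\<lambda>x. norm (g x)" _ 1]) (use ramp_bounds isgradD(4)[OF v] in \<open>auto simp: mult_left_le_one_le\<close>)
    show "integrable lebesgue (\<lambda>x. (norm (v x *\<^sub>R ramp_grad R x))\<^sup>2)"
      by (rule L2_bound[OF isgradD(2)[OF v] _, of _ 1]) (use norm_cut_grad_le in \<open>auto simp: mult_left_le\<close>)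
  qed measurable
  then show ?thesis using hw i1 by (simp add: isgrad_def)
qed

lemma wgrad_measurable:
  assumes "isgrad u g" shows "wgrad u \<in> borel_measurable lebesgue"
proof -
  have "wgrad u \<in> borel_measurable lebesgue \<and> has_weak_grad u (wgrad u)"
    unfolding wgrad_def by (rule someI[of _ g]) (use isgradD[OF assms] in auto)
  then show ?thesis by simp
qed

lemma Fprim_has_derivative:
  assumes f: "continuous_on UNIV f"
  shows "(Fprim f has_real_derivative f s) (at s)"
proof -
  define K where "K = \<bar>s\<bar> + 1"
  define G where "G u = integral {-K..u} f" for u
  have c: "continuous_on {-K..K} f" using f continuous_on_subset by blast
  have G: "(G has_vector_derivative f u) (at u within {-K..K})" if "u \<in> {-K..K}" for u
    unfolding G_def by (rule integral_has_vector_derivative[OF c that])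
  have F: "Fprim f u = G u - G 0" if u: "u \<in> {-K..K}" for u
  proof (cases "0 \<le> u")
    case True
    have "(f has_integral (G u - G 0)) {0..u}"
      by (rule fundamental_theorem_of_calculus[OF True])
         (use G u in \<open>auto intro!: has_vector_derivative_within_subset[OF G] simp: K_def\<close>)
    then show ?thesis using True by (simp add: Fprim_def integral_unique)
  next
    case False
    have "(f has_integral (G 0 - G u)) {u..0}"
      by (rule fundamental_theorem_of_calculus)
         (use False G u in \<open>auto intro!: has_vector_derivative_within_subset[OF G] simp: K_def\<close>)
    then show ?thesis using False by (simp add: Fprim_def integral_unique)
  qed
  have s: "s \<in> {-K<..<K}" by (auto simp: K_def)
  have "(G has_vector_derivative f s) (at s within {-K<..<K})"
    by (rule has_vector_derivative_within_subset[OF G]) (use s in auto)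
  then have "(G has_real_derivative f s) (at s)"
    using s by (simp add: at_within_open[OF s] has_real_derivative_iff_has_vector_derivative)
  then have "((\<lambda>u. G u - G 0) has_real_derivative f s) (at s)"
    by (auto intro!: derivative_eq_intros)
  then show ?thesis
    by (rule has_field_derivative_transform_within_open[where S = "{-K<..<K}"]) (use s F in auto)
qed

section \<open>The Nehari constraint, dilations and the reduced energy\<close>

locale nehari =
  fixes V0 \<theta> :: real and f :: "real \<Rightarrow> real"
  assumes V0: "V0 > 0" and fc: "continuous_on UNIV f" and f0: "f 0 = 0" and \<theta>: "\<theta> > 2"
    and AR: "\<And>s. s \<noteq> 0 \<Longrightarrow> 0 < \<theta> * Fprim f s \<and> \<theta> * Fprim f s \<le> s * f s"
begin

abbreviation F where "F \<equiv> Fprim f"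

lemma F_deriv: "(F has_real_derivative f s) (at s)" by (rule Fprim_has_derivative[OF fc])

lemma F_continuous: "continuous_on UNIV F"
  using F_deriv by (meson DERIV_isCont continuous_at_imp_continuous_on)

lemma fF_borel[measurable]: "f \<in> borel_measurable borel" "F \<in> borel_measurable borel"
  by (intro borel_measurable_continuous_onI fc F_continuous)+

lemma F_0[simp]: "F 0 = 0" by (simp add: Fprim_def)

lemma F_nonneg: "F s \<ge> 0"
  using AR[of s] \<theta> by (cases "s = 0") (auto simp: zero_less_mult_iff)

lemma F_le: "F s \<le> f s * s / \<theta>"
  using AR[of s] \<theta> by (cases "s = 0") (auto simp: field_simps)

lemma fs_nonneg: "0 \<le> f s * s"
  using AR[of s] by (cases "s = 0") (auto simp: mult.commute)

lemma F_le_fs: "F s \<le> f s * s"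
proof -
  have "f s * s / \<theta> \<le> f s * s / 1" using \<theta> fs_nonneg by (intro divide_left_mono) auto
  then show ?thesis using F_le[of s] by simp
qed

text \<open>Since \<open>f\<close> need not be monotone on the negative axis, \<open>f (\<sigma> s) \<sigma> s\<close> is controlled by \<open>f s s\<close> only on
  average over \<open>\<sigma>\<close>.\<close>

lemma average_le_F:
  "(\<integral>\<^sup>+\<sigma>. ennreal (f (\<sigma> * s) * (\<sigma> * s)) * indicator {0..1} \<sigma> \<partial>lborel) \<le> ennreal (F s)"
proof -
  have nn: "0 \<le> f (\<sigma> * s) * s" if "0 \<le> \<sigma>" for \<sigma>
  proof (cases "\<sigma> = 0")
    case False
    have "0 \<le> f (\<sigma> * s) * (\<sigma> * s) / \<sigma>" by (rule divide_nonneg_nonneg[OF fs_nonneg that])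
    then show ?thesis using False by simp
  qed (simp add: f0)
  have "(\<integral>\<^sup>+\<sigma>. ennreal (f (\<sigma> * s) * (\<sigma> * s)) * indicator {0..1} \<sigma> \<partial>lborel)
      \<le> (\<integral>\<^sup>+\<sigma>. ennreal (f (\<sigma> * s) * s) * indicator {0..1} \<sigma> \<partial>lborel)"
  proof (intro nn_integral_mono)
    fix \<sigma> :: real
    have "f (\<sigma> * s) * (\<sigma> * s) \<le> f (\<sigma> * s) * s" if "\<sigma> \<in> {0..1}"
      using mult_left_le_one_le[OF nn, of \<sigma> \<sigma>] that by (simp add: mult_ac)
    then show "ennreal (f (\<sigma> * s) * (\<sigma> * s)) * indicator {0..1} \<sigma> \<le> ennreal (f (\<sigma> * s) * s) * indicator {0..1} \<sigma>"
      by (auto intro: ennreal_leI split: split_indicator)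
  qed
  also have "\<dots> = ennreal (F (1 * s) - F (0 * s))"
  proof (rule nn_integral_FTC_Icc)
    show "((\<lambda>\<sigma>. F (\<sigma> * s)) has_real_derivative f (\<sigma> * s) * s) (at \<sigma>)" for \<sigma>
      by (rule DERIV_chain2[OF F_deriv]) (auto intro!: derivative_eq_intros)
  qed (use nn in auto)
  finally show ?thesis by simp
qed

definition AA :: "(R2 \<Rightarrow> R2) \<Rightarrow> real" where "AA g = (\<integral>x. (norm (g x))\<^sup>2 \<partial>lebesgue)"
definition NN :: "(R2 \<Rightarrow> real) \<Rightarrow> real" where "NN u = (\<integral>x. (u x)\<^sup>2 \<partial>lebesgue)"
definition PP :: "(R2 \<Rightarrow> real) \<Rightarrow> real" where "PP u = (\<integral>x. f (u x) * u x \<partial>lebesgue)"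
definition FF :: "(R2 \<Rightarrow> real) \<Rightarrow> real" where "FF u = (\<integral>x. F (u x) \<partial>lebesgue)"
definition BB :: "(R2 \<Rightarrow> real) \<Rightarrow> real" where "BB u = V0 * NN u - PP u"
definition QQ :: "(R2 \<Rightarrow> real) \<Rightarrow> real" where "QQ u = V0 / 2 * NN u - FF u"

text \<open>The energy of the dilate of \<open>u\<close> that lies on the Nehari manifold.\<close>

definition Psi :: "(R2 \<Rightarrow> real) \<Rightarrow> (R2 \<Rightarrow> R2) \<Rightarrow> real" where
  "Psi u g = AA g / 2 - QQ u * AA g / BB u"

text \<open>Membership in \<open>H1\<close> alone does not provide integrability of
  \<open>f (u) u\<close> here, and without it the splitting and scaling of energies would rest on
  default values of integrals.\<close>

definition adm :: "(R2 \<Rightarrow> real) \<Rightarrow> (R2 \<Rightarrow> R2) \<Rightarrow> bool" where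
  "adm u g \<longleftrightarrow> isgrad u g \<and> integrable lebesgue (\<lambda>x. f (u x) * u x)"

lemma adm_F_integrable:
  assumes "adm u g" shows "integrable lebesgue (\<lambda>x. F (u x))"
proof -
  have u: "isgrad u g" and i: "integrable lebesgue (\<lambda>x. f (u x) * u x)" using assms by (auto simp: adm_def)
  note [measurable] = isgradD(1)[OF u]
  show ?thesis
    by (rule Bochner_Integration.integrable_bound[OF i])
       (use F_nonneg F_le_fs fs_nonneg in \<open>auto simp: abs_of_nonneg\<close>)
qed

lemma Jfun_eq:
  assumes u: "isgrad u g" and nz: "nonzero u"
  shows "Jfun V0 f u = 1/2 * (AA g + V0 * NN u) - FF u" "dJ V0 f u u = AA g + V0 * NN u - PP u"
proof -
  note [measurable] = isgradD(1,3)[OF u] wgrad_measurable[OF u]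
  have i: "integrable lebesgue (\<lambda>x. V0 * (u x)\<^sup>2)" using isgradD(2)[OF u] by simp
  have 1: "(\<integral>x. (norm (wgrad u x))\<^sup>2 + V0 * (u x)\<^sup>2 \<partial>lebesgue) = (\<integral>x. (norm (g x))\<^sup>2 + V0 * (u x)\<^sup>2 \<partial>lebesgue)"
    by (rule integral_cong_AE) (use wgrad_AE[OF u nz] in auto)
  also have 2: "\<dots> = AA g + V0 * NN u" using i isgradD(4)[OF u] by (simp add: AA_def NN_def)
  finally show "Jfun V0 f u = 1/2 * (AA g + V0 * NN u) - FF u" by (simp add: Jfun_def FF_def)
  show "dJ V0 f u u = AA g + V0 * NN u - PP u"
    unfolding dJ_def using 1 2 by (simp add: dot_square_norm PP_def mult.assoc power2_eq_square[symmetric])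
qed

lemma NN_pos:
  assumes u: "isgrad u g" and nz: "nonzero u" shows "NN u > 0"
proof -
  have "NN u \<noteq> 0"
  proof
    assume "NN u = 0"
    then have "AE x in lebesgue. (u x)\<^sup>2 = 0"
      using isgradD(2)[OF u] unfolding NN_def by (subst (asm) integral_nonneg_eq_0_iff_AE) auto
    then show False using nz by (simp add: nonzero_def)
  qed
  moreover have "NN u \<ge> 0" by (simp add: NN_def)
  ultimately show ?thesis by linarith
qed

lemma AA_pos: "isgrad u g \<Longrightarrow> nonzero u \<Longrightarrow> AA g > 0"
  using isgrad_norm_pos by (simp add: AA_def)

text \<open>A non-integrable \<open>f (u) u\<close> would have integral 0, which the Nehari constraint excludes.\<close>

lemma adm_of_constraint:
  assumes u: "isgrad u g" and nz: "nonzero u" and d: "dJ V0 f u u = 0"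
  shows "adm u g" "BB u = - AA g" "BB u < 0" "Jfun V0 f u = Psi u g" "Jfun V0 f u > 0"
proof -
  have e: "AA g + V0 * NN u = PP u" using Jfun_eq(2)[OF u nz] d by simp
  have A: "AA g > 0" and N: "NN u > 0" using AA_pos[OF u nz] NN_pos[OF u nz] .
  have P: "PP u > 0" using e A mult_pos_pos[OF V0 N] by simp
  then have "PP u \<noteq> 0" by simp
  then show adm: "adm u g" using u unfolding adm_def PP_def by (meson not_integrable_integral_eq)
  show B: "BB u = - AA g" using e by (simp add: BB_def)
  then show "BB u < 0" using A by simp
  show "Jfun V0 f u = Psi u g" using A unfolding Jfun_eq(1)[OF u nz] Psi_def B by (simp add: QQ_def)
  have "FF u \<le> (\<integral>x. f (u x) * u x / \<theta> \<partial>lebesgue)"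
    unfolding FF_def using adm adm_F_integrable[OF adm] F_le by (intro integral_mono) (auto simp: adm_def)
  also have "\<dots> = PP u / \<theta>" by (simp add: PP_def)
  also have "\<dots> < PP u / 2" using \<theta> P by (intro divide_strict_left_mono) auto
  finally show "Jfun V0 f u > 0" unfolding Jfun_eq(1)[OF u nz] e by simp
qed

lemma Mset_parts:
  assumes u: "u \<in> Mset V0 f" and g: "isgrad u g"
  defines "gp \<equiv> \<lambda>x. if u x > 0 then g x else 0" and "gm \<equiv> \<lambda>x. if u x < 0 then g x else 0"
  shows "isgrad (pos_part u) gp" "isgrad (neg_part u) gm"
    "Jfun V0 f u = Jfun V0 f (pos_part u) + Jfun V0 f (neg_part u)"
proof -
  show p: "isgrad (pos_part u) gp" and m: "isgrad (neg_part u) gm"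
    unfolding gp_def gm_def by (rule isgrad_pos_part[OF g] isgrad_neg_part[OF g])+
  have nz: "nonzero (pos_part u)" "nonzero (neg_part u)" and
    d: "dJ V0 f (pos_part u) (pos_part u) = 0" "dJ V0 f (neg_part u) (neg_part u) = 0"
    using u by (auto simp: Mset_def)
  have nzu: "nonzero u"
    unfolding nonzero_def
  proof
    assume "AE x in lebesgue. u x = 0"
    then have "AE x in lebesgue. pos_part u x = 0" by eventually_elim (simp add: pos_part_def)
    then show False using nz(1) by (simp add: nonzero_def)
  qed
  \<comment> \<open>The constraints make \<open>F\<close> of both parts integrable; only then may
    \<open>FF u\<close> be split into two integrals.\<close>
  note ap = adm_of_constraint(1)[OF p nz(1) d(1)] and am = adm_of_constraint(1)[OF m nz(2) d(2)]
  note [measurable] = isgradD(1,3)[OF g] isgradD(1,3)[OF p] isgradD(1,3)[OF m]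
  have "AA g = (\<integral>x. (norm (gp x))\<^sup>2 + (norm (gm x))\<^sup>2 \<partial>lebesgue)"
    unfolding AA_def
  proof (rule integral_cong_AE)
    show "AE x in lebesgue. (norm (g x))\<^sup>2 = (norm (gp x))\<^sup>2 + (norm (gm x))\<^sup>2"
      using isgrad_zero_level[OF g] by eventually_elim (auto simp: gp_def gm_def)
  qed measurable
  then have A: "AA g = AA gp + AA gm" using isgradD(4)[OF p] isgradD(4)[OF m] by (simp add: AA_def)
  have "NN u = (\<integral>x. (pos_part u x)\<^sup>2 + (neg_part u x)\<^sup>2 \<partial>lebesgue)"
    unfolding NN_def pos_part_def neg_part_def by (intro Bochner_Integration.integral_cong) (auto simp: max_def min_def)
  then have N: "NN u = NN (pos_part u) + NN (neg_part u)" using isgradD(2)[OF p] isgradD(2)[OF m] by (simp add: NN_def)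
  have "FF u = (\<integral>x. F (pos_part u x) + F (neg_part u x) \<partial>lebesgue)"
    unfolding FF_def pos_part_def neg_part_def by (intro Bochner_Integration.integral_cong) (auto simp: max_def min_def)
  then have Fe: "FF u = FF (pos_part u) + FF (neg_part u)"
    using adm_F_integrable[OF ap] adm_F_integrable[OF am] by (simp add: FF_def)
  show "Jfun V0 f u = Jfun V0 f (pos_part u) + Jfun V0 f (neg_part u)"
    unfolding Jfun_eq(1)[OF g nzu] Jfun_eq(1)[OF p nz(1)] Jfun_eq(1)[OF m nz(2)] A N Fe by (simp add: algebra_simps)
qed

text \<open>An infimum of reals is a lower bound only for sets bounded below; here 0 is a bound,
  because each part has positive energy on the Nehari constraint.\<close>

lemma c_hat_le:
  assumes "u \<in> Mset V0 f" shows "c_hat V0 f \<le> Jfun V0 f u"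
  unfolding c_hat_def
proof (rule cInf_lower)
  show "bdd_below (Jfun V0 f ` Mset V0 f)"
  proof (rule bdd_belowI2)
    fix v assume v: "v \<in> Mset V0 f"
    then obtain g where g: "isgrad v g" by (auto simp: Mset_def H1_iff)
    show "0 \<le> Jfun V0 f v"
      using Mset_parts[OF v g] adm_of_constraint(5)[OF Mset_parts(1)[OF v g]] adm_of_constraint(5)[OF Mset_parts(2)[OF v g]] v
      by (auto simp: Mset_def intro!: add_nonneg_nonneg less_imp_le)
  qed
qed (use assms in auto)

lemma adm_affine:
  fixes a :: R2
  assumes u: "adm u g" and l: "l \<noteq> 0"
  defines "v \<equiv> \<lambda>x. u (a + l *\<^sub>R x)" and "h \<equiv> \<lambda>x. l *\<^sub>R g (a + l *\<^sub>R x)"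
  shows "adm v h" "AA h = AA g" "NN v = NN u / l\<^sup>2" "PP v = PP u / l\<^sup>2" "FF v = FF u / l\<^sup>2"
proof -
  have ug: "isgrad u g" and i: "integrable lebesgue (\<lambda>x. f (u x) * u x)" using u by (auto simp: adm_def)
  note [measurable] = isgradD(1,3)[OF ug]
  show "adm v h" unfolding adm_def v_def h_def
    using isgrad_affine[OF ug l] lebesgue_integral_affine_R2(2)[OF l, of "\<lambda>x. f (u x) * u x" a] i by simp
  show "NN v = NN u / l\<^sup>2" "PP v = PP u / l\<^sup>2" "FF v = FF u / l\<^sup>2"
    unfolding NN_def PP_def FF_def v_def
    using lebesgue_integral_affine_R2(3)[OF l, of "\<lambda>x. (u x)\<^sup>2" a]
      lebesgue_integral_affine_R2(3)[OF l, of "\<lambda>x. f (u x) * u x" a]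
      lebesgue_integral_affine_R2(3)[OF l, of "\<lambda>x. F (u x)" a] by simp_all
  have "AA h = l\<^sup>2 * (\<integral>x. (norm (g (a + l *\<^sub>R x)))\<^sup>2 \<partial>lebesgue)"
    unfolding AA_def h_def by (simp add: power_mult_distrib)
  then show "AA h = AA g"
    using lebesgue_integral_affine_R2(3)[OF l, of "\<lambda>x. (norm (g x))\<^sup>2" a] l by (simp add: AA_def)
qed

lemma nonzero_of_BB: "BB u < 0 \<Longrightarrow> nonzero u"
proof -
  assume B: "BB u < 0"
  show "nonzero u"
    unfolding nonzero_def
  proof
    assume z: "AE x in lebesgue. u x = 0"
    have "NN u = 0" unfolding NN_def by (rule integral_eq_zero_AE) (use z in auto)
    moreover have "PP u = 0" unfolding PP_def by (rule integral_eq_zero_AE) (use z in auto)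
    ultimately show False using B by (simp add: BB_def)
  qed
qed

lemma dilate_to_Nehari:
  assumes u: "adm u g" and B: "BB u < 0" and \<epsilon>: "\<epsilon> = 1 \<or> \<epsilon> = -1"
  obtains l h where "l * \<epsilon> > 0" "isgrad (\<lambda>x. u (a + l *\<^sub>R x)) h" "nonzero (\<lambda>x. u (a + l *\<^sub>R x))"
    "dJ V0 f (\<lambda>x. u (a + l *\<^sub>R x)) (\<lambda>x. u (a + l *\<^sub>R x)) = 0" "Jfun V0 f (\<lambda>x. u (a + l *\<^sub>R x)) = Psi u g"
proof -
  have ug: "isgrad u g" using u by (simp add: adm_def)
  have A: "AA g > 0" by (rule AA_pos[OF ug nonzero_of_BB[OF B]])
  \<comment> \<open>The Nehari equation of the dilate is \<open>AA g + BB u / l\<^sup>2 = 0\<close>,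
    which determines \<open>l\<^sup>2\<close>; the sign \<open>\<epsilon>\<close> chooses between a
    dilation and a dilation combined with a reflection.\<close>
  define l where "l = \<epsilon> * sqrt (- BB u / AA g)"
  have q: "- BB u / AA g > 0" using A B by (intro divide_pos_pos) auto
  have l2: "l\<^sup>2 = - BB u / AA g" using \<epsilon> real_sqrt_pow2[OF less_imp_le[OF q]] by (auto simp: l_def power_mult_distrib)
  have l0: "l \<noteq> 0" using l2 q by auto
  let ?v = "\<lambda>x. u (a + l *\<^sub>R x)" and ?h = "\<lambda>x. l *\<^sub>R g (a + l *\<^sub>R x)"
  note af = adm_affine[OF u l0, of a]
  have vh: "isgrad ?v ?h" using af(1) by (simp add: adm_def)
  have "BB ?v = BB u / l\<^sup>2" unfolding BB_def af by (simp add: diff_divide_distrib)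
  then have Bv: "BB ?v = - AA g" using A B unfolding l2 by (simp add: field_simps)
  then have nz: "nonzero ?v" using A by (intro nonzero_of_BB) simp
  have d: "dJ V0 f ?v ?v = 0" using Bv unfolding Jfun_eq(2)[OF vh nz] af(2) by (simp add: BB_def)
  have "Jfun V0 f ?v = AA g / 2 + QQ u / l\<^sup>2"
    unfolding Jfun_eq(1)[OF vh nz] af QQ_def by (simp add: diff_divide_distrib)
  then have "Jfun V0 f ?v = Psi u g" unfolding l2 Psi_def by simp
  moreover have "l * \<epsilon> > 0" using \<epsilon> q by (auto simp: l_def)
  ultimately show ?thesis using that[OF _ vh nz d] by blast
qed

text \<open>The maps \<open>axis 1 (- R) + l *\<^sub>R x\<close> with \<open>l > 0\<close> and
  \<open>axis 1 (- R') + k *\<^sub>R x\<close> with \<open>k < 0\<close> send the line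
  \<open>x $ 1 = 0\<close> to the boundary lines of the two half-planes. The dilates therefore live
  on opposite sides of that line, and their sum belongs to \<open>Mset V0 f\<close>.\<close>

lemma c_hat_le_half_planes:
  assumes v: "adm v g" "BB v < 0" "\<And>x. v x \<ge> 0" "\<And>x. v x \<noteq> 0 \<Longrightarrow> x $ 1 > - R"
    and m: "adm m h" "BB m < 0" "\<And>x. m x \<le> 0" "\<And>x. m x \<noteq> 0 \<Longrightarrow> x $ 1 > - R'"
  shows "c_hat V0 f \<le> Psi v g + Psi m h"
proof -
  obtain l h1 where 1: "l * 1 > 0" "isgrad (\<lambda>x. v (axis 1 (- R) + l *\<^sub>R x)) h1" "nonzero (\<lambda>x. v (axis 1 (- R) + l *\<^sub>R x))"
    "dJ V0 f (\<lambda>x. v (axis 1 (- R) + l *\<^sub>R x)) (\<lambda>x. v (axis 1 (- R) + l *\<^sub>R x)) = 0" "Jfun V0 f (\<lambda>x. v (axis 1 (- R) + l *\<^sub>R x)) = Psi v g"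
    using dilate_to_Nehari[OF v(1,2), of 1 "axis 1 (- R)"] by blast
  obtain k h2 where 2: "k * (-1) > 0" "isgrad (\<lambda>x. m (axis 1 (- R') + k *\<^sub>R x)) h2" "nonzero (\<lambda>x. m (axis 1 (- R') + k *\<^sub>R x))"
    "dJ V0 f (\<lambda>x. m (axis 1 (- R') + k *\<^sub>R x)) (\<lambda>x. m (axis 1 (- R') + k *\<^sub>R x)) = 0" "Jfun V0 f (\<lambda>x. m (axis 1 (- R') + k *\<^sub>R x)) = Psi m h"
    using dilate_to_Nehari[OF m(1,2), of "-1" "axis 1 (- R')"] by blast
  define v1 where "v1 = (\<lambda>x. v (axis 1 (- R) + l *\<^sub>R x))"
  define m1 where "m1 = (\<lambda>x. m (axis 1 (- R') + k *\<^sub>R x))"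
  define u where "u = (\<lambda>x. v1 x + m1 x)"
  have v1: "x $ 1 > 0" if "v1 x \<noteq> 0" for x
    using v(4)[of "axis 1 (- R) + l *\<^sub>R x"] that 1(1) by (simp add: v1_def axis_def zero_less_mult_iff)
  have m1: "x $ 1 < 0" if "m1 x \<noteq> 0" for x
    using m(4)[of "axis 1 (- R') + k *\<^sub>R x"] that 2(1) by (simp add: m1_def axis_def zero_less_mult_iff)
  have or: "v1 x = 0 \<or> m1 x = 0" for x using v1[of x] m1[of x] by linarith
  have pos: "v1 x \<ge> 0" "m1 x \<le> 0" for x using v(3) m(3) by (auto simp: v1_def m1_def)
  have "max (v1 x + m1 x) 0 = v1 x" "min (v1 x + m1 x) 0 = m1 x" for x
    using or[of x] pos[of x] by auto
  then have p: "pos_part u = v1" and n: "neg_part u = m1"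
    by (simp_all add: pos_part_def neg_part_def u_def)
  have ug: "isgrad u (\<lambda>x. h1 x + h2 x)"
    using isgrad_lincomb[OF 1(2) 2(2), of 1 1] by (simp add: u_def v1_def m1_def)
  have uM: "u \<in> Mset V0 f"
    using ug 1(3,4) 2(3,4) unfolding Mset_def mem_Collect_eq p n H1_iff by (auto simp: v1_def m1_def)
  have "c_hat V0 f \<le> Jfun V0 f u" by (rule c_hat_le[OF uM])
  also have "\<dots> = Psi v g + Psi m h"
    unfolding Mset_parts(3)[OF uM ug] p n using 1(5) 2(5) by (simp add: v1_def m1_def)
  finally show ?thesis .
qed


section \<open>Cutting off with a well-chosen position of the transition strip\<close>

definition strip :: "(R2 \<Rightarrow> real) \<Rightarrow> real \<Rightarrow> R2 \<Rightarrow> real" where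
  "strip v R x = (if - R < x $ 1 \<and> x $ 1 < 1 - R then f (ramp R x * v x) * (ramp R x * v x) else 0)"

lemma strip_nonneg: "strip v R x \<ge> 0"
  using fs_nonneg by (simp add: strip_def)

lemma ramp_pair_borel[measurable]: "(\<lambda>(x, R). ramp R x) \<in> borel_measurable (borel \<Otimes>\<^sub>M borel)"
proof -
  have "continuous_on UNIV (\<lambda>z::R2 \<times> real. ramp (snd z) (fst z))"
    unfolding ramp_def by (intro continuous_intros)
  from borel_measurable_continuous_onI[OF this] show ?thesis
    by (simp add: borel_prod case_prod_beta')
qed

text \<open>For fixed \<open>x\<close> the substitution \<open>\<sigma> = x $ 1 + R\<close> turns
  the average over \<open>R\<close> into that of \<open>average_le_F\<close>. Only points with
  \<open>x $ 1 < 1 - c\<close> meet a strip with \<open>R \<ge> c\<close>, so the bound is a tail of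
  the integral of \<open>F (v)\<close>.\<close>

lemma strip_average:
  fixes v :: "R2 \<Rightarrow> real"
  assumes v[measurable]: "v \<in> borel_measurable borel"
  shows "(\<integral>\<^sup>+R. (\<integral>\<^sup>+x. ennreal (strip v R x) \<partial>lborel) * indicator {c..c + 1} R \<partial>lborel)
     \<le> (\<integral>\<^sup>+x. ennreal (F (v x)) * indicator {x. x $ 1 < 1 - c} x \<partial>lborel)"
proof -
  have m[measurable]: "(\<lambda>(x, R). strip v R x) \<in> borel_measurable (lborel \<Otimes>\<^sub>M lborel)"
    unfolding strip_def by measurable
  have "(\<integral>\<^sup>+R. (\<integral>\<^sup>+x. ennreal (strip v R x) \<partial>lborel) * indicator {c..c + 1} R \<partial>lborel)
      = (\<integral>\<^sup>+R. \<integral>\<^sup>+x. ennreal (strip v R x) * indicator {c..c + 1} R \<partial>lborel \<partial>lborel)"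
    by (subst nn_integral_multc) auto
  also have "\<dots> = (\<integral>\<^sup>+x. \<integral>\<^sup>+R. ennreal (strip v R x) * indicator {c..c + 1} R \<partial>lborel \<partial>lborel)"
    by (rule lborel_pair.Fubini'[symmetric]) measurable
  also have "\<dots> \<le> (\<integral>\<^sup>+x. ennreal (F (v x)) * indicator {x. x $ 1 < 1 - c} x \<partial>lborel)"
  proof (rule nn_integral_mono)
    fix x :: R2
    let ?H = "\<lambda>\<sigma>. ennreal (f (\<sigma> * v x) * (\<sigma> * v x)) * indicator {0..1} \<sigma>"
    have "(\<integral>\<^sup>+R. ennreal (strip v R x) * indicator {c..c + 1} R \<partial>lborel)
       \<le> (\<integral>\<^sup>+R. ?H (x $ 1 + 1 * R) * indicator {x. x $ 1 < 1 - c} x \<partial>lborel)"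
    proof (rule nn_integral_mono)
      fix R :: real
      show "ennreal (strip v R x) * indicator {c..c + 1} R \<le> ?H (x $ 1 + 1 * R) * indicator {x. x $ 1 < 1 - c} x"
        by (auto simp: strip_def ramp_def indicator_def)
    qed
    also have "\<dots> = (\<integral>\<^sup>+R. ?H (x $ 1 + 1 * R) \<partial>lborel) * indicator {x. x $ 1 < 1 - c} x"
      by (rule nn_integral_multc) measurable
    also have "(\<integral>\<^sup>+R. ?H (x $ 1 + 1 * R) \<partial>lborel) = (\<integral>\<^sup>+\<sigma>. ?H \<sigma> \<partial>lborel)"
      using nn_integral_real_affine[of ?H 1 "x $ 1"] by simp
    also have "\<dots> * indicator {x. x $ 1 < 1 - c} x \<le> ennreal (F (v x)) * indicator {x. x $ 1 < 1 - c} x"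
      by (intro mult_right_mono average_le_F) auto
    finally show "(\<integral>\<^sup>+R. ennreal (strip v R x) * indicator {c..c + 1} R \<partial>lborel) \<le> ennreal (F (v x)) * indicator {x. x $ 1 < 1 - c} x" .
  qed
  finally show ?thesis .
qed

text \<open>Some position in [c, c + 1] does not exceed the average by more than a prescribed
  amount, since the interval has length 1.\<close>

lemma choose_strip:
  assumes v: "adm v g"
  obtains R where "c \<le> R" "integrable lebesgue (strip v R)"
    "(\<integral>x. strip v R x \<partial>lebesgue) \<le> (\<integral>x. F (v x) * indicator {x. x $ 1 < 1 - c} x \<partial>lebesgue) + 1 / (\<bar>c\<bar> + 1)"
proof -
  have vg: "isgrad v g" using v by (simp add: adm_def)
  note vm[measurable] = isgradD(1)[OF vg]
  obtain v' where v'[measurable]: "v' \<in> borel_measurable borel" and ae: "AE x in lebesgue. v x = v' x" and ae': "AE x in lborel. v x = v' x"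
    using borel_representative[OF vm] by metis
  note [measurable] = borel_measurable_lebesgueI[OF v']
  have half[measurable]: "{x :: R2. x $ 1 < 1 - c} \<in> sets borel" by measurable
  have half'[measurable]: "{x :: R2. x $ 1 < 1 - c} \<in> sets lebesgue" using half by simp
  define \<epsilon> where "\<epsilon> = (\<integral>x. F (v x) * indicator {x. x $ 1 < 1 - c} x \<partial>lebesgue)"
  \<comment> \<open>This slack makes the comparison with the average strict even if
    \<open>\<epsilon> = 0\<close>, and it tends to 0 as \<open>c\<close> grows.\<close>
  define d where "d = 1 / (\<bar>c\<bar> + 1)"
  have d: "d > 0" by (simp add: d_def add_nonneg_pos)
  have e0: "\<epsilon> \<ge> 0" unfolding \<epsilon>_def using F_nonneg by (intro Bochner_Integration.integral_nonneg) auto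
  have Fi: "integrable lebesgue (\<lambda>x. F (v x) * indicator {x. x $ 1 < 1 - c} x)"
    using integrable_mult_indicator[OF half' adm_F_integrable[OF v]] by (simp add: mult.commute)
  have "ennreal \<epsilon> = (\<integral>\<^sup>+x. ennreal (F (v x) * indicator {x. x $ 1 < 1 - c} x) \<partial>lebesgue)"
    unfolding \<epsilon>_def by (rule nn_integral_eq_integral[symmetric]) (use Fi F_nonneg in auto)
  also have "\<dots> = (\<integral>\<^sup>+x. ennreal (F (v' x)) * indicator {x. x $ 1 < 1 - c} x \<partial>lebesgue)"
    by (rule nn_integral_cong_AE) (use ae in \<open>eventually_elim, auto split: split_indicator\<close>)
  also have "\<dots> = (\<integral>\<^sup>+x. ennreal (F (v' x)) * indicator {x. x $ 1 < 1 - c} x \<partial>lborel)"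
    by (rule nn_integral_completion)
  finally have eps: "(\<integral>\<^sup>+R. (\<integral>\<^sup>+x. ennreal (strip v' R x) \<partial>lborel) * indicator {c..c + 1} R \<partial>lborel) \<le> ennreal \<epsilon>"
    using strip_average[OF v', of c] by simp
  have "\<exists>R\<in>{c..c + 1}. (\<integral>\<^sup>+x. ennreal (strip v' R x) \<partial>lborel) \<le> ennreal (\<epsilon> + d)"
  proof (rule ccontr)
    assume "\<not> ?thesis"
    then have n: "\<And>R. R \<in> {c..c + 1} \<Longrightarrow> ennreal (\<epsilon> + d) \<le> (\<integral>\<^sup>+x. ennreal (strip v' R x) \<partial>lborel)"
      by (meson linear not_le less_imp_le)
    have "ennreal (\<epsilon> + d) = (\<integral>\<^sup>+R. ennreal (\<epsilon> + d) * indicator {c..c + 1} R \<partial>lborel)"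
      by (simp add: nn_integral_cmult_indicator)
    also have "\<dots> \<le> (\<integral>\<^sup>+R. (\<integral>\<^sup>+x. ennreal (strip v' R x) \<partial>lborel) * indicator {c..c + 1} R \<partial>lborel)"
      by (intro nn_integral_mono) (use n in \<open>auto split: split_indicator\<close>)
    also note eps
    finally show False using d e0 by (simp add: ennreal_le_iff)
  qed
  then obtain R where R: "R \<in> {c..c + 1}" "(\<integral>\<^sup>+x. ennreal (strip v' R x) \<partial>lborel) \<le> ennreal (\<epsilon> + d)" by blast
  have [measurable]: "ramp R \<in> borel_measurable lebesgue"
    by (intro borel_measurable_lebesgueI borel_measurable_continuous_onI ramp_continuous)
  have co[measurable]: "(\<lambda>x :: R2. x $ 1) \<in> borel_measurable lebesgue"
    by (intro borel_measurable_lebesgueI) measurable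
  have sm[measurable]: "strip v R \<in> borel_measurable lebesgue"
    unfolding strip_def by measurable
  have "(\<integral>\<^sup>+x. ennreal (strip v R x) \<partial>lebesgue) = (\<integral>\<^sup>+x. ennreal (strip v' R x) \<partial>lebesgue)"
    by (rule nn_integral_cong_AE) (use ae in \<open>eventually_elim, simp add: strip_def\<close>)
  also have "\<dots> = (\<integral>\<^sup>+x. ennreal (strip v' R x) \<partial>lborel)" by (rule nn_integral_completion)
  finally have le: "(\<integral>\<^sup>+x. ennreal (strip v R x) \<partial>lebesgue) \<le> ennreal (\<epsilon> + d)" using R by simp
  have si: "integrable lebesgue (strip v R)"
    using le by (intro integrableI_bounded) (auto simp: strip_nonneg intro: le_less_trans)
  have "ennreal (\<integral>x. strip v R x \<partial>lebesgue) \<le> ennreal (\<epsilon> + d)"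
    using le by (subst nn_integral_eq_integral[symmetric]) (use si strip_nonneg in auto)
  then have "(\<integral>x. strip v R x \<partial>lebesgue) \<le> \<epsilon> + d" using e0 d by (subst (asm) ennreal_le_iff) auto
  then show ?thesis using that[of R] R si by (simp add: \<epsilon>_def d_def)
qed

lemma ramp_decompose:
  "f (ramp R x * v x) * (ramp R x * v x) = f (v x) * v x * indicator {x. 1 - R \<le> x $ 1} x + strip v R x"
  by (auto simp: strip_def ramp_def f0 indicator_def)

lemma ramp_decompose_F_le:
  "\<bar>F (ramp R x * v x) - F (v x) * indicator {x. 1 - R \<le> x $ 1} x\<bar> \<le> strip v R x"
  using F_nonneg[of "ramp R x * v x"] F_le_fs[of "ramp R x * v x"] by (auto simp: strip_def ramp_def indicator_def)

text \<open>Choosing \<open>R n \<ge> real n\<close> by \<open>choose_strip\<close> makes the strip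
  contributions vanish in the limit, as tails of an integrable function plus
  \<open>1 / (n + 1)\<close>. Outside the strips the cut-off is 0 or 1, and dominated convergence
  applies.\<close>

lemma ramp_sequence:
  assumes v: "adm v g"
  obtains R :: "nat \<Rightarrow> real" where
    "\<And>n. adm (\<lambda>x. ramp (R n) x * v x) (\<lambda>x. ramp (R n) x *\<^sub>R g x + v x *\<^sub>R ramp_grad (R n) x)"
    "(\<lambda>n. AA (\<lambda>x. ramp (R n) x *\<^sub>R g x + v x *\<^sub>R ramp_grad (R n) x)) \<longlonglongrightarrow> AA g"
    "(\<lambda>n. BB (\<lambda>x. ramp (R n) x * v x)) \<longlonglongrightarrow> BB v"
    "(\<lambda>n. QQ (\<lambda>x. ramp (R n) x * v x)) \<longlonglongrightarrow> QQ v"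
proof -
  have vg: "isgrad v g" and Pi: "integrable lebesgue (\<lambda>x. f (v x) * v x)" using v by (auto simp: adm_def)
  note Fi = adm_F_integrable[OF v]
  note [measurable] = isgradD(1,3)[OF vg]
  have "\<forall>n::nat. \<exists>R. real n \<le> R \<and> integrable lebesgue (strip v R) \<and>
    (\<integral>x. strip v R x \<partial>lebesgue) \<le> (\<integral>x. F (v x) * indicator {x. x $ 1 < 1 - real n} x \<partial>lebesgue) + 1 / (\<bar>real n\<bar> + 1)"
    by (rule allI, rule choose_strip[OF v]) blast
  from choice[OF this] obtain R where R: "\<And>n. real n \<le> R n" "\<And>n. integrable lebesgue (strip v (R n))"
    "\<And>n. (\<integral>x. strip v (R n) x \<partial>lebesgue) \<le> (\<integral>x. F (v x) * indicator {x. x $ 1 < 1 - real n} x \<partial>lebesgue) + 1 / (\<bar>real n\<bar> + 1)"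
    by blast
  have [measurable]: "ramp (R n) \<in> borel_measurable lebesgue" for n
    by (intro borel_measurable_lebesgueI borel_measurable_continuous_onI ramp_continuous)
  have [measurable]: "ramp_grad (R n) \<in> borel_measurable lebesgue" for n by (simp add: measurable_completion)
  have "{x :: R2. x $ 1 < 1 - a} \<in> sets borel" for a by measurable
  then have h1: "{x :: R2. x $ 1 < 1 - a} \<in> sets lebesgue" for a by simp
  have "{x :: R2. 1 - a \<le> x $ 1} \<in> sets borel" for a by measurable
  then have h2: "{x :: R2. 1 - a \<le> x $ 1} \<in> sets lebesgue" for a by simp
  have Hm: "(\<lambda>x. H (v x) * indicator A x) \<in> borel_measurable lebesgue"
    if "A \<in> sets lebesgue" "H \<in> borel_measurable borel" for A and H :: "real \<Rightarrow> real"
    by (intro borel_measurable_times borel_measurable_indicator that measurable_compose[OF isgradD(1)[OF vg] that(2)])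
  have ev: "\<forall>\<^sub>F n in sequentially. 1 - R n < x $ 1 \<and> 1 - real n < x $ 1" for x :: R2
  proof -
    obtain N :: nat where "1 - x $ 1 < real N" using reals_Archimedean2 by blast
    then have "1 - R n < x $ 1 \<and> 1 - real n < x $ 1" if "n \<ge> N" for n
      using R(1)[of n] that by (smt (verit) of_nat_mono)
    then show ?thesis unfolding eventually_sequentially by blast
  qed
  let ?v = "\<lambda>n x. ramp (R n) x * v x"
  let ?g = "\<lambda>n x. ramp (R n) x *\<^sub>R g x + v x *\<^sub>R ramp_grad (R n) x"
  have Pin: "integrable lebesgue (\<lambda>x. f (v x) * v x * indicator {x. 1 - R n \<le> x $ 1} x)" for n
    using integrable_mult_indicator[OF h2 Pi] by (simp add: mult.commute)
  have Fin: "integrable lebesgue (\<lambda>x. F (v x) * indicator {x. 1 - R n \<le> x $ 1} x)" for n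
    using integrable_mult_indicator[OF h2 Fi] by (simp add: mult.commute)
  have adm: "adm (?v n) (?g n)" for n
    unfolding adm_def ramp_decompose using isgrad_ramp[OF vg] Pin R(2) by simp
  have S: "(\<lambda>n. \<integral>x. strip v (R n) x \<partial>lebesgue) \<longlonglongrightarrow> 0"
  proof (rule tendsto_sandwich[OF _ _ tendsto_const])
    have "(\<lambda>n. \<integral>x. F (v x) * indicator {x. x $ 1 < 1 - real n} x \<partial>lebesgue) \<longlonglongrightarrow> (\<integral>x. 0 \<partial>(lebesgue :: R2 measure))"
    proof (rule integral_dominated_convergence[where w = "\<lambda>x. F (v x)"])
      show "AE x in lebesgue. (\<lambda>n. F (v x) * indicator {x. x $ 1 < 1 - real n} x) \<longlonglongrightarrow> 0"
      proof (rule AE_I2, rule tendsto_eventually)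
        fix x :: R2
        show "\<forall>\<^sub>F n in sequentially. F (v x) * indicator {x. x $ 1 < 1 - real n} x = 0"
          using ev[of x] by eventually_elim simp
      qed
      show "AE x in lebesgue. norm (F (v x) * indicator {x. x $ 1 < 1 - real n} x) \<le> F (v x)" for n
        using F_nonneg by (intro AE_I2) (auto split: split_indicator)
      show "(\<lambda>x. F (v x) * indicator {x. x $ 1 < 1 - real n} x) \<in> borel_measurable lebesgue" for n
        by (rule Hm[OF h1 fF_borel(2)])
    qed (simp_all add: Fi)
    moreover have "(\<lambda>n. 1 / (\<bar>real n\<bar> + 1)) \<longlonglongrightarrow> 0" using tn_lim unfolding tn_def by simp
    ultimately show "(\<lambda>n. (\<integral>x. F (v x) * indicator {x. x $ 1 < 1 - real n} x \<partial>lebesgue) + 1 / (\<bar>real n\<bar> + 1)) \<longlonglongrightarrow> 0"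
      using tendsto_add_zero by fastforce
    show "\<forall>\<^sub>F n in sequentially. 0 \<le> (\<integral>x. strip v (R n) x \<partial>lebesgue)"
      by (intro always_eventually allI Bochner_Integration.integral_nonneg strip_nonneg)
    show "\<forall>\<^sub>F n in sequentially. (\<integral>x. strip v (R n) x \<partial>lebesgue) \<le> (\<integral>x. F (v x) * indicator {x. x $ 1 < 1 - real n} x \<partial>lebesgue) + 1 / (\<bar>real n\<bar> + 1)"
      by (intro always_eventually allI R(3))
  qed
  have N: "(\<lambda>n. NN (?v n)) \<longlonglongrightarrow> NN v"
    unfolding NN_def
  proof (rule integral_dominated_convergence[where w = "\<lambda>x. (v x)\<^sup>2"])
    show "AE x in lebesgue. (\<lambda>n. (?v n x)\<^sup>2) \<longlonglongrightarrow> (v x)\<^sup>2"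
    proof (rule AE_I2, rule tendsto_eventually)
      fix x :: R2
      show "\<forall>\<^sub>F n in sequentially. (?v n x)\<^sup>2 = (v x)\<^sup>2"
        using ev[of x] by eventually_elim (simp add: ramp_def)
    qed
    show "AE x in lebesgue. norm ((?v n x)\<^sup>2) \<le> (v x)\<^sup>2" for n
      using ramp_bounds by (intro AE_I2) (auto simp: power_mult_distrib intro!: mult_left_le_one_le power_le_one)
  qed (use isgradD(2)[OF vg] in auto)
  have A: "(\<lambda>n. AA (?g n)) \<longlonglongrightarrow> AA g"
    unfolding AA_def
  proof (rule integral_dominated_convergence[where w = "\<lambda>x. 2 * (norm (g x))\<^sup>2 + 2 * (v x)\<^sup>2"])
    show "AE x in lebesgue. (\<lambda>n. (norm (?g n x))\<^sup>2) \<longlonglongrightarrow> (norm (g x))\<^sup>2"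
    proof (rule AE_I2, rule tendsto_eventually)
      fix x :: R2
      show "\<forall>\<^sub>F n in sequentially. (norm (?g n x))\<^sup>2 = (norm (g x))\<^sup>2"
        using ev[of x] by eventually_elim (simp add: ramp_def ramp_grad_def)
    qed
    have "(norm (?g n x))\<^sup>2 \<le> 2 * (norm (g x))\<^sup>2 + 2 * (v x)\<^sup>2" for n x
    proof -
      have "(norm (?g n x))\<^sup>2 \<le> 2 * (norm (ramp (R n) x *\<^sub>R g x))\<^sup>2 + 2 * (norm (v x *\<^sub>R ramp_grad (R n) x))\<^sup>2"
        by (rule norm_add_square_le)
      moreover have "(norm (ramp (R n) x *\<^sub>R g x))\<^sup>2 \<le> (norm (g x))\<^sup>2"
        using ramp_bounds[of "R n" x] by (intro power_mono) (auto simp: mult_left_le_one_le)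
      moreover have "(norm (v x *\<^sub>R ramp_grad (R n) x))\<^sup>2 \<le> (\<bar>v x\<bar>)\<^sup>2"
        using norm_cut_grad_le[of "R n" x] by (intro power_mono) (auto simp: mult_left_le)
      ultimately show ?thesis unfolding power2_abs by linarith
    qed
    then show "AE x in lebesgue. norm ((norm (?g n x))\<^sup>2) \<le> 2 * (norm (g x))\<^sup>2 + 2 * (v x)\<^sup>2" for n by simp
  qed (use isgradD(2,4)[OF vg] in auto)
  have dc: "(\<lambda>n. \<integral>x. H (v x) * indicator {x. 1 - R n \<le> x $ 1} x \<partial>lebesgue) \<longlonglongrightarrow> (\<integral>x. H (v x) \<partial>lebesgue)"
    if Hi: "integrable lebesgue (\<lambda>x. H (v x))" and [measurable]: "H \<in> borel_measurable borel" for H :: "real \<Rightarrow> real"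
  proof (rule integral_dominated_convergence[where w = "\<lambda>x. \<bar>H (v x)\<bar>"])
    show "AE x in lebesgue. (\<lambda>n. H (v x) * indicator {x. 1 - R n \<le> x $ 1} x) \<longlonglongrightarrow> H (v x)"
    proof (rule AE_I2, rule tendsto_eventually)
      fix x :: R2
      show "\<forall>\<^sub>F n in sequentially. H (v x) * indicator {x. 1 - R n \<le> x $ 1} x = H (v x)"
        using ev[of x] by eventually_elim simp
    qed
    show "AE x in lebesgue. norm (H (v x) * indicator {x. 1 - R n \<le> x $ 1} x) \<le> \<bar>H (v x)\<bar>" for n
      by (intro AE_I2) (auto split: split_indicator)
    show "(\<lambda>x. H (v x) * indicator {x. 1 - R n \<le> x $ 1} x) \<in> borel_measurable lebesgue" for n
      by (rule Hm[OF h2 that(2)])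
    show "(\<lambda>x. H (v x)) \<in> borel_measurable lebesgue" using Hi by simp
    show "integrable lebesgue (\<lambda>x. \<bar>H (v x)\<bar>)" using Hi by (rule integrable_abs)
  qed
  have P: "(\<lambda>n. PP (?v n)) \<longlonglongrightarrow> PP v"
  proof -
    have "PP (?v n) = (\<integral>x. f (v x) * v x * indicator {x. 1 - R n \<le> x $ 1} x \<partial>lebesgue) + (\<integral>x. strip v (R n) x \<partial>lebesgue)" for n
      unfolding PP_def ramp_decompose using Pin R(2) by simp
    then show ?thesis using tendsto_add[OF dc[of "\<lambda>s. f s * s"] S] Pi by (simp add: PP_def)
  qed
  have FF: "(\<lambda>n. FF (?v n)) \<longlonglongrightarrow> FF v"
  proof -
    have "(\<lambda>n. FF (?v n) - (\<integral>x. F (v x) * indicator {x. 1 - R n \<le> x $ 1} x \<partial>lebesgue)) \<longlonglongrightarrow> 0"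
    proof (rule Lim_null_comparison[OF always_eventually S], rule allI)
      fix n
      have e: "FF (?v n) - (\<integral>x. F (v x) * indicator {x. 1 - R n \<le> x $ 1} x \<partial>lebesgue)
         = (\<integral>x. F (?v n x) - F (v x) * indicator {x. 1 - R n \<le> x $ 1} x \<partial>lebesgue)"
        unfolding FF_def using adm_F_integrable[OF adm[of n]] Fin[of n] by simp
      have "norm (\<integral>x. F (?v n x) - F (v x) * indicator {x. 1 - R n \<le> x $ 1} x \<partial>lebesgue) \<le> (\<integral>x. norm (F (?v n x) - F (v x) * indicator {x. 1 - R n \<le> x $ 1} x) \<partial>lebesgue)"
        by (rule integral_norm_bound)
      also have "\<dots> \<le> (\<integral>x. strip v (R n) x \<partial>lebesgue)"
        using adm_F_integrable[OF adm[of n]] Fin[of n] R(2)[of n] ramp_decompose_F_le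
        by (intro integral_mono) auto
      finally show "norm (FF (?v n) - (\<integral>x. F (v x) * indicator {x. 1 - R n \<le> x $ 1} x \<partial>lebesgue)) \<le> (\<integral>x. strip v (R n) x \<partial>lebesgue)"
        unfolding e .
    qed
    from tendsto_add[OF this dc[OF Fi]] show ?thesis by (simp add: FF_def)
  qed
  show ?thesis
  proof (rule that[OF adm A])
    show "(\<lambda>n. BB (?v n)) \<longlonglongrightarrow> BB v" unfolding BB_def by (intro tendsto_intros N P)
    show "(\<lambda>n. QQ (?v n)) \<longlonglongrightarrow> QQ v" unfolding QQ_def by (intro tendsto_intros N FF)
  qed
qed

lemma Psi_tendsto:
  assumes "(\<lambda>n. AA (G n)) \<longlonglongrightarrow> AA g" "(\<lambda>n. BB (V n)) \<longlonglongrightarrow> BB v" "(\<lambda>n. QQ (V n)) \<longlonglongrightarrow> QQ v" "BB v < 0"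
  shows "(\<lambda>n. Psi (V n) (G n)) \<longlonglongrightarrow> Psi v g"
  unfolding Psi_def by (intro tendsto_intros assms) (use assms(4) in auto)

text \<open>The inequality for half-planes applies to the cut-offs as soon as both values of
  \<open>BB\<close> have become negative, and it passes to the limit because \<open>Psi\<close> is a
  continuous expression in \<open>AA\<close>, \<open>BB\<close> and \<open>QQ\<close> there.\<close>

lemma Psi_sum_ge:
  assumes v: "adm v g" "BB v < 0" "\<And>x. v x \<ge> 0" and m: "adm m h" "BB m < 0" "\<And>x. m x \<le> 0"
  shows "c_hat V0 f \<le> Psi v g + Psi m h"
proof -
  obtain R where R: "\<And>n. adm (\<lambda>x. ramp (R n) x * v x) (\<lambda>x. ramp (R n) x *\<^sub>R g x + v x *\<^sub>R ramp_grad (R n) x)"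
    "(\<lambda>n. AA (\<lambda>x. ramp (R n) x *\<^sub>R g x + v x *\<^sub>R ramp_grad (R n) x)) \<longlonglongrightarrow> AA g"
    "(\<lambda>n. BB (\<lambda>x. ramp (R n) x * v x)) \<longlonglongrightarrow> BB v"
    "(\<lambda>n. QQ (\<lambda>x. ramp (R n) x * v x)) \<longlonglongrightarrow> QQ v"
    using ramp_sequence[OF v(1)] by blast
  obtain S where S: "\<And>n. adm (\<lambda>x. ramp (S n) x * m x) (\<lambda>x. ramp (S n) x *\<^sub>R h x + m x *\<^sub>R ramp_grad (S n) x)"
    "(\<lambda>n. AA (\<lambda>x. ramp (S n) x *\<^sub>R h x + m x *\<^sub>R ramp_grad (S n) x)) \<longlonglongrightarrow> AA h"
    "(\<lambda>n. BB (\<lambda>x. ramp (S n) x * m x)) \<longlonglongrightarrow> BB m"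
    "(\<lambda>n. QQ (\<lambda>x. ramp (S n) x * m x)) \<longlonglongrightarrow> QQ m"
    using ramp_sequence[OF m(1)] by blast
  have sup: "x $ 1 > - r" if "ramp r x * q \<noteq> 0" for r x and q :: real
    using that by (auto simp: ramp_def max_def min_def split: if_splits)
  have "\<forall>\<^sub>F n in sequentially. c_hat V0 f \<le> Psi (\<lambda>x. ramp (R n) x * v x) (\<lambda>x. ramp (R n) x *\<^sub>R g x + v x *\<^sub>R ramp_grad (R n) x)
      + Psi (\<lambda>x. ramp (S n) x * m x) (\<lambda>x. ramp (S n) x *\<^sub>R h x + m x *\<^sub>R ramp_grad (S n) x)"
    using order_tendstoD(2)[OF R(3) v(2)] order_tendstoD(2)[OF S(3) m(2)]
  proof eventually_elim
    case (elim n)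
    show ?case
      by (rule c_hat_le_half_planes[OF R(1) elim(1) _ _ S(1) elim(2), where R = "R n" and R' = "S n"])
         (use v(3) m(3) ramp_bounds sup in \<open>auto simp: mult_nonneg_nonpos\<close>)
  qed
  then show ?thesis
    by (rule tendsto_lowerbound[OF tendsto_add[OF Psi_tendsto[OF R(2-4) v(2)] Psi_tendsto[OF S(2-4) m(2)]]]) simp
qed

end

subsection \<open>The variational inequality satisfied by a minimizer\<close>

text \<open>The interval [0, 2] contains all values of \<open>w + e \<zeta>\<close> where the
  perturbation acts, since there \<open>w < 1\<close> and \<open>e \<zeta> \<le> 1\<close>.\<close>

locale nehari_lipschitz = nehari +
  fixes C :: real
  assumes C0: "C \<ge> 0" and lip: "\<And>a b. 0 \<le> b \<Longrightarrow> b \<le> a \<Longrightarrow> a \<le> 2 \<Longrightarrow> \<bar>f a - f b\<bar> \<le> C * (a - b)"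
begin

lemma f_le: "0 \<le> a \<Longrightarrow> a \<le> 2 \<Longrightarrow> \<bar>f a\<bar> \<le> C * a"
  using lip[of 0 a] f0 by simp

text \<open>The extra factor \<open>a\<close> comes from \<open>f 0 = 0\<close> and is essential: it
  produces errors of the size of the integral of \<open>w \<zeta>\<close>. The integral of
  \<open>\<zeta>\<close> itself would have no evident bound independent of \<open>d\<close> for the
  test functions used below.\<close>

lemma fs_diff_le:
  assumes "0 \<le> b" "b \<le> a" "a \<le> 2"
  shows "\<bar>f a * a - f b * b\<bar> \<le> 2 * C * (a * (a - b))"
proof -
  have "f a * a - f b * b = f a * (a - b) + b * (f a - f b)" by (simp add: algebra_simps)
  also have "\<bar>\<dots>\<bar> \<le> \<bar>f a\<bar> * (a - b) + b * \<bar>f a - f b\<bar>"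
    using assms abs_triangle_ineq[of "f a * (a - b)" "b * (f a - f b)"] by (simp add: abs_mult)
  also have "\<dots> \<le> (C * a) * (a - b) + a * (C * (a - b))"
    using assms f_le[of a] lip[of b a] by (intro add_mono mult_mono) auto
  finally show ?thesis by (simp add: mult_ac)
qed

lemma F_diff_le:
  assumes "0 \<le> b" "b \<le> a" "a \<le> 2"
  shows "\<bar>F a - F b\<bar> \<le> C * (a * (a - b))"
proof (cases "b = a")
  case False
  then have "b < a" using assms by simp
  from MVT2[OF this F_deriv] obtain z where z: "b < z" "z < a" "F a - F b = (a - b) * f z" by auto
  have "\<bar>f z\<bar> \<le> C * z" using z assms by (intro f_le) auto
  also have "\<dots> \<le> C * a" using z C0 by (intro mult_left_mono) auto
  finally have "(a - b) * \<bar>f z\<bar> \<le> (a - b) * (C * a)" using assms by (intro mult_left_mono) auto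
  then show ?thesis using assms by (simp add: z(3) abs_mult mult_ac)
qed simp

text \<open>Lipschitz bounds take the place of derivatives of \<open>BB\<close> and
  \<open>QQ\<close>; an unspecified constant in front of the integral of \<open>w \<zeta>\<close> is
  all that the supersolution property has to provide. Only \<open>AA\<close> is expanded
  exactly.\<close>

lemma perturbation:
  assumes w: "adm w g" "\<And>x. w x \<ge> 0" and z: "isgrad \<zeta> k" "\<And>x. \<zeta> x \<ge> 0" "\<And>x. w x \<ge> 1 \<Longrightarrow> \<zeta> x = 0"
    and e: "e > 0" "\<And>x. e * \<zeta> x \<le> 1"
  defines "X \<equiv> (\<integral>x. w x * \<zeta> x \<partial>lebesgue) + e * NN \<zeta>"
  shows "adm (\<lambda>x. w x + e * \<zeta> x) (\<lambda>x. g x + e *\<^sub>R k x)"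
    "\<bar>BB (\<lambda>x. w x + e * \<zeta> x) - BB w\<bar> \<le> (2 * V0 + 2 * C) * (e * X)"
    "\<bar>QQ (\<lambda>x. w x + e * \<zeta> x) - QQ w\<bar> \<le> (V0 + C) * (e * X)"
    "AA (\<lambda>x. g x + e *\<^sub>R k x) = AA g + e * (2 * (\<integral>x. g x \<bullet> k x \<partial>lebesgue) + e * AA k)"
proof -
  let ?v = "\<lambda>x. w x + e * \<zeta> x"
  have wg: "isgrad w g" and Pw: "integrable lebesgue (\<lambda>x. f (w x) * w x)" using w by (auto simp: adm_def)
  note [measurable] = isgradD(1,3)[OF wg] isgradD(1,3)[OF z(1)]
  have vg: "isgrad ?v (\<lambda>x. g x + e *\<^sub>R k x)" using isgrad_lincomb[OF wg z(1), of 1 e] by simp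
  note [measurable] = isgradD(1,3)[OF vg]
  have wz: "integrable lebesgue (\<lambda>x. w x * \<zeta> x)" by (intro L2_mult isgradD[OF wg] isgradD[OF z(1)])
  have zz: "integrable lebesgue (\<lambda>x. (\<zeta> x)\<^sup>2)" by (rule isgradD[OF z(1)])
  \<comment> \<open>This is \<open>v (v - w)\<close> for \<open>v = w + e \<zeta>\<close>, the
    majorant delivered by \<open>fs_diff_le\<close> and \<open>F_diff_le\<close>.\<close>
  define Y where "Y x = e * (w x * \<zeta> x + e * (\<zeta> x)\<^sup>2)" for x
  have Yi: "integrable lebesgue Y" unfolding Y_def using wz zz by simp
  have YX: "(\<integral>x. Y x \<partial>lebesgue) = e * X" unfolding Y_def X_def NN_def using wz zz by simp
  have Ye: "?v x * (?v x - w x) = Y x" for x by (simp add: Y_def power2_eq_square algebra_simps)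
  have d1: "\<bar>f (?v x) * ?v x - f (w x) * w x\<bar> \<le> 2 * C * Y x" and d2: "\<bar>F (?v x) - F (w x)\<bar> \<le> C * Y x" for x
  proof -
    show "\<bar>f (?v x) * ?v x - f (w x) * w x\<bar> \<le> 2 * C * Y x"
    proof (cases "w x \<ge> 1")
      case False
      then show ?thesis using fs_diff_le[of "w x" "?v x"] w(2)[of x] z(2)[of x] e e(2)[of x] unfolding Ye by simp
    qed (use z(3) in \<open>simp add: Y_def\<close>)
    show "\<bar>F (?v x) - F (w x)\<bar> \<le> C * Y x"
    proof (cases "w x \<ge> 1")
      case False
      then show ?thesis using F_diff_le[of "w x" "?v x"] w(2)[of x] z(2)[of x] e e(2)[of x] unfolding Ye by simp
    qed (use z(3) in \<open>simp add: Y_def\<close>)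
  qed
  have "integrable lebesgue (\<lambda>x. f (?v x) * ?v x - f (w x) * w x)"
  proof (rule Bochner_Integration.integrable_bound)
    show "integrable lebesgue (\<lambda>x. 2 * C * Y x)" using Yi by simp
    show "AE x in lebesgue. norm (f (?v x) * ?v x - f (w x) * w x) \<le> norm (2 * C * Y x)"
      using d1 by (intro AE_I2) (metis abs_ge_self order_trans real_norm_def)
  qed measurable
  from Bochner_Integration.integrable_add[OF this Pw] have Pv: "integrable lebesgue (\<lambda>x. f (?v x) * ?v x)" by simp
  show adm: "adm ?v (\<lambda>x. g x + e *\<^sub>R k x)" unfolding adm_def using vg Pv by simp
  note Fv = adm_F_integrable[OF adm] and Fw = adm_F_integrable[OF w(1)]
  have "\<bar>PP ?v - PP w\<bar> = \<bar>\<integral>x. f (?v x) * ?v x - f (w x) * w x \<partial>lebesgue\<bar>" unfolding PP_def using Pv Pw by simp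
  also have "\<dots> \<le> (\<integral>x. \<bar>f (?v x) * ?v x - f (w x) * w x\<bar> \<partial>lebesgue)" by (rule integral_abs_bound)
  also have "\<dots> \<le> (\<integral>x. 2 * C * Y x \<partial>lebesgue)"
    using Pv Pw Yi d1 by (intro integral_mono) auto
  finally have P: "\<bar>PP ?v - PP w\<bar> \<le> 2 * C * (e * X)" by (simp add: YX)
  have "\<bar>FF ?v - FF w\<bar> = \<bar>\<integral>x. F (?v x) - F (w x) \<partial>lebesgue\<bar>" unfolding FF_def using Fv Fw by simp
  also have "\<dots> \<le> (\<integral>x. \<bar>F (?v x) - F (w x)\<bar> \<partial>lebesgue)" by (rule integral_abs_bound)
  also have "\<dots> \<le> (\<integral>x. C * Y x \<partial>lebesgue)"
    using Fv Fw Yi d2 by (intro integral_mono) auto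
  finally have Fd: "\<bar>FF ?v - FF w\<bar> \<le> C * (e * X)" by (simp add: YX)
  have "NN ?v - NN w = (\<integral>x. (?v x)\<^sup>2 - (w x)\<^sup>2 \<partial>lebesgue)" unfolding NN_def using isgradD(2)[OF vg] isgradD(2)[OF wg] by simp
  also have "\<dots> = (\<integral>x. 2 * e * (w x * \<zeta> x) + e * e * (\<zeta> x)\<^sup>2 \<partial>lebesgue)"
    by (intro Bochner_Integration.integral_cong) (auto simp: power2_eq_square algebra_simps)
  also have "\<dots> = 2 * e * (\<integral>x. w x * \<zeta> x \<partial>lebesgue) + e * e * NN \<zeta>" using wz zz by (simp add: NN_def)
  finally have Ne: "NN ?v - NN w = 2 * e * (\<integral>x. w x * \<zeta> x \<partial>lebesgue) + e * e * NN \<zeta>" .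
  have i0: "(\<integral>x. w x * \<zeta> x \<partial>lebesgue) \<ge> 0" using w(2) z(2) by (intro Bochner_Integration.integral_nonneg) auto
  have N0: "NN \<zeta> \<ge> 0" by (simp add: NN_def)
  have Na: "\<bar>NN ?v - NN w\<bar> \<le> 2 * (e * X)"
  proof -
    have "e * e * NN \<zeta> \<ge> 0" using e N0 by simp
    moreover have "e * (\<integral>x. w x * \<zeta> x \<partial>lebesgue) \<ge> 0" using e i0 by simp
    ultimately show ?thesis unfolding Ne X_def by (simp add: algebra_simps)
  qed
  have VN: "\<bar>V0 * (NN ?v - NN w)\<bar> \<le> V0 * (2 * (e * X))"
    unfolding abs_mult using V0 Na by (intro mult_mono) auto
  show "\<bar>BB ?v - BB w\<bar> \<le> (2 * V0 + 2 * C) * (e * X)"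
    using VN P unfolding BB_def by (simp add: algebra_simps abs_le_iff)
  show "\<bar>QQ ?v - QQ w\<bar> \<le> (V0 + C) * (e * X)"
    using VN Fd unfolding QQ_def by (simp add: algebra_simps abs_le_iff)
  have gk: "integrable lebesgue (\<lambda>x. g x \<bullet> k x)" by (intro L2_inner isgradD[OF wg] isgradD[OF z(1)])
  have "AA (\<lambda>x. g x + e *\<^sub>R k x) = (\<integral>x. (norm (g x))\<^sup>2 + (2 * e) * (g x \<bullet> k x) + e\<^sup>2 * (norm (k x))\<^sup>2 \<partial>lebesgue)"
    unfolding AA_def power2_norm_eq_inner
    by (intro Bochner_Integration.integral_cong)
       (auto simp: inner_add_left inner_add_right inner_commute[of "k _" "g _"] power2_eq_square algebra_simps)
  also have "\<dots> = AA g + (2 * e) * (\<integral>x. g x \<bullet> k x \<partial>lebesgue) + e\<^sup>2 * AA k"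
    using gk isgradD(4)[OF wg] isgradD(4)[OF z(1)] by (simp add: AA_def)
  finally show "AA (\<lambda>x. g x + e *\<^sub>R k x) = AA g + e * (2 * (\<integral>x. g x \<bullet> k x \<partial>lebesgue) + e * AA k)"
    by (simp add: power2_eq_square algebra_simps)
qed

text \<open>The numerator propagates the Lipschitz constants of \<open>BB\<close> and
  \<open>QQ\<close> through the quotient \<open>QQ / BB\<close>; the last divisor is the coefficient
  of the integral of \<open>g x \<bullet> k x\<close> in the variation of
  \<open>Psi\<close>.\<close>

definition var_const :: "(R2 \<Rightarrow> real) \<Rightarrow> (R2 \<Rightarrow> R2) \<Rightarrow> real" where
  "var_const w g = AA g * ((V0 + C) * \<bar>BB w\<bar> + \<bar>QQ w\<bar> * (2 * V0 + 2 * C)) / (BB w)\<^sup>2 / (2 * (1/2 - QQ w / BB w))"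

text \<open>A minimizer of \<open>Psi\<close> is a supersolution where it is less than 1. The factor \<open>1/2 - QQ w / BB w\<close> is the quotient of
  the energy and the Dirichlet integral, hence positive; so the Lagrange multiplier of the Nehari constraint
  need not be identified.\<close>

lemma variational_inequality:
  assumes w: "adm w g" "\<And>x. w x \<ge> 0" "BB w < 0" "Psi w g > 0"
    and min: "\<And>v h. adm v h \<Longrightarrow> (\<And>x. v x \<ge> 0) \<Longrightarrow> BB v < 0 \<Longrightarrow> Psi w g \<le> Psi v h"
    and z: "isgrad \<zeta> k" "\<And>x. \<zeta> x \<ge> 0" "\<And>x. w x \<ge> 1 \<Longrightarrow> \<zeta> x = 0" "\<And>x. \<zeta> x \<le> M"
  shows "- var_const w g * (\<integral>x. w x * \<zeta> x \<partial>lebesgue) \<le> (\<integral>x. g x \<bullet> k x \<partial>lebesgue)"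
proof -
  have wg: "isgrad w g" using w by (simp add: adm_def)
  have A: "AA g > 0" by (rule AA_pos[OF wg nonzero_of_BB[OF w(3)]])
  have Psi_w: "Psi w g = AA g * (1/2 - QQ w / BB w)" by (simp add: Psi_def algebra_simps)
  then have q: "1/2 - QQ w / BB w > 0" using w(4) A by (simp add: zero_less_mult_iff)
  define I where "I = (\<integral>x. g x \<bullet> k x \<partial>lebesgue)"
  define X0 where "X0 = (\<integral>x. w x * \<zeta> x \<partial>lebesgue)"
  define K where "K = (V0 + C) * \<bar>BB w\<bar> + \<bar>QQ w\<bar> * (2 * V0 + 2 * C)"
  define M1 where "M1 = max M 1"
  \<comment> \<open>Dividing by \<open>M1\<close> ensures \<open>e n * \<zeta> x \<le> 1\<close>;
    taking the maximum with 1 keeps the divisor positive whatever \<open>M\<close> is.\<close>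
  define e where "e n = tn n / M1" for n
  have M1: "M1 \<ge> 1" by (simp add: M1_def)
  have e0: "e n > 0" for n using tn_pos[of n] M1 by (simp add: e_def)
  have e1: "e n * \<zeta> x \<le> 1" for n x
  proof -
    have "\<zeta> x \<le> M1" using z(4)[of x] by (simp add: M1_def)
    then have "tn n * \<zeta> x \<le> 1 * M1" using tn_le_1[of n] tn_pos[of n] z(2)[of x] by (intro mult_mono) auto
    then show ?thesis using M1 by (simp add: e_def divide_le_eq)
  qed
  have el: "e \<longlonglongrightarrow> 0" using tendsto_divide[OF tn_lim tendsto_const, of M1] M1 by (simp add: e_def[abs_def])
  define X where "X n = X0 + e n * NN \<zeta>" for n
  define b where "b n = BB (\<lambda>x. w x + e n * \<zeta> x)" for n
  define qn where "qn n = QQ (\<lambda>x. w x + e n * \<zeta> x)" for n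
  note pt = perturbation[OF w(1,2) z(1-3) e0 e1, folded I_def X0_def, folded X_def b_def qn_def]
  have Xl: "X \<longlonglongrightarrow> X0"
  proof -
    have "X \<longlonglongrightarrow> X0 + 0 * NN \<zeta>" unfolding X_def[abs_def] by (intro tendsto_intros el)
    then show ?thesis by simp
  qed
  have eX: "(\<lambda>n. c * (e n * X n)) \<longlonglongrightarrow> 0" for c
  proof -
    have "(\<lambda>n. c * (e n * X n)) \<longlonglongrightarrow> c * (0 * X0)" by (intro tendsto_intros el Xl)
    then show ?thesis by simp
  qed
  have bl: "b \<longlonglongrightarrow> BB w"
    using Lim_null_comparison[OF always_eventually eX, of "\<lambda>n. b n - BB w" "2 * V0 + 2 * C"] pt(2)
    by (simp add: LIM_zero_iff)
  have ql: "qn \<longlonglongrightarrow> QQ w"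
    using Lim_null_comparison[OF always_eventually eX, of "\<lambda>n. qn n - QQ w" "V0 + C"] pt(3)
    by (simp add: LIM_zero_iff)
  \<comment> \<open>An upper bound for the difference quotient of \<open>Psi\<close> at
    \<open>w\<close> with step \<open>e n\<close> in direction \<open>\<zeta>\<close>; minimality
    makes it nonnegative, and its limit is the claim.\<close>
  let ?r = "\<lambda>n. (2 * I + e n * AA k) * (1/2 - qn n / b n) + AA g * (X n * K / (\<bar>b n\<bar> * \<bar>BB w\<bar>))"
  have "?r \<longlonglongrightarrow> (2 * I + 0 * AA k) * (1/2 - QQ w / BB w) + AA g * (X0 * K / (\<bar>BB w\<bar> * \<bar>BB w\<bar>))"
    by (intro tendsto_intros el ql bl Xl) (use w(3) in auto)
  moreover have "\<forall>\<^sub>F n in sequentially. 0 \<le> ?r n"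
    using order_tendstoD(2)[OF bl w(3)]
  proof eventually_elim
    case (elim n)
    let ?v = "\<lambda>x. w x + e n * \<zeta> x" and ?h = "\<lambda>x. g x + e n *\<^sub>R k x"
    have "Psi w g \<le> Psi ?v ?h"
      by (rule min[OF pt(1)]) (use w(2) z(2) e0[of n] elim in \<open>auto simp: b_def\<close>)
    also have "Psi ?v ?h = AA ?h * (1/2 - qn n / b n)" by (simp add: Psi_def b_def qn_def algebra_simps)
    also have "\<dots> = (AA g + e n * (2 * I + e n * AA k)) * (1/2 - qn n / b n)" by (simp only: pt(4))
    finally have "0 \<le> (AA g + e n * (2 * I + e n * AA k)) * (1/2 - qn n / b n) - AA g * (1/2 - QQ w / BB w)"
      by (simp add: Psi_w)
    also have "\<dots> = e n * ((2 * I + e n * AA k) * (1/2 - qn n / b n)) + AA g * (QQ w / BB w - qn n / b n)"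
      by (simp add: algebra_simps)
    also have "QQ w / BB w - qn n / b n = (QQ w * (b n - BB w) - (qn n - QQ w) * BB w) / (b n * BB w)"
      using elim w(3) by (simp add: field_simps)
    also have "\<dots> \<le> \<bar>QQ w * (b n - BB w) - (qn n - QQ w) * BB w\<bar> / (\<bar>b n\<bar> * \<bar>BB w\<bar>)"
      by (metis abs_divide abs_ge_self abs_mult)
    also have "\<dots> \<le> (e n * (X n * K)) / (\<bar>b n\<bar> * \<bar>BB w\<bar>)"
    proof (rule divide_right_mono)
      have "\<bar>QQ w * (b n - BB w) - (qn n - QQ w) * BB w\<bar> \<le> \<bar>QQ w\<bar> * \<bar>b n - BB w\<bar> + \<bar>qn n - QQ w\<bar> * \<bar>BB w\<bar>"
        unfolding abs_mult[symmetric] by (rule abs_triangle_ineq4)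
      also have "\<dots> \<le> \<bar>QQ w\<bar> * ((2 * V0 + 2 * C) * (e n * X n)) + ((V0 + C) * (e n * X n)) * \<bar>BB w\<bar>"
        by (intro add_mono mult_left_mono mult_right_mono pt) auto
      finally show "\<bar>QQ w * (b n - BB w) - (qn n - QQ w) * BB w\<bar> \<le> e n * (X n * K)"
        by (simp add: K_def algebra_simps)
    qed simp
    finally have "0 \<le> e n * ((2 * I + e n * AA k) * (1/2 - qn n / b n)) + AA g * ((e n * (X n * K)) / (\<bar>b n\<bar> * \<bar>BB w\<bar>))"
      using A by (simp add: mult_left_mono)
    also have "\<dots> = e n * ?r n" by (simp add: algebra_simps)
    finally show ?case using e0[of n] by (simp add: zero_le_mult_iff)
  qed
  ultimately have "0 \<le> (2 * I + 0 * AA k) * (1/2 - QQ w / BB w) + AA g * (X0 * K / (\<bar>BB w\<bar> * \<bar>BB w\<bar>))"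
    by (intro tendsto_lowerbound) auto
  moreover have "\<bar>BB w\<bar> * \<bar>BB w\<bar> = (BB w)\<^sup>2" by (simp add: power2_eq_square)
  ultimately have *: "0 \<le> I * (2 * (1/2 - QQ w / BB w)) + AA g * K / (BB w)\<^sup>2 * X0" by (simp add: mult_ac)
  define t where "t = 2 * (1/2 - QQ w / BB w)"
  have t: "t > 0" unfolding t_def by (rule mult_pos_pos[OF _ q]) simp
  have "var_const w g = AA g * K / (BB w)\<^sup>2 / t" by (simp add: var_const_def K_def t_def)
  then have tc: "AA g * K / (BB w)\<^sup>2 = var_const w g * t" using t by simp
  from * have "0 \<le> I * t + var_const w g * t * X0" unfolding tc t_def .
  then have "0 \<le> (I + var_const w g * X0) * t" by (simp add: algebra_simps)
  then have "0 \<le> I + var_const w g * X0" using t by (simp add: zero_le_mult_iff)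
  then show ?thesis by (simp add: I_def X0_def)
qed

end

subsection \<open>The logarithmic estimate\<close>

text \<open>The square makes the truncation continuously differentiable at 1, as the chain rule
  demands.\<close>

lemma max_square_derivative: "((\<lambda>s::real. (max 0 (1 - s))\<^sup>2) has_real_derivative - 2 * max 0 (1 - s)) (at s)"
proof (cases s "1 :: real" rule: linorder_cases)
  case less
  have "((\<lambda>s::real. (1 - s)\<^sup>2) has_real_derivative - 2 * (1 - s)) (at s)"
    by (auto intro!: derivative_eq_intros)
  then have "((\<lambda>s::real. (max 0 (1 - s))\<^sup>2) has_real_derivative - 2 * (1 - s)) (at s)"
    by (rule has_field_derivative_transform_within_open[where S = "{..<1}"]) (use less in auto)
  then show ?thesis using less by simp
next
  case equal
  have "((\<lambda>h::real. ((max 0 (1 - (1 + h)))\<^sup>2 - (max 0 (1 - 1))\<^sup>2) / h) \<longlongrightarrow> 0) (at 0)"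
  proof (rule Lim_null_comparison)
    have "\<bar>(max 0 (- h))\<^sup>2 / h\<bar> \<le> \<bar>h\<bar>" for h :: real
      by (cases "h = 0") (auto simp: max_def power2_eq_square abs_mult)
    then show "\<forall>\<^sub>F h::real in at 0. norm (((max 0 (1 - (1 + h)))\<^sup>2 - (max 0 (1 - 1))\<^sup>2) / h) \<le> \<bar>h\<bar>"
      by (intro always_eventually) simp
    show "((\<lambda>h::real. \<bar>h\<bar>) \<longlongrightarrow> 0) (at 0)" by (rule tendsto_rabs_zero) simp
  qed
  then show ?thesis using equal by (simp add: DERIV_def)
next
  case greater
  have "((\<lambda>s::real. 0) has_real_derivative 0) (at s)" by simp
  then have "((\<lambda>s::real. (max 0 (1 - s))\<^sup>2) has_real_derivative 0) (at s)"
    by (rule has_field_derivative_transform_within_open[where S = "{1<..}"]) (use greater in auto)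
  then show ?thesis using greater by simp
qed

definition Sf :: "real \<Rightarrow> real \<Rightarrow> real" where "Sf d s = (max 0 (1 - s))\<^sup>2 / (s + d)"

definition Sf' :: "real \<Rightarrow> real \<Rightarrow> real" where
  "Sf' d s = (- 2 * max 0 (1 - s) * (s + d) - (max 0 (1 - s))\<^sup>2) / (s + d)\<^sup>2"

text \<open>Chosen so that \<open>Sf' d s \<le> - (zf d s)\<^sup>2\<close> for
  \<open>s \<ge> 0\<close>. The \<open>max 0 s\<close> in the denominator keeps the function
  continuous on the whole line, so that its primitive is covered by \<open>Fprim\<close>.\<close>

definition zf :: "real \<Rightarrow> real \<Rightarrow> real" where "zf d s = max 0 (1 - s) / (max 0 s + d)"

text \<open>A truncated logarithm: for \<open>s\<close> in [0, 1] it is the integral of (1 - t)/(t +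
  d) from 0 to \<open>s\<close>.\<close>

definition Zf :: "real \<Rightarrow> real \<Rightarrow> real" where "Zf d = Fprim (zf d)"

context fixes d :: real assumes d: "d > 0"
begin

lemma Sf_derivative:
  assumes "s \<ge> 0" shows "(Sf d has_real_derivative Sf' d s) (at s within {0..})"
proof -
  have "((\<lambda>s. (max 0 (1 - s))\<^sup>2 / (s + d)) has_real_derivative Sf' d s) (at s)"
    unfolding Sf'_def
    by (rule derivative_eq_intros max_square_derivative refl | use assms d in \<open>simp add: power2_eq_square\<close>)+
  then show ?thesis unfolding Sf_def[abs_def] by (rule DERIV_subset) simp
qed

lemma Sf'_continuous: "continuous_on {0..} (Sf' d)"
  unfolding Sf'_def using d by (intro continuous_intros) (auto simp: add_nonneg_eq_0_iff)

text \<open>The bounds free of \<open>d\<close> carry the logarithmic estimate; those containing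
  \<open>1 / d\<close> only make the test function admissible.\<close>

lemma Sf_bounds:
  assumes "s \<ge> 0"
  shows "0 \<le> Sf d s" "Sf d s \<le> 1 / d" "s * Sf d s \<le> 1" "1 \<le> s \<Longrightarrow> Sf d s = 0" "Sf d s \<le> zf d s"
    "Sf' d s \<le> - (zf d s)\<^sup>2" "\<bar>Sf' d s\<bar> \<le> 2 / d + 1 / d\<^sup>2"
proof -
  define p where "p = max 0 (1 - s)"
  have p: "0 \<le> p" "p \<le> 1" "p\<^sup>2 \<le> p" "p\<^sup>2 \<le> 1" using assms by (auto simp: p_def power2_eq_square mult_left_le intro: mult_le_one)
  have q: "s + d > 0" "s + d \<ge> d" using assms d by auto
  show "0 \<le> Sf d s" using q by (simp add: Sf_def)
  have "p\<^sup>2 / (s + d) \<le> 1 / d" using p q d by (intro frac_le) auto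
  then show "Sf d s \<le> 1 / d" by (simp add: Sf_def p_def)
  have "s * p\<^sup>2 \<le> s * 1" using assms p by (intro mult_left_mono) auto
  then have "s * p\<^sup>2 \<le> s + d" using d by simp
  then show "s * Sf d s \<le> 1" using q by (simp add: Sf_def p_def divide_le_eq)
  show "1 \<le> s \<Longrightarrow> Sf d s = 0" by (simp add: Sf_def)
  show "Sf d s \<le> zf d s" using p q assms by (simp add: Sf_def zf_def p_def[symmetric] divide_right_mono)
  have "- 2 * p * (s + d) - p\<^sup>2 \<le> - (p\<^sup>2)" using p q by simp
  then have "(- 2 * p * (s + d) - p\<^sup>2) / (s + d)\<^sup>2 \<le> - (p\<^sup>2) / (s + d)\<^sup>2" by (intro divide_right_mono) auto
  then show "Sf' d s \<le> - (zf d s)\<^sup>2" using assms by (simp add: Sf'_def zf_def p_def[symmetric] power_divide)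
  have "\<bar>Sf' d s\<bar> = (2 * p * (s + d) + p\<^sup>2) / (s + d)\<^sup>2"
  proof -
    have "- 2 * p * (s + d) - p\<^sup>2 = - (2 * p * (s + d) + p\<^sup>2)" by simp
    moreover have "0 \<le> 2 * p * (s + d) + p\<^sup>2" using p q by simp
    ultimately show ?thesis unfolding Sf'_def p_def[symmetric] by (simp add: abs_divide del: minus_add_distrib)
  qed
  also have "\<dots> = 2 * p / (s + d) + p\<^sup>2 / (s + d)\<^sup>2"
    using q by (simp add: add_divide_distrib power2_eq_square[of "s + d"])
  also have "\<dots> \<le> 2 / d + 1 / d\<^sup>2" using p q d by (intro add_mono frac_le power_mono) auto
  finally show "\<bar>Sf' d s\<bar> \<le> 2 / d + 1 / d\<^sup>2" .
qed

lemma zf_continuous: "continuous_on UNIV (zf d)"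
  unfolding zf_def using d by (intro continuous_intros) (auto simp: max_def)

lemma zf_bounds: "0 \<le> zf d s" "s \<ge> 0 \<Longrightarrow> zf d s \<le> 1 / d"
proof -
  show "0 \<le> zf d s" unfolding zf_def using d by (intro divide_nonneg_nonneg) auto
  show "s \<ge> 0 \<Longrightarrow> zf d s \<le> 1 / d" unfolding zf_def using d by (intro frac_le) auto
qed

lemma Zf_derivative: "(Zf d has_real_derivative zf d s) (at s)"
  unfolding Zf_def by (rule Fprim_has_derivative[OF zf_continuous])

lemma Zf_0[simp]: "Zf d 0 = 0" by (simp add: Zf_def Fprim_def)

lemma Zf_mono: "a \<le> b \<Longrightarrow> Zf d a \<le> Zf d b"
  by (rule DERIV_nonneg_imp_nondecreasing, assumption)
     (rule exI conjI Zf_derivative zf_bounds(1))+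

lemma Zf_le: assumes "s \<ge> 0" shows "\<bar>Zf d s\<bar> \<le> (1 / d) * \<bar>s\<bar>"
proof -
  have "\<bar>Zf d s - Zf d 0\<bar> \<le> (1 / d) * \<bar>s - 0\<bar>"
    using field_differentiable_bound[of "{0..}" "Zf d" "zf d" "1/d" s 0]
      has_field_derivative_at_within[OF Zf_derivative] zf_bounds assms by simp
  then show ?thesis by simp
qed

text \<open>On [0, c] the factor \<open>1 - s\<close> is at least 1/2, so \<open>zf d\<close>
  dominates half the derivative of the logarithm; beyond \<open>c\<close> monotonicity
  suffices.\<close>

lemma Zf_ge:
  assumes "0 \<le> c" "c \<le> 1/2" "c \<le> s" shows "1/2 * ln ((c + d) / d) \<le> Zf d s"
proof -
  have "Zf d 0 - 1/2 * ln ((0 + d) / d) \<le> Zf d c - 1/2 * ln ((c + d) / d)"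
  proof (rule DERIV_nonneg_imp_nondecreasing[OF assms(1)])
    fix s assume s: "0 \<le> s" "s \<le> c"
    have "((\<lambda>s. Zf d s - 1/2 * ln ((s + d) / d)) has_real_derivative zf d s - 1/2 * (1 / (s + d))) (at s)"
      using s d by (auto intro!: derivative_eq_intros Zf_derivative simp: field_simps)
    moreover have "1/2 * (1 / (s + d)) \<le> zf d s"
    proof -
      have "(1/2) / (s + d) \<le> (1 - s) / (s + d)" using s d assms by (intro divide_right_mono) auto
      moreover have "zf d s = (1 - s) / (s + d)" using s assms by (simp add: zf_def)
      ultimately show ?thesis by simp
    qed
    ultimately show "\<exists>y. ((\<lambda>s. Zf d s - 1/2 * ln ((s + d) / d)) has_real_derivative y) (at s) \<and> 0 \<le> y" by force
  qed
  then show ?thesis using Zf_mono[OF assms(3)] d by simp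
qed

end

lemma norm_square_R2: "(norm (v :: R2))\<^sup>2 = (v $ 1)\<^sup>2 + (v $ 2)\<^sup>2"
  unfolding power2_norm_eq_inner by (simp add: inner_vec_def sum_2 power2_eq_square)

text \<open>Squaring a bump makes its gradient vanish with it: the squared gradient is
  \<open>4 \<eta>\<^sup>2\<close> times a bounded factor, hence a multiple of \<open>\<phi>\<close>.
  This lets the gradient of the cut-off be absorbed in the weighted estimate.\<close>

lemma cutoff_square_exists:
  fixes a b :: R2
  obtains \<phi> c K where "test_fun UNIV \<phi>" "\<And>x. 0 \<le> \<phi> x" "\<And>x. \<phi> x \<le> 1" "c > 0" "\<And>x. x \<in> box a b \<Longrightarrow> c \<le> \<phi> x"
    "K \<ge> 0" "\<And>x. (norm (cgrad \<phi> x))\<^sup>2 \<le> K * \<phi> x"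
    "\<And>x. x \<notin> cbox (a - 1) (b + 1) \<Longrightarrow> \<phi> x = 0"
proof -
  define \<eta> where "\<eta> = bump (a - 1) (b + 1) 1"
  define \<phi> where "\<phi> x = \<eta> x * \<eta> x" for x
  have \<eta>: "test_fun UNIV \<eta>" unfolding \<eta>_def by (rule bump_test_fun) simp
  have \<eta>b: "0 \<le> \<eta> x" "\<eta> x \<le> 1" for x by (auto simp: \<eta>_def bump_nonneg bump_le_1)
  obtain c where c: "c > 0" "\<And>x. x \<in> box a b \<Longrightarrow> \<eta> x \<ge> c" using bump_bounded_below unfolding \<eta>_def by blast
  have eq: "\<eta> = (\<lambda>x. (flat_exp 0 (1 * x $ 1 + (- (a - 1) $ 1)) * flat_exp 0 ((- 1) * x $ 1 + (b + 1) $ 1)) *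
                  (flat_exp 0 (1 * x $ 2 + (- (a - 1) $ 2)) * flat_exp 0 ((- 1) * x $ 2 + (b + 1) $ 2)))"
    by (auto simp: \<eta>_def bump_def algebra_simps fun_eq_iff)
  have "flat_alg \<eta>" unfolding eq by (intro flat_alg.intros)
  then have sm: "smooth2 \<phi>" unfolding \<phi>_def[abs_def] by (intro flat_alg_smooth2 flat_alg.mult)
  have "supp2 \<phi> = supp2 \<eta>" by (simp add: supp2_def \<phi>_def)
  then have t: "test_fun UNIV \<phi>" using sm \<eta> by (simp add: test_fun_def)
  obtain L1 where L1: "\<And>x. \<bar>frechet_derivative \<eta> (at x) (axis 1 1)\<bar> \<le> L1" using test_fun_bounds[OF \<eta>, of "axis 1 1"] by metis
  obtain L2 where L2: "\<And>x. \<bar>frechet_derivative \<eta> (at x) (axis 2 1)\<bar> \<le> L2" using test_fun_bounds[OF \<eta>, of "axis 2 1"] by metis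
  have g: "cgrad \<phi> x = (2 * \<eta> x) *\<^sub>R cgrad \<eta> x" for x
  proof -
    have "(\<phi> has_derivative (\<lambda>v. \<eta> x * frechet_derivative \<eta> (at x) v + frechet_derivative \<eta> (at x) v * \<eta> x)) (at x)"
      unfolding \<phi>_def by (intro has_derivative_mult smooth2_has_derivative test_fun_smooth2 \<eta>)
    from frechet_derivative_at[OF this] show ?thesis
      by (simp add: cgrad_def vec_eq_iff fun_eq_iff algebra_simps)
  qed
  have gb: "(norm (cgrad \<eta> x))\<^sup>2 \<le> L1\<^sup>2 + L2\<^sup>2" for x
  proof -
    have "(norm (cgrad \<eta> x))\<^sup>2 = (cgrad \<eta> x $ 1)\<^sup>2 + (cgrad \<eta> x $ 2)\<^sup>2"
      by (rule norm_square_R2)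
    moreover have "(cgrad \<eta> x $ 1)\<^sup>2 \<le> L1\<^sup>2" "(cgrad \<eta> x $ 2)\<^sup>2 \<le> L2\<^sup>2"
      using power_mono[OF L1[of x], of 2] power_mono[OF L2[of x], of 2] by (auto simp: cgrad_def)
    ultimately show ?thesis by linarith
  qed
  show ?thesis
  proof (rule that[OF t, of "c * c" "4 * (L1\<^sup>2 + L2\<^sup>2)"])
    show "0 \<le> \<phi> x" "\<phi> x \<le> 1" for x using \<eta>b[of x] by (auto simp: \<phi>_def mult_le_one)
    show "0 < c * c" using c by simp
    show "c * c \<le> \<phi> x" if "x \<in> box a b" for x using c(2)[OF that] c(1) by (auto simp: \<phi>_def intro!: mult_mono)
    have "(norm (cgrad \<phi> x))\<^sup>2 = 4 * (\<eta> x * \<eta> x) * (norm (cgrad \<eta> x))\<^sup>2" for x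
      by (simp add: g power_mult_distrib power2_eq_square)
    moreover have "4 * (\<eta> x * \<eta> x) * (norm (cgrad \<eta> x))\<^sup>2 \<le> 4 * (\<eta> x * \<eta> x) * (L1\<^sup>2 + L2\<^sup>2)" for x
      by (intro mult_left_mono gb) auto
    ultimately show "(norm (cgrad \<phi> x))\<^sup>2 \<le> 4 * (L1\<^sup>2 + L2\<^sup>2) * \<phi> x" for x by (simp add: \<phi>_def mult_ac)
    show "\<phi> x = 0" if "x \<notin> cbox (a - 1) (b + 1)" for x
      using that box_subset_cbox bump_eq_0[of 1 x "a - 1" "b + 1"] by (auto simp: \<phi>_def \<eta>_def)
  qed simp
qed

lemma cgrad_borel: "test_fun UNIV \<phi> \<Longrightarrow> cgrad \<phi> \<in> borel_measurable borel"
  by (rule vec_borelI) (simp add: cgrad_def test_fun_deriv_borel)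

lemma isgrad_test_chain:
  assumes w: "isgrad w g" "\<And>x. w x \<ge> 0" and \<phi>: "test_fun UNIV \<phi>" "\<And>x. 0 \<le> \<phi> x" "\<And>x. \<phi> x \<le> 1" and d: "d > 0"
  shows "isgrad (\<lambda>x. \<phi> x * Sf d (w x)) (\<lambda>x. (\<phi> x * Sf' d (w x)) *\<^sub>R g x + Sf d (w x) *\<^sub>R cgrad \<phi> x)"
proof -
  have [measurable]: "Sf d \<in> borel_measurable borel" "Sf' d \<in> borel_measurable borel" "zf d \<in> borel_measurable borel"
    unfolding Sf_def Sf'_def zf_def by measurable
  note cb[measurable] = cgrad_borel[OF \<phi>(1)]
  have cl[measurable]: "cgrad \<phi> \<in> borel_measurable lebesgue" by (simp add: measurable_completion)
  note [measurable] = isgradD(1,3)[OF w(1)] test_fun_L2(1)[OF \<phi>(1)]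
  have "\<exists>L. \<forall>i::2. (\<forall>x. \<bar>frechet_derivative \<phi> (at x) (axis i 1)\<bar> \<le> L)"
  proof -
    obtain L1 where "\<And>x. \<bar>frechet_derivative \<phi> (at x) (axis 1 1)\<bar> \<le> L1" using test_fun_bounds[OF \<phi>(1), of "axis 1 1"] by metis
    moreover obtain L2 where "\<And>x. \<bar>frechet_derivative \<phi> (at x) (axis 2 1)\<bar> \<le> L2" using test_fun_bounds[OF \<phi>(1), of "axis 2 1"] by metis
    ultimately show ?thesis by (intro exI[of _ "max L1 L2"]) (simp add: forall_2 le_max_iff_disj)
  qed
  then obtain L where L: "\<And>i x. \<bar>frechet_derivative \<phi> (at x) (axis (i::2) 1)\<bar> \<le> L" by blast
  have lim: "AE x in lborel. (\<lambda>n. (\<phi> (x + tn n *\<^sub>R axis i 1) - \<phi> x) / tn n) \<longlonglongrightarrow> cgrad \<phi> x $ i" for i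
    using tn_difference_quotient[OF test_fun_line_derivative[OF \<phi>(1), of _ "axis i 1" 0 UNIV], of 1]
    by (intro AE_I2) (simp add: cgrad_def)
  note pc = has_weak_grad_product_chain[OF w(1), where I = "{0..}" and T = "Sf d" and T' = "Sf' d" and L = "2 / d + 1 / d\<^sup>2"
      and \<phi> = \<phi> and \<Phi> = "cgrad \<phi>" and M = 1 and N = L]
  have prem: "is_interval {0::real..}" "{0::real..} \<in> sets borel" "\<And>x. w x \<in> {0..}"
    "\<And>s. s \<in> {0..} \<Longrightarrow> (Sf d has_real_derivative Sf' d s) (at s within {0..})" "continuous_on {0..} (Sf' d)"
    "\<And>s. s \<in> {0..} \<Longrightarrow> \<bar>Sf' d s\<bar> \<le> 2 / d + 1 / d\<^sup>2" "Sf d \<in> borel_measurable borel" "Sf' d \<in> borel_measurable borel"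
    "cgrad \<phi> \<in> borel_measurable borel" "continuous_on UNIV \<phi>" "\<And>x. \<bar>\<phi> x\<bar> \<le> 1"
    "\<And>i x t. \<bar>\<phi> (x + t *\<^sub>R axis i 1) - \<phi> x\<bar> \<le> L * \<bar>t\<bar>" "\<And>i x. \<bar>cgrad \<phi> x $ i\<bar> \<le> L"
    using w(2) Sf_derivative[OF d] Sf'_continuous[OF d] Sf_bounds(7)[OF d] \<phi> L
      smooth2_continuous[OF test_fun_smooth2[OF \<phi>(1)]] test_fun_lipschitz[OF \<phi>(1) L]
    by (auto simp: cgrad_def)
  note pc' = pc[OF prem lim]
  have i1: "integrable lebesgue (\<lambda>x. (norm (\<phi> x * Sf d (w x)))\<^sup>2)"
  proof (rule L2_bound[OF test_fun_L2(2)[OF \<phi>(1)], of _ "1/d"])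
    show "norm (\<phi> x * Sf d (w x)) \<le> 1 / d * \<bar>\<phi> x\<bar>" for x
      using mult_left_mono[OF Sf_bounds(2)[OF d w(2)[of x]] \<phi>(2)[of x]] Sf_bounds(1)[OF d w(2)[of x]] \<phi>(2)[of x]
      by (simp add: abs_mult)
  qed measurable
  have i2: "integrable lebesgue (\<lambda>x. (norm ((\<phi> x * Sf' d (w x)) *\<^sub>R g x + Sf d (w x) *\<^sub>R cgrad \<phi> x))\<^sup>2)"
  proof (rule L2_add)
    show "integrable lebesgue (\<lambda>x. (norm ((\<phi> x * Sf' d (w x)) *\<^sub>R g x))\<^sup>2)"
    proof (rule L2_bound[of _ "\<lambda>x. norm (g x)" _ "2 / d + 1 / d\<^sup>2"])
      show "norm ((\<phi> x * Sf' d (w x)) *\<^sub>R g x) \<le> (2 / d + 1 / d\<^sup>2) * \<bar>norm (g x)\<bar>" for x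
      proof -
        have "\<bar>\<phi> x\<bar> * \<bar>Sf' d (w x)\<bar> \<le> 1 * (2 / d + 1 / d\<^sup>2)"
          by (intro mult_mono prem) (use w(2) in auto)
        then have "\<bar>\<phi> x * Sf' d (w x)\<bar> * norm (g x) \<le> (2 / d + 1 / d\<^sup>2) * norm (g x)"
          by (intro mult_right_mono) (auto simp: abs_mult)
        then show ?thesis by simp
      qed
    qed (use isgradD(4)[OF w(1)] in auto)
    have cL2: "integrable lebesgue (\<lambda>x. (norm (cgrad \<phi> x))\<^sup>2)"
    proof -
      have "(\<lambda>x. (norm (cgrad \<phi> x))\<^sup>2) = (\<lambda>x. (cgrad \<phi> x $ 1)\<^sup>2 + (cgrad \<phi> x $ 2)\<^sup>2)"
        by (simp add: norm_square_R2)
      then show ?thesis using test_fun_L2(4)[OF \<phi>(1), of 1] test_fun_L2(4)[OF \<phi>(1), of 2] by simp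
    qed
    show "integrable lebesgue (\<lambda>x. (norm (Sf d (w x) *\<^sub>R cgrad \<phi> x))\<^sup>2)"
    proof (rule L2_bound[of _ "\<lambda>x. norm (cgrad \<phi> x)" _ "1/d"])
      show "norm (Sf d (w x) *\<^sub>R cgrad \<phi> x) \<le> 1 / d * \<bar>norm (cgrad \<phi> x)\<bar>" for x
        using mult_right_mono[OF Sf_bounds(2)[OF d w(2)[of x]], of "norm (cgrad \<phi> x)"] Sf_bounds(1)[OF d w(2)[of x]]
        by simp
    qed (use cL2 in auto)
  qed measurable
  show ?thesis unfolding isgrad_def using pc' i1 i2 by simp
qed

lemma wdir_vector:
  assumes u: "sqi u" and g: "\<And>i. sqi (\<lambda>x. g x $ i)" and w: "\<And>i::2. wdir (axis i 1) u (\<lambda>x. g x $ i)"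
  shows "wdir a u (\<lambda>x. a \<bullet> g x)"
  unfolding wdir_def
proof (intro allI impI)
  fix \<phi> assume \<phi>: "test_fun UNIV \<phi>"
  note [measurable] = sqi_borel[OF u] sqi_borel[OF g] test_fun_borel[OF \<phi>] test_fun_deriv_borel[OF \<phi>]
  let ?D = "\<lambda>i x. frechet_derivative \<phi> (at x) (axis (i::2) 1)"
  have i: "integrable lborel (\<lambda>x. u x * ?D i x)" "integrable lborel (\<lambda>x. g x $ i * \<phi> x)" for i
  proof -
    obtain R L where RL: "\<forall>x. norm x \<ge> R \<longrightarrow> \<phi> x = 0" "\<forall>x. norm x \<ge> R \<longrightarrow> ?D i x = 0"
      "\<And>x. \<bar>\<phi> x\<bar> \<le> L" "\<And>x. \<bar>?D i x\<bar> \<le> L"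
      using test_fun_bounds[OF \<phi>, of "axis i 1"] by metis
    show "integrable lborel (\<lambda>x. u x * ?D i x)" by (rule sqi_local_integrable[OF u _ RL(4) RL(2)]) measurable
    show "integrable lborel (\<lambda>x. g x $ i * \<phi> x)" by (rule sqi_local_integrable[OF g _ RL(3) RL(1)]) measurable
  qed
  have D: "frechet_derivative \<phi> (at x) a = a $ 1 * ?D 1 x + a $ 2 * ?D 2 x" for x
  proof -
    have lin: "linear (frechet_derivative \<phi> (at x))"
      by (intro linear_frechet_derivative smooth2_differentiable test_fun_smooth2 \<phi>)
    have "a = a $ 1 *\<^sub>R axis 1 1 + a $ 2 *\<^sub>R axis 2 1" by (simp add: vec_eq_iff forall_2 axis_def)
    then have "frechet_derivative \<phi> (at x) a = frechet_derivative \<phi> (at x) (a $ 1 *\<^sub>R axis 1 1 + a $ 2 *\<^sub>R axis 2 1)" by simp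
    then show ?thesis by (simp add: linear_add[OF lin] linear_scale[OF lin])
  qed
  have w': "(\<integral>x. u x * ?D i x \<partial>lborel) = - (\<integral>x. g x $ i * \<phi> x \<partial>lborel)" for i
    using w[of i] \<phi> unfolding wdir_def by blast
  have "(\<integral>x. u x * frechet_derivative \<phi> (at x) a \<partial>lborel) = (\<integral>x. a $ 1 * (u x * ?D 1 x) + a $ 2 * (u x * ?D 2 x) \<partial>lborel)"
    by (simp add: D algebra_simps)
  also have "\<dots> = - (\<integral>x. a $ 1 * (g x $ 1 * \<phi> x) + a $ 2 * (g x $ 2 * \<phi> x) \<partial>lborel)"
    using i w' by simp
  also have "\<dots> = - (\<integral>x. (a \<bullet> g x) * \<phi> x \<partial>lborel)" by (simp add: inner_vec_def sum_2 algebra_simps)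
  finally show "(\<integral>x. u x * frechet_derivative \<phi> (at x) a \<partial>lborel) = - (\<integral>x. (a \<bullet> g x) * \<phi> x \<partial>lborel)" .
qed

text \<open>Integrating the measure of the overlap over all shifts \<open>a\<close> gives the
  product of the two measures, by Tonelli; so not every overlap can be null.\<close>

lemma positive_overlap:
  fixes Z P :: "R2 set"
  assumes [measurable]: "Z \<in> sets borel" "P \<in> sets borel" and pos: "emeasure lborel Z > 0" "emeasure lborel P > 0"
  obtains a where "emeasure lborel {x \<in> Z. x + a \<in> P} > 0"
proof -
  have m: "{x \<in> Z. x + a \<in> P} \<in> sets borel" for a by measurable
  have "(\<integral>\<^sup>+a. emeasure lborel {x \<in> Z. x + a \<in> P} \<partial>lborel) = (\<integral>\<^sup>+a. \<integral>\<^sup>+x. indicator Z x * indicator P (x + a) \<partial>lborel \<partial>lborel)"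
  proof (rule nn_integral_cong)
    fix a :: R2
    have "emeasure lborel {x \<in> Z. x + a \<in> P} = (\<integral>\<^sup>+x. indicator {x \<in> Z. x + a \<in> P} x \<partial>lborel)"
      by (rule nn_integral_indicator[symmetric]) (use m in simp)
    also have "\<dots> = (\<integral>\<^sup>+x. indicator Z x * indicator P (x + a) \<partial>lborel)"
      by (intro nn_integral_cong) (auto split: split_indicator)
    finally show "emeasure lborel {x \<in> Z. x + a \<in> P} = (\<integral>\<^sup>+x. indicator Z x * indicator P (x + a) \<partial>lborel)" .
  qed
  also have "\<dots> = (\<integral>\<^sup>+x. \<integral>\<^sup>+a. indicator Z x * indicator P (x + a) \<partial>lborel \<partial>lborel)"
    by (rule lborel_pair.Fubini') measurable
  also have "\<dots> = (\<integral>\<^sup>+x. indicator Z x * (\<integral>\<^sup>+a. indicator P (a + x) \<partial>lborel) \<partial>lborel)"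
    by (subst nn_integral_cmult) (auto simp: add.commute)
  also have "\<dots> = (\<integral>\<^sup>+x. emeasure lborel P * indicator Z x \<partial>lborel)"
    by (subst nn_integral_translate) (auto simp: mult.commute)
  also have "\<dots> = emeasure lborel P * emeasure lborel Z" by (simp add: nn_integral_cmult_indicator)
  finally have nz: "(\<integral>\<^sup>+a. emeasure lborel {x \<in> Z. x + a \<in> P} \<partial>lborel) \<noteq> 0" using pos by (simp add: zero_less_iff_neq_zero)
  have "\<not> (\<forall>a. emeasure lborel {x \<in> Z. x + a \<in> P} = 0)"
  proof
    assume "\<forall>a. emeasure lborel {x \<in> Z. x + a \<in> P} = 0"
    with nz show False by simp
  qed
  then show ?thesis using that by (auto simp: zero_less_iff_neq_zero)
qed

section \<open>Local bounds for the truncated logarithm and positivity of the minimizer\<close>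

context nehari_lipschitz
begin

text \<open>In \<open>g x \<bullet> k x\<close> the derivative of \<open>Sf d\<close> contributes at
  most minus the integrand to be bounded; the cross term with the gradient of \<open>\<phi>\<close>
  is absorbed by Young's inequality. The variational inequality bounds what remains through
  \<open>w \<zeta> \<le> 1\<close> on the box, so the final constant does not contain
  \<open>d\<close>.\<close>

lemma log_estimate:
  assumes w: "adm w g" "\<And>x. w x \<ge> 0" "BB w < 0" "Psi w g > 0"
    and min: "\<And>v h. adm v h \<Longrightarrow> (\<And>x. v x \<ge> 0) \<Longrightarrow> BB v < 0 \<Longrightarrow> Psi w g \<le> Psi v h"
    and \<phi>: "test_fun UNIV \<phi>" "\<And>x. 0 \<le> \<phi> x" "\<And>x. \<phi> x \<le> 1"
    and K: "\<And>x. (norm (cgrad \<phi> x))\<^sup>2 \<le> K * \<phi> x" "K \<ge> 0" and z: "\<And>x. x \<notin> cbox a b \<Longrightarrow> \<phi> x = 0"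
    and d: "d > 0"
  shows "integrable lebesgue (\<lambda>x. \<phi> x * ((zf d (w x))\<^sup>2 * (norm (g x))\<^sup>2))"
    "(\<integral>x. \<phi> x * ((zf d (w x))\<^sup>2 * (norm (g x))\<^sup>2) \<partial>lebesgue) \<le> (2 * \<bar>var_const w g\<bar> + K) * measure lebesgue (cbox a b)"
proof -
  have wg: "isgrad w g" using w by (simp add: adm_def)
  define \<zeta> where "\<zeta> x = \<phi> x * Sf d (w x)" for x
  define k where "k x = (\<phi> x * Sf' d (w x)) *\<^sub>R g x + Sf d (w x) *\<^sub>R cgrad \<phi> x" for x
  have zk: "isgrad \<zeta> k" unfolding \<zeta>_def[abs_def] k_def[abs_def] by (rule isgrad_test_chain[OF wg w(2) \<phi> d])
  have zm: "zf d \<in> borel_measurable borel" unfolding zf_def by measurable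
  note [measurable] = isgradD(1,3)[OF wg] isgradD(1,3)[OF zk] test_fun_L2(1)[OF \<phi>(1)] measurable_compose[OF isgradD(1)[OF wg] zm]
  let ?i = "indicator (cbox a b) :: R2 \<Rightarrow> real"
  have ii: "integrable lebesgue ?i"
    by (intro integrable_real_indicator) (auto simp: emeasure_lborel_cbox_eq)
  have gk: "integrable lebesgue (\<lambda>x. g x \<bullet> k x)" by (intro L2_inner isgradD[OF wg] isgradD[OF zk])
  have pw: "\<phi> x * ((zf d (w x))\<^sup>2 * (norm (g x))\<^sup>2) \<le> - 2 * (g x \<bullet> k x) + K * ?i x" for x
  proof -
    define G N t S where "G = norm (g x)" and "N = norm (cgrad \<phi> x)" and "t = zf d (w x)" and "S = Sf d (w x)"
    note Sb = Sf_bounds[OF d w(2)[of x], folded t_def S_def]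
    have nn: "G \<ge> 0" "N \<ge> 0" "t \<ge> 0" using zf_bounds(1)[OF d] by (auto simp: G_def N_def t_def)
    have "g x \<bullet> k x = \<phi> x * Sf' d (w x) * G\<^sup>2 + S * (g x \<bullet> cgrad \<phi> x)"
      by (simp add: k_def G_def S_def inner_add_right dot_square_norm)
    also have "\<dots> \<le> \<phi> x * (- t\<^sup>2) * G\<^sup>2 + S * (G * N)"
      using Sb(1,6) \<phi>(2)[of x] norm_cauchy_schwarz[of "g x" "cgrad \<phi> x"]
      by (intro add_mono mult_right_mono mult_left_mono) (auto simp: G_def N_def)
    also have "S * (G * N) \<le> t * (G * N)" using Sb(5) nn by (intro mult_right_mono) auto
    finally have 1: "g x \<bullet> k x \<le> - (\<phi> x * (t\<^sup>2 * G\<^sup>2)) + t * G * N" by (simp add: mult_ac)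
    \<comment> \<open>Young's inequality is applied after multiplication by \<open>\<phi> x\<close>,
      so that \<open>N\<^sup>2 \<le> K * \<phi> x\<close> cancels one factor; where
      \<open>\<phi> x = 0\<close>, the gradient vanishes too.\<close>
    have 2: "2 * (t * G * N) \<le> \<phi> x * (t\<^sup>2 * G\<^sup>2) + K * ?i x"
    proof (cases "\<phi> x = 0")
      case True
      then have "N = 0" using K(1)[of x] by (simp add: N_def)
      then show ?thesis using True K(2) by simp
    next
      case False
      then have p: "\<phi> x > 0" and i: "?i x = 1" using \<phi>(2)[of x] z[of x] by (auto simp: indicator_def)
      have "2 * \<bar>(\<phi> x * (t * G)) * N\<bar> \<le> (\<phi> x * (t * G))\<^sup>2 + N\<^sup>2" by (rule two_abs_mult_le)
      then have "2 * (\<phi> x * (t * G) * N) \<le> (\<phi> x * (t * G))\<^sup>2 + K * \<phi> x" using K(1)[of x] unfolding N_def by linarith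
      then have "\<phi> x * (2 * (t * G * N)) \<le> \<phi> x * (\<phi> x * (t\<^sup>2 * G\<^sup>2) + K)"
        by (simp add: power_mult_distrib power2_eq_square algebra_simps)
      then show ?thesis using p i by (simp add: mult_le_cancel_left)
    qed
    show ?thesis using 1 2 unfolding t_def G_def by linarith
  qed
  have ri: "integrable lebesgue (\<lambda>x. - 2 * (g x \<bullet> k x) + K * ?i x)" using gk ii by simp
  have nn: "0 \<le> \<phi> x * ((zf d (w x))\<^sup>2 * (norm (g x))\<^sup>2)" for x using \<phi>(2) by simp
  show li: "integrable lebesgue (\<lambda>x. \<phi> x * ((zf d (w x))\<^sup>2 * (norm (g x))\<^sup>2))"
  proof (rule Bochner_Integration.integrable_bound[OF ri])
    show "AE x in lebesgue. norm (\<phi> x * ((zf d (w x))\<^sup>2 * (norm (g x))\<^sup>2)) \<le> norm (- 2 * (g x \<bullet> k x) + K * ?i x)"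
      using pw nn by (intro AE_I2) (smt (verit) real_norm_def)
  qed measurable
  have wz: "integrable lebesgue (\<lambda>x. w x * \<zeta> x)" by (intro L2_mult isgradD[OF wg] isgradD[OF zk])
  have z0: "0 \<le> \<zeta> x" and zM: "\<zeta> x \<le> 1 / d" and z1: "w x \<ge> 1 \<Longrightarrow> \<zeta> x = 0" and wz1: "w x * \<zeta> x \<le> ?i x" for x
  proof -
    note Sb = Sf_bounds[OF d w(2)[of x]]
    show "0 \<le> \<zeta> x" using Sb \<phi>(2) by (simp add: \<zeta>_def)
    have "\<phi> x * Sf d (w x) \<le> 1 * (1 / d)" using Sb \<phi> by (intro mult_mono) auto
    then show "\<zeta> x \<le> 1 / d" by (simp add: \<zeta>_def)
    show "w x \<ge> 1 \<Longrightarrow> \<zeta> x = 0" using Sb by (simp add: \<zeta>_def)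
    have "\<phi> x * (w x * Sf d (w x)) \<le> 1 * 1" using Sb \<phi> w(2)[of x] by (intro mult_mono) auto
    then show "w x * \<zeta> x \<le> ?i x" using z[of x] by (cases "x \<in> cbox a b") (auto simp: \<zeta>_def mult_ac)
  qed
  have vi: "- var_const w g * (\<integral>x. w x * \<zeta> x \<partial>lebesgue) \<le> (\<integral>x. g x \<bullet> k x \<partial>lebesgue)"
    by (rule variational_inequality[OF w min zk z0 z1 zM])
  have W: "0 \<le> (\<integral>x. w x * \<zeta> x \<partial>lebesgue)" "(\<integral>x. w x * \<zeta> x \<partial>lebesgue) \<le> measure lebesgue (cbox a b)"
  proof -
    show "0 \<le> (\<integral>x. w x * \<zeta> x \<partial>lebesgue)" using z0 w(2) by (intro Bochner_Integration.integral_nonneg) auto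
    have "(\<integral>x. w x * \<zeta> x \<partial>lebesgue) \<le> (\<integral>x. ?i x \<partial>lebesgue)" using wz ii wz1 by (intro integral_mono) auto
    then show "(\<integral>x. w x * \<zeta> x \<partial>lebesgue) \<le> measure lebesgue (cbox a b)" by simp
  qed
  have "(\<integral>x. \<phi> x * ((zf d (w x))\<^sup>2 * (norm (g x))\<^sup>2) \<partial>lebesgue) \<le> (\<integral>x. - 2 * (g x \<bullet> k x) + K * ?i x \<partial>lebesgue)"
    by (intro integral_mono li ri pw)
  also have "\<dots> = - 2 * (\<integral>x. g x \<bullet> k x \<partial>lebesgue) + K * measure lebesgue (cbox a b)" using gk ii by simp
  also have "\<dots> \<le> 2 * (var_const w g * (\<integral>x. w x * \<zeta> x \<partial>lebesgue)) + K * measure lebesgue (cbox a b)" using vi by simp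
  also have "var_const w g * (\<integral>x. w x * \<zeta> x \<partial>lebesgue) \<le> \<bar>var_const w g\<bar> * measure lebesgue (cbox a b)"
    using W by (intro mult_mono) auto
  finally show "(\<integral>x. \<phi> x * ((zf d (w x))\<^sup>2 * (norm (g x))\<^sup>2) \<partial>lebesgue) \<le> (2 * \<bar>var_const w g\<bar> + K) * measure lebesgue (cbox a b)"
    by (simp add: algebra_simps)
qed

text \<open>On a set \<open>E\<close> of positive measure a fixed shift \<open>a\<close> leads from
  zeros of \<open>w\<close> to points with \<open>w \<ge> \<kappa>\<close>. There the increment of
  \<open>Zf d (w)\<close> is at least half of \<open>ln ((\<kappa> + d) / d)\<close>, which is
  unbounded as \<open>d\<close> tends to 0, whereas its square integral over \<open>E\<close> is
  bounded independently of \<open>d\<close>.\<close>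

lemma minimizer_positive:
  assumes w: "adm w g" "\<And>x. w x \<ge> 0" "BB w < 0" "Psi w g > 0"
    and min: "\<And>v h. adm v h \<Longrightarrow> (\<And>x. v x \<ge> 0) \<Longrightarrow> BB v < 0 \<Longrightarrow> Psi w g \<le> Psi v h"
    and [measurable]: "w \<in> borel_measurable borel" "g \<in> borel_measurable borel"
  shows "AE x in lborel. w x \<noteq> 0"
proof (rule ccontr)
  assume nz: "\<not> (AE x in lborel. w x \<noteq> 0)"
  have wg: "isgrad w g" using w by (simp add: adm_def)
  define B where "B n = (box (- (real n *\<^sub>R One)) (real n *\<^sub>R One) :: R2 set)" for n :: nat
  have Bm[measurable]: "B n \<in> sets borel" for n by (simp add: B_def)
  have Bmono: "B m \<subseteq> B n" if "m \<le> n" for m n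
    unfolding B_def using that by (intro subset_box_imp) (auto simp: inner_Basis)
  have BU: "\<exists>n. x \<in> B n" for x unfolding B_def using UN_box_eq_UNIV by blast
  define Z where "Z n = {x \<in> B n. w x = 0}" for n
  \<comment> \<open>The shift by 2 keeps the threshold at most 1/2, as \<open>Zf_ge\<close>
    requires.\<close>
  define P where "P n = {x \<in> B n. 1 / (real n + 2) \<le> w x}" for n
  have Zm[measurable]: "Z n \<in> sets borel" and Pm[measurable]: "P n \<in> sets borel" for n
    unfolding Z_def P_def by measurable
  have "\<exists>n. emeasure lborel (Z n) > 0"
  proof (rule ccontr)
    assume "\<not> ?thesis"
    then have "AE x in lborel. x \<notin> Z n" for n by (intro AE_not_in) (auto simp: null_sets_def)
    then have "AE x in lborel. \<forall>n. x \<notin> Z n" unfolding AE_all_countable by blast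
    then have "AE x in lborel. w x \<noteq> 0" by eventually_elim (use BU in \<open>auto simp: Z_def\<close>)
    with nz show False by simp
  qed
  then obtain n1 where n1: "emeasure lborel (Z n1) > 0" by blast
  have "\<exists>n. emeasure lborel (P n) > 0"
  proof (rule ccontr)
    assume "\<not> ?thesis"
    then have "AE x in lborel. x \<notin> P n" for n by (intro AE_not_in) (auto simp: null_sets_def)
    then have "AE x in lborel. \<forall>n. x \<notin> P n" unfolding AE_all_countable by blast
    then have "AE x in lborel. w x = 0"
    proof eventually_elim
      case (elim x)
      show ?case
      proof (rule ccontr)
        assume "w x \<noteq> 0"
        then have "w x > 0" using w(2)[of x] by simp
        then obtain m where m: "1 / w x < real m" using reals_Archimedean2 by blast
        obtain l where l: "x \<in> B l" using BU by blast
        define n where "n = max m l"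
        have "1 / w x < real n + 2" using m by (simp add: n_def)
        then have "1 / (real n + 2) \<le> w x" using \<open>w x > 0\<close> by (simp add: field_simps)
        moreover have "x \<in> B n" using Bmono[of l n] l by (auto simp: n_def)
        ultimately show False using elim by (auto simp: P_def)
      qed
    qed
    from AE_completion[OF this] nonzero_of_BB[OF w(3)] show False by (simp add: nonzero_def)
  qed
  then obtain n2 where n2: "emeasure lborel (P n2) > 0" by blast
  define N where "N = max n1 n2"
  have "Z n1 \<subseteq> Z N" using Bmono[of n1 N] by (auto simp: Z_def N_def)
  then have ZN: "emeasure lborel (Z N) > 0" using n1 emeasure_mono[of "Z n1" "Z N" lborel] by (simp add: less_le_trans)
  have "1 / (real N + 2) \<le> 1 / (real n2 + 2)" by (intro frac_le) (auto simp: N_def)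
  then have "P n2 \<subseteq> P N" using Bmono[of n2 N] by (auto simp: P_def N_def)
  then have PN: "emeasure lborel (P N) > 0" using n2 emeasure_mono[of "P n2" "P N" lborel] by (simp add: less_le_trans)
  obtain a where a: "emeasure lborel {x \<in> Z N. x + a \<in> P N} > 0" using positive_overlap[OF Zm Pm ZN PN] by blast
  define E where "E = {x \<in> Z N. x + a \<in> P N}"
  have Em[measurable]: "E \<in> sets borel" unfolding E_def by measurable
  have "E \<subseteq> B N" by (auto simp: E_def Z_def)
  then have "emeasure lborel E < \<infinity>"
    by (intro emeasure_bounded_finite) (auto simp: B_def intro: bounded_subset[OF bounded_box])
  then obtain me where me: "emeasure lborel E = ennreal me" "me \<ge> 0" by (cases "emeasure lborel E") auto
  have me0: "me > 0" using a me unfolding E_def[symmetric] by (simp add: ennreal_less_zero_iff)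
  obtain \<phi> c K where \<phi>: "test_fun UNIV \<phi>" "\<And>x. 0 \<le> \<phi> x" "\<And>x. \<phi> x \<le> 1" "c > 0" "\<And>x. x \<in> B N \<Longrightarrow> c \<le> \<phi> x"
    "K \<ge> 0" "\<And>x. (norm (cgrad \<phi> x))\<^sup>2 \<le> K * \<phi> x"
    "\<And>x. x \<notin> cbox (- (real N *\<^sub>R One) - 1) (real N *\<^sub>R One + 1) \<Longrightarrow> \<phi> x = 0"
    using cutoff_square_exists[of "- (real N *\<^sub>R One)" "real N *\<^sub>R One"] unfolding B_def by blast
  note [measurable] = test_fun_borel[OF \<phi>(1)]
  define C1 where "C1 = (2 * \<bar>var_const w g\<bar> + K) * measure lebesgue (cbox (- (real N *\<^sub>R One) - 1) (real N *\<^sub>R One + 1 :: R2))"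
  define \<kappa> where "\<kappa> = 1 / (real N + 2)"
  have \<kappa>: "0 < \<kappa>" "\<kappa> \<le> 1/2" by (auto simp: \<kappa>_def)
  define Q where "Q = (norm a)\<^sup>2 / c * C1"
  have key: "(1/2 * ln ((\<kappa> + d) / d))\<^sup>2 * me \<le> Q" if d: "d > 0" for d
  proof -
    have zm[measurable]: "zf d \<in> borel_measurable borel" unfolding zf_def by measurable
    have Zc: "continuous_on UNIV (Zf d)" using Zf_derivative[OF d] by (meson DERIV_isCont continuous_at_imp_continuous_on)
    note Zfm[measurable] = borel_measurable_continuous_onI[OF Zc]
    let ?z = "\<lambda>x. Zf d (w x)" and ?k = "\<lambda>x. zf d (w x) *\<^sub>R g x"
    have hw: "has_weak_grad ?z ?k"
      by (rule has_weak_grad_chain[OF wg, where I = "{0..}" and L = "1/d"])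
         (use w(2) zf_bounds[OF d] has_field_derivative_at_within[OF Zf_derivative[OF d]] zf_continuous[OF d] in
           \<open>auto intro: continuous_on_subset\<close>)
    have zb: "?z \<in> borel_measurable borel" and kb: "?k \<in> borel_measurable borel" by measurable
    note zl = borel_measurable_lebesgueI[OF zb]
    have kl: "?k \<in> borel_measurable lebesgue" using kb by (simp add: measurable_completion)
    have z2: "integrable lebesgue (\<lambda>x. (norm (?z x))\<^sup>2)"
      by (rule L2_bound[OF isgradD(2)[OF wg] zl, of "1/d"]) (use Zf_le[OF d w(2)] in auto)
    have k2: "integrable lebesgue (\<lambda>x. (norm (?k x))\<^sup>2)"
    proof (rule L2_bound[of _ "\<lambda>x. norm (g x)" _ "1/d"])
      show "norm (?k x) \<le> 1 / d * \<bar>norm (g x)\<bar>" for x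
        using mult_right_mono[OF zf_bounds(2)[OF d w(2)[of x]], of "norm (g x)"] zf_bounds(1)[OF d, of "w x"] by simp
    qed (use isgradD(4)[OF wg] kl in auto)
    have sz: "sqi ?z" by (rule sqi_of_lebesgue[OF zl zb]) (use z2 in auto)
    have sk: "sqi (\<lambda>x. ?k x $ i)" for i
      by (rule sqi_of_lebesgue[where u = "\<lambda>x. ?k x $ i"])
         (use kl kb L2_component[OF kl k2] in \<open>auto intro!: vec_nth_borel simp del: vector_scaleR_component\<close>)
    have wd: "wdir (axis i 1) ?z (\<lambda>x. ?k x $ i)" for i
      using has_weak_grad_iff_wdir[OF zl kl zb kb] hw by auto
    have sa: "sqi (\<lambda>x. a \<bullet> ?k x)"
    proof -
      have am: "(\<lambda>x. a \<bullet> ?k x) \<in> borel_measurable borel" by measurable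
      have "integrable lebesgue (\<lambda>x. (norm (a \<bullet> ?k x))\<^sup>2)"
      proof (rule L2_bound[of _ "\<lambda>x. norm (?k x)" _ "norm a"])
        show "norm (a \<bullet> ?k x) \<le> norm a * \<bar>norm (?k x)\<bar>" for x using Cauchy_Schwarz_ineq2[of a "?k x"] by simp
      qed (use k2 borel_measurable_lebesgueI[OF am] in auto)
      with am show ?thesis by (intro sqi_of_lebesgue[where u = "\<lambda>x. a \<bullet> ?k x"]) (auto intro: borel_measurable_lebesgueI)
    qed
    note est = translation_estimate[OF sz sa wdir_vector[OF sz sk wd] Em Bm[of N]]
    \<comment> \<open>Both ends of the segment lie in the box \<open>B N\<close>, which is convex,
      so the gradient is needed only where the cut-off is bounded below by \<open>c\<close>.\<close>
    have sub: "x + s *\<^sub>R a \<in> B N" if "x \<in> E" "0 \<le> s" "s \<le> 1" for x s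
    proof -
      have "x \<in> B N" "x + a \<in> B N" using that by (auto simp: E_def Z_def P_def)
      then have "(1 - s) *\<^sub>R x + s *\<^sub>R (x + a) \<in> B N"
        using that unfolding B_def by (intro convexD[OF convex_box(2)]) auto
      then show ?thesis by (simp add: algebra_simps)
    qed
    define l where "l = 1/2 * ln ((\<kappa> + d) / d)"
    have l0: "l \<ge> 0" using \<kappa> d by (simp add: l_def)
    have "ennreal (l\<^sup>2 * me) = (\<integral>\<^sup>+x. ennreal (l\<^sup>2) * indicator E x \<partial>lborel)"
      by (simp add: nn_integral_cmult_indicator me ennreal_mult)
    also have "\<dots> \<le> (\<integral>\<^sup>+x. ennreal ((?z (x + a) - ?z x)\<^sup>2) * indicator E x \<partial>lborel)"
    proof (rule nn_integral_mono)
      fix x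
      have "l\<^sup>2 \<le> (?z (x + a) - ?z x)\<^sup>2" if "x \<in> E"
      proof -
        have "w x = 0" "\<kappa> \<le> w (x + a)" using that by (auto simp: E_def Z_def P_def \<kappa>_def)
        then have "?z x = 0" "l \<le> ?z (x + a)" using Zf_ge[OF d, of \<kappa> "w (x + a)"] \<kappa> d by (auto simp: l_def)
        then show ?thesis using l0 by (intro power_mono) auto
      qed
      then show "ennreal (l\<^sup>2) * indicator E x \<le> ennreal ((?z (x + a) - ?z x)\<^sup>2) * indicator E x"
        by (auto split: split_indicator intro: ennreal_leI)
    qed
    also have "\<dots> \<le> (\<integral>\<^sup>+x. ennreal ((a \<bullet> ?k x)\<^sup>2) * indicator (B N) x \<partial>lborel)"
      by (rule est) (rule sub)
    also have "\<dots> \<le> (\<integral>\<^sup>+x. ennreal ((norm a)\<^sup>2 / c * (\<phi> x * ((zf d (w x))\<^sup>2 * (norm (g x))\<^sup>2))) \<partial>lborel)"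
    proof (rule nn_integral_mono)
      fix x
      have "(a \<bullet> ?k x)\<^sup>2 \<le> (norm a)\<^sup>2 / c * (\<phi> x * ((zf d (w x))\<^sup>2 * (norm (g x))\<^sup>2))" if "x \<in> B N"
      proof -
        have "(a \<bullet> ?k x)\<^sup>2 \<le> (norm a * norm (?k x))\<^sup>2"
          using power_mono[OF Cauchy_Schwarz_ineq2[of a "?k x"], of 2] by simp
        also have "\<dots> = (norm a)\<^sup>2 * ((zf d (w x))\<^sup>2 * (norm (g x))\<^sup>2)" by (simp add: power_mult_distrib)
        also have "\<dots> = (norm a)\<^sup>2 / c * (c * ((zf d (w x))\<^sup>2 * (norm (g x))\<^sup>2))" using \<phi>(4) by simp
        also have "\<dots> \<le> (norm a)\<^sup>2 / c * (\<phi> x * ((zf d (w x))\<^sup>2 * (norm (g x))\<^sup>2))"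
          using \<phi>(4) \<phi>(5)[OF that] by (intro mult_left_mono mult_right_mono) auto
        finally show ?thesis .
      qed
      then show "ennreal ((a \<bullet> ?k x)\<^sup>2) * indicator (B N) x \<le> ennreal ((norm a)\<^sup>2 / c * (\<phi> x * ((zf d (w x))\<^sup>2 * (norm (g x))\<^sup>2)))"
        by (auto split: split_indicator intro: ennreal_leI)
    qed
    also have "\<dots> = (\<integral>\<^sup>+x. ennreal ((norm a)\<^sup>2 / c * (\<phi> x * ((zf d (w x))\<^sup>2 * (norm (g x))\<^sup>2))) \<partial>lebesgue)"
      by (rule nn_integral_completion[symmetric])
    also have "\<dots> = ennreal (\<integral>x. (norm a)\<^sup>2 / c * (\<phi> x * ((zf d (w x))\<^sup>2 * (norm (g x))\<^sup>2)) \<partial>lebesgue)"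
      by (rule nn_integral_eq_integral)
         (use log_estimate(1)[OF w min \<phi>(1-3,7,6,8) d] \<phi>(2,4) in auto)
    also have "\<dots> = ennreal ((norm a)\<^sup>2 / c * (\<integral>x. \<phi> x * ((zf d (w x))\<^sup>2 * (norm (g x))\<^sup>2) \<partial>lebesgue))"
      by (subst Bochner_Integration.integral_mult_right_zero) simp
    also have "\<dots> \<le> ennreal Q"
      unfolding Q_def C1_def using log_estimate(2)[OF w min \<phi>(1-3,7,6,8) d] \<phi>(4)
      by (intro ennreal_leI mult_left_mono) auto
    finally have "ennreal (l\<^sup>2 * me) \<le> ennreal Q" .
    moreover have "l\<^sup>2 * me \<ge> 0" using me by simp
    moreover have "Q \<ge> 0" using \<phi>(4,6) by (auto simp: Q_def C1_def intro!: mult_nonneg_nonneg)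
    ultimately show ?thesis by (simp add: l_def ennreal_le_iff)
  qed
  \<comment> \<open>\<open>T\<close> is made so large that \<open>T * me\<close> exceeds
    \<open>Q\<close>, and \<open>d\<close> so small that half the logarithm is at least
    \<open>T\<close>. The added 1 gives \<open>T \<ge> 1\<close>, hence
    \<open>T \<le> T\<^sup>2\<close>.\<close>
  define T where "T = \<bar>Q\<bar> / me + 1"
  have T1: "T \<ge> 1" using me0 by (simp add: T_def)
  define d where "d = \<kappa> * exp (- 2 * T)"
  have d: "d > 0" using \<kappa> by (simp add: d_def)
  have "exp (2 * T) = \<kappa> / d" using \<kappa> by (simp add: d_def exp_minus field_simps)
  also have "\<dots> \<le> (\<kappa> + d) / d" using d by (intro divide_right_mono) auto
  finally have "2 * T \<le> ln ((\<kappa> + d) / d)" using \<kappa> d by (subst ln_ge_iff) (auto simp: add_pos_pos)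
  then have "T \<le> 1/2 * ln ((\<kappa> + d) / d)" by simp
  then have "T\<^sup>2 \<le> (1/2 * ln ((\<kappa> + d) / d))\<^sup>2" using T1 by (intro power_mono) auto
  moreover have "T \<le> T\<^sup>2" using T1 by (simp add: power2_eq_square)
  ultimately have "T * me \<le> Q" using key[OF d] me0 by (smt (verit) mult_right_mono)
  moreover have "T * me = \<bar>Q\<bar> + me" using me0 by (simp add: T_def field_simps)
  ultimately show False using me0 by linarith
qed

section \<open>Borel representatives of the positive part and the final contradiction\<close>

lemma adm_representative:
  assumes w: "adm w g" "\<And>x. w x \<ge> 0"
  obtains w' g' where "w' \<in> borel_measurable borel" "g' \<in> borel_measurable borel" "AE x in lebesgue. w x = w' x"
    "adm w' g'" "\<And>x. w' x \<ge> 0" "BB w' = BB w" "Psi w' g' = Psi w g"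
proof -
  have wg: "isgrad w g" using w by (simp add: adm_def)
  have I: "{0::real..} \<in> sets borel" "w x \<in> {0..}" for x using w(2) by auto
  obtain w' g' where r: "w' \<in> borel_measurable borel" "g' \<in> borel_measurable borel"
    "AE x in lebesgue. w x = w' x" "AE x in lebesgue. g x = g' x" "\<And>x. w' x \<in> {0..}"
    "sqi w'" "\<And>i. sqi (\<lambda>x. g' x $ i)" "\<And>i. wdir (axis i 1) w' (\<lambda>x. g' x $ i)"
    using isgrad_representative[OF wg I] by blast
  note [measurable] = isgradD(1,3)[OF wg] borel_measurable_lebesgueI[OF r(1)]
  have [measurable]: "g' \<in> borel_measurable lebesgue" using r(2) by (simp add: measurable_completion)
  have N: "NN w' = NN w" unfolding NN_def by (rule integral_cong_AE) (use r(3) in auto)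
  have P: "PP w' = PP w" unfolding PP_def by (rule integral_cong_AE) (use r(3) in auto)
  have Fe: "FF w' = FF w" unfolding FF_def by (rule integral_cong_AE) (use r(3) in auto)
  have A: "AA g' = AA g" unfolding AA_def by (rule integral_cong_AE) (use r(4) in auto)
  have "integrable lebesgue (\<lambda>x. (w' x)\<^sup>2)"
    by (rule integrable_cong_AE_imp[OF isgradD(2)[OF wg]]) (use r(3) in auto)
  moreover have "integrable lebesgue (\<lambda>x. (norm (g' x))\<^sup>2)"
    by (rule integrable_cong_AE_imp[OF isgradD(4)[OF wg]]) (use r(4) in auto)
  moreover have "has_weak_grad w' g'"
    using has_weak_grad_iff_wdir[OF _ _ r(1,2), of w' g'] r(8) by simp
  ultimately have "isgrad w' g'" by (simp add: isgrad_def)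
  moreover have "integrable lebesgue (\<lambda>x. f (w' x) * w' x)"
    by (rule integrable_cong_AE_imp[of _ "\<lambda>x. f (w x) * w x"]) (use r(3) w(1) in \<open>auto simp: adm_def\<close>)
  ultimately have "adm w' g'" by (simp add: adm_def)
  then show ?thesis
    using that[OF r(1,2,3)] r(5) N P Fe A by (simp add: BB_def QQ_def Psi_def)
qed

theorem not_attained: "\<not> (\<exists>u. u \<in> Mset V0 f \<and> Jfun V0 f u = c_hat V0 f)"
proof
  assume "\<exists>u. u \<in> Mset V0 f \<and> Jfun V0 f u = c_hat V0 f"
  then obtain u where u: "u \<in> Mset V0 f" "Jfun V0 f u = c_hat V0 f" by blast
  then obtain g where g: "isgrad u g" by (auto simp: Mset_def H1_iff)
  have nz: "nonzero (pos_part u)" "nonzero (neg_part u)" and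
    dJ: "dJ V0 f (pos_part u) (pos_part u) = 0" "dJ V0 f (neg_part u) (neg_part u) = 0"
    using u by (auto simp: Mset_def)
  note pt = Mset_parts[OF u(1) g]
  note p = adm_of_constraint[OF pt(1) nz(1) dJ(1)] and m = adm_of_constraint[OF pt(2) nz(2) dJ(2)]
  let ?gp = "\<lambda>x. if u x > 0 then g x else 0" and ?gm = "\<lambda>x. if u x < 0 then g x else 0"
  have min: "Psi (pos_part u) ?gp \<le> Psi v h" if "adm v h" "\<And>x. v x \<ge> 0" "BB v < 0" for v h
  proof -
    \<comment> \<open>The negative part of \<open>u\<close> itself serves as the second competitor,
      so its energy cancels and the minimality of the positive part remains.\<close>
    have "c_hat V0 f \<le> Psi v h + Psi (neg_part u) ?gm"
      by (rule Psi_sum_ge[OF that(1,3,2) m(1,3)]) (simp add: neg_part_def)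
    moreover have "c_hat V0 f = Psi (pos_part u) ?gp + Psi (neg_part u) ?gm"
      using u(2) pt(3) p(4) m(4) by simp
    ultimately show ?thesis by linarith
  qed
  obtain w' g' where r: "w' \<in> borel_measurable borel" "g' \<in> borel_measurable borel" "AE x in lebesgue. pos_part u x = w' x"
    "adm w' g'" "\<And>x. w' x \<ge> 0" "BB w' = BB (pos_part u)" "Psi w' g' = Psi (pos_part u) ?gp"
    using adm_representative[OF p(1)] by (auto simp: pos_part_def)
  have "AE x in lborel. w' x \<noteq> 0"
    by (rule minimizer_positive[OF r(4,5) _ _ _ r(1,2)]) (use r(6,7) p(3,4,5) min in auto)
  from AE_completion[OF this] r(3) have "AE x in lebesgue. neg_part u x = 0"
    by eventually_elim (auto simp: pos_part_def neg_part_def)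
  then show False using nz(2) by (simp add: nonzero_def)
qed

end

theorem theorem1p2:
  fixes V0 \<theta> p Cp :: real and f :: "real \<Rightarrow> real"
  assumes V0: "V0 > 0"
    and C1: "f C1_differentiable_on UNIV"
    and f1: "\<exists>C>0. \<forall>s. \<bar>f s\<bar> \<le> C * exp (4 * pi * s\<^sup>2)"
    and f2: "((\<lambda>s. f s / s) \<longlongrightarrow> 0) (at 0)"
    and f3: "\<theta> > 2" "\<forall>s. s \<noteq> 0 \<longrightarrow> 0 < \<theta> * Fprim f s \<and> \<theta> * Fprim f s \<le> s * f s"
    and f4: "strict_mono_on {0<..} (\<lambda>s. f s / \<bar>s\<bar>)"
    and f5: "p > 2" "Cp > 0" "\<forall>s. s \<noteq> 0 \<longrightarrow> sgn s * f s \<ge> Cp * \<bar>s\<bar> powr (p - 1)"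
    and Cp_bound: "Cp > (chi_p V0 p * (2 * \<theta> / (\<theta> - 2))) powr ((p - 2) / 2)"
  shows "(\<nexists>u. least_energy_nodal_solution V0 f u) \<and>
         (\<nexists>u. u \<in> Mset V0 f \<and> Jfun V0 f u = c_hat V0 f)"
proof -
  obtain D where D: "\<And>x. (f has_real_derivative D x) (at x)" "continuous_on UNIV D"
    using C1 unfolding C1_differentiable_on_def by (auto simp: has_real_derivative_iff_has_vector_derivative)
  have fc: "continuous_on UNIV f" using D(1) by (meson DERIV_isCont continuous_at_imp_continuous_on)
  have f0: "f 0 = 0"
  proof (rule tendsto_unique[of "at (0::real)"])
    show "(f \<longlongrightarrow> f 0) (at 0)" using fc by (simp add: continuous_on_def)
    have "((\<lambda>s. f s / s * s) \<longlongrightarrow> 0 * 0) (at 0)" by (intro tendsto_intros f2)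
    then have "((\<lambda>s. f s / s * s) \<longlongrightarrow> 0) (at 0)" by simp
    then show "(f \<longlongrightarrow> 0) (at 0)"
      by (rule Lim_transform_eventually) (auto simp: eventually_at_filter)
  qed simp
  \<comment> \<open>The derivative of \<open>f\<close> is continuous, hence bounded on the interval
    [0, 2] used for perturbations; its bound is the Lipschitz constant.\<close>
  have "compact (D ` {0..2})" by (intro compact_continuous_image continuous_on_subset[OF D(2)]) auto
  then obtain C where C: "C > 0" "\<And>x. x \<in> {0..2} \<Longrightarrow> \<bar>D x\<bar> \<le> C"
    by (metis bounded_pos compact_imp_bounded imageI real_norm_def)
  interpret nehari_lipschitz V0 \<theta> f C
  proof
    show "\<bar>f a - f b\<bar> \<le> C * (a - b)" if "0 \<le> b" "b \<le> a" "a \<le> 2" for a b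
      using field_differentiable_bound[of "{0..2}" f D C a b] that C(2) has_field_derivative_at_within[OF D(1)] by simp
  qed (use V0 fc f0 f3 C(1) in auto)
  \<comment> \<open>A least energy nodal solution in particular attains the infimum, so both claims
    follow at once.\<close>
  show ?thesis using not_attained by (auto simp: least_energy_nodal_solution_def)
qed

end
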